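(* Let $n\ge 3$. Let $U\subset \mathcal S^{n\times n}$ be an open set such that $O^{-1}UO=U$ for all $O\in O(n)$, and such that $U\cap\{M+tN \mid 0<t<\infty\}$ is convex for all $M\in\mathcal S^{n\times n}$ and all $N\in\mathcal S^{n\times n}_+$. Let $F\in C^1(U)$ satisfy: (a) $F(O^{-1}MO)=F(M)$ for all $M\in U$, $O\in O(n)$; (b) the matrix $\left(\frac{\partial F}{\partial M_{ij}}(M)\right)$ is positive definite for all $M\in U$; (c) for some $\delta>0$, $F(M)\ne 1$ for all $M\in U$ with $\|M\|<\delta$. Assume that $u\in C^2(B_2\setminus\{0\})$ satisfies $$u>0,\quad \Delta u\le 0,\quad A^u\in U,\quad F(A^u)=1\qquad\text{in } B_2\setminus\{0\}.$$ Then $$\limsup_{|y|\to 0}|y|^{\frac{n-2}{2}}u(y)<\infty .$$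
   Context: $\mathcal S^{n\times n}$ is the set of real symmetric $n\times n$ matrices, $\mathcal S^{n\times n}_+$ the subset of positive definite ones, $O(n)$ the real orthogonal $n\times n$ matrices, $\|M\|=(\sum_{i,j}M_{ij}^2)^{1/2}$. $B_a(x)\subset\mathbb R^n$ is the ball of radius $a$ centered at $x$, $B_a=B_a(0)$. For a positive $C^2$ function $u$, $$A^u=-\frac{2}{n-2}u^{-\frac{n+2}{n-2}}\nabla^2u+\frac{2n}{(n-2)^2}u^{-\frac{2n}{n-2}}\nabla u\otimes\nabla u-\frac{2}{(n-2)^2}u^{-\frac{2n}{n-2}}|\nabla u|^2 I,$$ where $\nabla u$ is the gradient, $\nabla^2u$ the Hessian of $u$ and $I$ the identity matrix. *)

theory Defs
  imports "HOL-Analysis.Analysis"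
begin

text \<open>The matrix \<open>A\<close> has entries \<open>A $ i $ j\<close>; the norm and the inner product that the library puts on
  \<open>real^'n^'n\<close> are the Frobenius ones.\<close>

definition sym_mats :: "(real^'n^'n) set" where
  "sym_mats = {M. transpose M = M}"

definition pos_def :: "real^'n^'n \<Rightarrow> bool" where
  "pos_def M \<longleftrightarrow> M \<in> sym_mats \<and> (\<forall>x. x \<noteq> 0 \<longrightarrow> 0 < x \<bullet> (M *v x))"

text \<open>Below, \<open>S\<close> is either an open set or a relatively open subset of the subspace of symmetric
  matrices, hence the derivative within \<open>S\<close>. In the second case the derivative is determined
  only on symmetric increments, and the definition asks for some continuous choice of it; this is
  the usual notion, since one can compose with the orthogonal projection onto that subspace.\<close>

definition C1_on :: "'a::real_normed_vector set \<Rightarrow> ('a \<Rightarrow> 'b::real_normed_vector) \<Rightarrow> bool" where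
  "C1_on S f \<longleftrightarrow>
     (\<exists>f' :: 'a \<Rightarrow> 'a \<Rightarrow>\<^sub>L 'b. (\<forall>x\<in>S. (f has_derivative blinfun_apply (f' x)) (at x within S)) \<and>
        continuous_on S f')"

definition C2_on :: "'a::real_normed_vector set \<Rightarrow> ('a \<Rightarrow> 'b::real_normed_vector) \<Rightarrow> bool" where
  "C2_on S f \<longleftrightarrow>
     (\<exists>f' :: 'a \<Rightarrow> 'a \<Rightarrow>\<^sub>L 'b. (\<forall>x\<in>S. (f has_derivative blinfun_apply (f' x)) (at x within S)) \<and>
        C1_on S f')"

definition dir_deriv :: "'a::real_normed_vector \<Rightarrow> ('a \<Rightarrow> real) \<Rightarrow> 'a \<Rightarrow> real" where
  "dir_deriv v f x = deriv (\<lambda>t. f (x + t *\<^sub>R v)) 0"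

abbreviation partial :: "'n \<Rightarrow> (real^'n \<Rightarrow> real) \<Rightarrow> real^'n \<Rightarrow> real" where
  "partial i \<equiv> dir_deriv (axis i 1)"

definition grad :: "(real^'n \<Rightarrow> real) \<Rightarrow> real^'n \<Rightarrow> real^'n" where
  "grad u x = (\<chi> i. partial i u x)"

definition hessian :: "(real^'n \<Rightarrow> real) \<Rightarrow> real^'n \<Rightarrow> real^'n^'n" where
  "hessian u x = (\<chi> i j. partial i (partial j u) x)"

definition laplacian :: "(real^'n \<Rightarrow> real) \<Rightarrow> real^'n \<Rightarrow> real" where
  "laplacian u x = (\<Sum>i\<in>UNIV. partial i (partial i u) x)"

definition tensor :: "real^'n \<Rightarrow> real^'n \<Rightarrow> real^'n^'n" where
  "tensor v w = (\<chi> i j. v $ i * w $ j)"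

definition conf_hessian :: "(real^'n \<Rightarrow> real) \<Rightarrow> real^'n \<Rightarrow> real^'n^'n" where
  "conf_hessian u x = (let n = real CARD('n) in
     (- (2 / (n - 2)) * u x powr (- ((n + 2) / (n - 2)))) *\<^sub>R hessian u x
     + (2 * n / (n - 2)\<^sup>2 * u x powr (- (2 * n / (n - 2)))) *\<^sub>R tensor (grad u x) (grad u x)
     - (2 / (n - 2)\<^sup>2 * u x powr (- (2 * n / (n - 2))) * (norm (grad u x))\<^sup>2) *\<^sub>R mat 1)"

text \<open>\<open>E\<^sub>i\<^sub>j = axis i (axis j 1)\<close> is the matrix unit. For a function \<open>F\<close> of symmetric matrices,
  \<open>\<partial>F/\<partial>M\<^sub>i\<^sub>j\<close> is taken with the usual convention that \<open>(\<partial>F/\<partial>M\<^sub>i\<^sub>j)\<close> is the symmetric matrix with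
  \<open>dF(M)[H] = (\<Sum>i j. \<partial>F/\<partial>M\<^sub>i\<^sub>j H\<^sub>i\<^sub>j)\<close> for symmetric \<open>H\<close>; equivalently, it is the ordinary partial
  derivative of \<open>M \<mapsto> F ((M + M\<^sup>T) / 2)\<close>.\<close>

definition sym_unit :: "'n \<Rightarrow> 'n \<Rightarrow> real^'n^'n" where
  "sym_unit i j = (1/2) *\<^sub>R (axis i (axis j 1) + axis j (axis i 1))"

definition mat_grad :: "(real^'n^'n \<Rightarrow> real) \<Rightarrow> real^'n^'n \<Rightarrow> real^'n^'n" where
  "mat_grad F M = (\<chi> i j. dir_deriv (sym_unit i j) F M)"

end

theory Submission
  imports Defs
begin

text \<open>Write \<open>n\<close> for the dimension, \<open>A\<^sup>u\<close> for the conformal Hessian and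
\<open>u\<^sub>x\<^sub>,\<^sub>l\<close> for the Kelvin transform of \<open>u\<close> in the sphere of radius \<open>l\<close> about \<open>x\<close>.

Suppose that \<open>|y|\<close> to the power \<open>(n-2)/2\<close> times \<open>u y\<close> is huge at some \<open>y\<close> close to the origin.
A weighted maximum (\<open>doubling\<close>) moves \<open>y\<close> to a point \<open>x\<^sub>0\<close> such that, with \<open>T = u x\<^sub>0\<close> and the
natural length \<open>a = T powr (- 2 / (n - 2))\<close>, the function \<open>u\<close> is at most a fixed multiple of \<open>T\<close> on a
ball about \<open>x\<^sub>0\<close> that avoids the origin and whose radius is a large multiple of \<open>a\<close>. The method of
moving spheres (locale \<open>moving_spheres\<close>) shows that \<open>u\<^sub>x\<^sub>,\<^sub>l \<le> u\<close> on the part of the unit ball outside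
the sphere, for all \<open>x\<close> near \<open>x\<^sub>0\<close> and all \<open>l < \<Lambda> = L * a\<close> with \<open>L\<close> large. In infinitesimal form this
is \<open>(n - 2) / 2 * u y + G y \<bullet> (y - x) \<ge> 0\<close> for \<open>y\<close> within \<open>\<Lambda>\<close> of \<open>x\<close>, where \<open>G\<close> is the gradient
(\<open>rate_nonneg\<close>); letting \<open>x\<close> run around \<open>y\<close> gives \<open>|G y| \<le> (n - 2) / \<Lambda> * u y\<close>
(\<open>gradient_estimate\<close>). So \<open>u\<close> is almost constant at scale \<open>a\<close>, and a slightly bent paraboloid touches it
from below near \<open>x\<^sub>0\<close>. At the contact point the Hessian is almost nonnegative, and its trace is nonpositive
because \<open>u\<close> is superharmonic; hence the Hessian, and with it \<open>A\<^sup>u\<close>, is small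
(\<open>nearly_flat_point\<close>). But \<open>F\<close> does not take the value 1 at small matrices of \<open>U\<close>.

The spheres can be moved because \<open>u\<^sub>x\<^sub>,\<^sub>l\<close> solves the same equation (\<open>solution_on_kelvin\<close>) and
because two solutions \<open>w \<le> u\<close> can be compared near a point \<open>p\<close> by a single barrier argument
(\<open>barrier_bound\<close>): \<open>w + \<epsilon> (exp (\<alpha> \<phi>) - 1 - \<tau>)\<close> is a strict subsolution for large \<open>\<alpha>\<close> and small
\<open>\<epsilon>\<close>, \<open>\<tau>\<close>, and a strict subsolution cannot touch \<open>u\<close> from below, since \<open>F\<close> is monotone in positive
semidefinite directions. With \<open>p\<close> an interior point this gives the strong maximum principle; with \<open>p\<close> on
the sphere it gives the boundary point lemma; with \<open>p = 0\<close>, where \<open>u\<close> may be singular, it gives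
\<open>u y \<ge> w y + c |y|\<close>, which the minimum principle for superharmonic functions on a punctured ball improves to
a positive gap at the origin (\<open>gap_at_singularity\<close>).\<close>

section \<open>Positive semidefinite matrices\<close>

definition pos_semidef :: "real^'n^'n \<Rightarrow> bool" where
  "pos_semidef M \<longleftrightarrow> M \<in> sym_mats \<and> (\<forall>x. 0 \<le> x \<bullet> (M *v x))"

lemma sym_mats_iff: "M \<in> sym_mats \<longleftrightarrow> (\<forall>i j. M $ i $ j = M $ j $ i)"
  by (auto simp: sym_mats_def transpose_def vec_eq_iff)

lemma subspace_sym_mats: "subspace sym_mats"
  unfolding subspace_def by (auto simp: sym_mats_iff)

lemma tensor_in_sym_mats [simp]: "tensor v v \<in> sym_mats"
  by (simp add: sym_mats_iff tensor_def)

lemma mat_in_sym_mats [simp]: "mat c \<in> sym_mats"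
  by (auto simp: sym_mats_iff mat_def)

lemma tensor_vector_mult: "tensor v w *v x = (w \<bullet> x) *\<^sub>R v"
  by (simp add: tensor_def matrix_vector_mult_def inner_vec_def vec_eq_iff sum_distrib_right
      sum_distrib_left mult_ac)

lemma mat_vector_mult: "mat c *v x = c *\<^sub>R (x :: real^'n)"
  by (simp add: matrix_vector_mult_def mat_def vec_eq_iff if_distrib if_distribR cong: if_cong)

lemma matrix_vector_axis: "((M :: real^'n^'n) *v axis j 1) $ i = M $ i $ j"
  by (simp add: matrix_vector_mul_component inner_axis)

lemma sym_mats_inner:
  assumes "M \<in> sym_mats" shows "x \<bullet> (M *v y) = y \<bullet> (M *v x)"
  using assms unfolding sym_mats_def
  by (metis (mono_tags, lifting) dot_lmul_matrix inner_commute mem_Collect_eq vector_transpose_matrix)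

lemma pos_semidef_diag: "pos_semidef M \<Longrightarrow> 0 \<le> M $ i $ i"
  unfolding pos_semidef_def
  by (metis inner_axis' matrix_vector_axis scaleR_one inner_real_def mult_1)

lemma pos_semidef_off_diag:
  assumes "pos_semidef M" shows "2 * \<bar>M $ i $ j\<bar> \<le> M $ i $ i + M $ j $ j"
proof -
  have s: "M $ j $ i = M $ i $ j"
    using assms by (auto simp: pos_semidef_def sym_mats_iff)
  have q: "0 \<le> M $ i $ i + 2 * t * M $ i $ j + t\<^sup>2 * M $ j $ j" for t
  proof -
    let ?x = "axis i 1 + t *\<^sub>R axis j (1::real)"
    have "?x \<bullet> (M *v ?x) = M $ i $ i + 2 * t * M $ i $ j + t\<^sup>2 * M $ j $ j"
      by (simp add: inner_add_left matrix_vector_right_distrib inner_axis' matrix_vector_axis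
          matrix_vector_mult_scaleR s power2_eq_square algebra_simps)
    then show ?thesis using assms unfolding pos_semidef_def by metis
  qed
  show ?thesis using q[of 1] q[of "-1"] by simp
qed

text \<open>A positive semidefinite matrix is a sum of matrices \<open>tensor v v\<close>: if the diagonal entry \<open>N $ i $ i\<close> is
not zero, then subtracting the rank-one matrix built from column \<open>i\<close> leaves a positive semidefinite matrix
(the Schur complement) with at least one more zero on the diagonal. This replaces diagonalization.\<close>

lemma pos_semidef_rank_one_induct [consumes 1, case_names zero add]:
  fixes N :: "real^'n^'n"
  assumes "pos_semidef N" and zero: "Q 0" and add: "\<And>M v. Q M \<Longrightarrow> Q (M + tensor v v)"
  shows "Q N"
  using assms(1)
proof (induction "card {i. N $ i $ i \<noteq> 0}" arbitrary: N rule: less_induct)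
  case less
  show ?case
  proof (cases "\<forall>i. N $ i $ i = 0")
    case True
    then have "N = 0"
      using pos_semidef_off_diag[OF less.prems] by (simp add: vec_eq_iff)
    then show ?thesis using zero by simp
  next
    case False
    then obtain i where i: "N $ i $ i \<noteq> 0" by blast
    have d: "0 < N $ i $ i" using pos_semidef_diag[OF less.prems, of i] i by simp
    have sym: "N \<in> sym_mats" using less.prems by (simp add: pos_semidef_def)
    let ?a = "N *v axis i 1"
    let ?v = "(1 / sqrt (N $ i $ i)) *\<^sub>R ?a"
    let ?M = "N - tensor ?v ?v"
    have diag: "?M $ j $ j = N $ j $ j - (N $ j $ i)\<^sup>2 / N $ i $ i" for j
      using d by (simp add: tensor_def matrix_vector_axis power2_eq_square)
    have "pos_semidef ?M"
      unfolding pos_semidef_def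
    proof (intro conjI allI)
      show "?M \<in> sym_mats" by (rule subspace_diff[OF subspace_sym_mats sym]) simp
      fix x :: "real^'n"
      \<comment> \<open>the value of the form of \<open>N\<close> at \<open>x - t e\<^sub>i\<close> is smallest for this \<open>t\<close>\<close>
      let ?t = "(x \<bullet> ?a) / N $ i $ i"
      have "0 \<le> (x - ?t *\<^sub>R axis i 1) \<bullet> (N *v (x - ?t *\<^sub>R axis i 1))"
        using less.prems unfolding pos_semidef_def by blast
      also have "\<dots> = x \<bullet> (N *v x) - 2 * ?t * (x \<bullet> ?a) + ?t\<^sup>2 * N $ i $ i"
        using sym_mats_inner[OF sym, of "axis i 1" x]
        by (simp add: inner_diff_left matrix_vector_mult_diff_distrib inner_diff_right
           matrix_vector_mult_scaleR power2_eq_square algebra_simps inner_axis' matrix_vector_axis)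
      also have "\<dots> = x \<bullet> (N *v x) - (x \<bullet> ?a)\<^sup>2 / N $ i $ i"
        using d by (simp add: power2_eq_square field_simps)
      also have "\<dots> = x \<bullet> (?M *v x)"
        using d by (simp add: matrix_vector_mult_diff_rdistrib tensor_vector_mult inner_diff_right
            inner_commute power2_eq_square)
      finally show "0 \<le> x \<bullet> (?M *v x)" .
    qed
    moreover have "card {j. ?M $ j $ j \<noteq> 0} < card {j. N $ j $ j \<noteq> 0}"
    proof (rule psubset_card_mono)
      have "?M $ j $ j = 0" if "N $ j $ j = 0" for j
      proof -
        have "0 \<le> ?M $ j $ j" using pos_semidef_diag[OF calculation] .
        then show ?thesis using d that unfolding diag by (simp add: divide_le_0_iff)
      qed
      moreover have "?M $ i $ i = 0" unfolding diag using d by (simp add: power2_eq_square)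
      ultimately show "{j. ?M $ j $ j \<noteq> 0} \<subset> {j. N $ j $ j \<noteq> 0}" using i by blast
    qed simp
    ultimately have "Q ?M" using less.hyps by blast
    from add[OF this, of ?v] show ?thesis by simp
  qed
qed

lemma norm_matrix_le_trace:
  fixes M :: "real^'n^'n"
  assumes "pos_semidef M"
  shows "norm M \<le> (real CARD('n))\<^sup>2 * (\<Sum>i\<in>UNIV. M $ i $ i)"
proof -
  let ?t = "\<Sum>i\<in>UNIV. M $ i $ i"
  have le: "M $ i $ i \<le> ?t" for i
    by (rule member_le_sum) (auto intro: pos_semidef_diag[OF assms])
  have "\<bar>M $ i $ j\<bar> \<le> ?t" for i j
    using pos_semidef_off_diag[OF assms, of i j] le[of i] le[of j] by linarith
  then have "norm (M $ i) \<le> real CARD('n) * ?t" for i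
    using norm_le_l1_cart[of "M $ i"] sum_bounded_above[of UNIV "\<lambda>j. \<bar>M $ i $ j\<bar>" ?t] 
    by (meson UNIV_I order_trans)
  then have "(\<Sum>i\<in>UNIV. norm (M $ i)) \<le> real CARD('n) * (real CARD('n) * ?t)"
    by (meson sum_bounded_above UNIV_I)
  moreover have "norm M \<le> (\<Sum>i\<in>UNIV. norm (M $ i))"
    unfolding norm_vec_def by (rule L2_set_le_sum) simp
  ultimately show ?thesis by (simp add: power2_eq_square mult.assoc)
qed

lemma pos_semidef_scale: "pos_semidef N \<Longrightarrow> 0 \<le> c \<Longrightarrow> pos_semidef (c *\<^sub>R N)"
  by (auto simp: pos_semidef_def subspace_scale subspace_sym_mats scaleR_matrix_vector_assoc[symmetric])

lemma pos_semidef_tensor: "pos_semidef (tensor v v)"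
  by (simp add: pos_semidef_def tensor_vector_mult inner_commute)

lemma norm_tensor_le: "norm (tensor v v) \<le> (real CARD('n))\<^sup>2 * (norm v)\<^sup>2" for v :: "real^'n"
  using norm_matrix_le_trace[OF pos_semidef_tensor, of v]
  by (simp add: tensor_def power2_norm_eq_inner inner_vec_def)

lemma pos_semidef_mat: "0 \<le> c \<Longrightarrow> pos_semidef (mat c)"
  by (simp add: pos_semidef_def mat_vector_mult)

lemma norm_mat_le: "norm (mat 1 :: real^'n^'n) \<le> (real CARD('n))^3"
  using norm_matrix_le_trace[OF pos_semidef_mat[of 1], where 'n = 'n]
  by (simp add: mat_def power2_eq_square power3_eq_cube)

section \<open>Functions with a continuous second derivative\<close>

lemma bilinear_tensor: "bilinear (tensor :: real^'n \<Rightarrow> real^'n \<Rightarrow> real^'n^'n)"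
  unfolding bilinear_def linear_iff by (auto simp: tensor_def vec_eq_iff algebra_simps)

lemma bounded_bilinear_tensor: "bounded_bilinear (tensor :: real^'n \<Rightarrow> real^'n \<Rightarrow> real^'n^'n)"
  using bilinear_tensor by (simp add: bilinear_conv_bounded_bilinear)

lemmas tendsto_tensor [tendsto_intros] = bounded_bilinear.tendsto [OF bounded_bilinear_tensor]
lemmas continuous_on_tensor [continuous_intros] =
  bounded_bilinear.continuous_on [OF bounded_bilinear_tensor]
lemmas has_vector_derivative_tensor [derivative_intros] =
  bounded_bilinear.has_vector_derivative [OF bounded_bilinear_tensor]

text \<open>A \<open>C\<^sup>2\<close> function together with its gradient \<open>G\<close> and the matrix \<open>H\<close> of the derivative of \<open>G\<close>. Keeping \<open>G\<close> and
\<open>H\<close> as explicit functions lets sums, barriers and Kelvin transforms be differentiated by formula.\<close>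

definition second_order_on ::
  "(real^'n) set \<Rightarrow> (real^'n \<Rightarrow> real) \<Rightarrow> (real^'n \<Rightarrow> real^'n) \<Rightarrow> (real^'n \<Rightarrow> real^'n^'n) \<Rightarrow> bool" where
  "second_order_on V u G H \<longleftrightarrow> open V \<and>
     (\<forall>y\<in>V. (u has_derivative (\<lambda>v. G y \<bullet> v)) (at y)) \<and>
     (\<forall>y\<in>V. (G has_derivative (\<lambda>v. H y *v v)) (at y)) \<and> continuous_on V H"

lemma second_order_onD:
  assumes "second_order_on V u G H"
  shows "open V" "y \<in> V \<Longrightarrow> (u has_derivative (\<lambda>v. G y \<bullet> v)) (at y)"
    "y \<in> V \<Longrightarrow> (G has_derivative (\<lambda>v. H y *v v)) (at y)" "continuous_on V H"
  using assms by (auto simp: second_order_on_def)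

lemma second_order_on_continuous:
  assumes "second_order_on V u G H"
  shows "continuous_on V u" "continuous_on V G" "continuous_on V H"
proof -
  show "continuous_on V u" "continuous_on V G"
    using second_order_onD[OF assms] by (meson continuous_at_imp_continuous_on has_derivative_continuous)+
  show "continuous_on V H" using second_order_onD[OF assms] by blast
qed

lemma second_order_on_tendsto:
  assumes "second_order_on V u G H" "y \<in> V"
  shows "(u \<longlongrightarrow> u y) (nhds y)" "(G \<longlongrightarrow> G y) (nhds y)" "(H \<longlongrightarrow> H y) (nhds y)"
  using second_order_on_continuous[OF assms(1)] assms second_order_onD(1)[OF assms(1)]
  by (metis continuous_on_eq_continuous_at isCont_def tendsto_at_iff_tendsto_nhds)+

lemma second_order_on_subset:
  assumes "second_order_on V u G H" "open W" "W \<subseteq> V"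
  shows "second_order_on W u G H"
  using assms unfolding second_order_on_def by (meson continuous_on_subset subset_iff)

lemma second_order_on_add:
  assumes "second_order_on V u G H" "second_order_on V u' G' H'"
  shows "second_order_on V (\<lambda>y. u y + u' y) (\<lambda>y. G y + G' y) (\<lambda>y. H y + H' y)"
  using assms unfolding second_order_on_def
  by (auto intro!: derivative_eq_intros continuous_intros simp: inner_add_left matrix_vector_mult_add_rdistrib)

lemma second_order_on_cmul:
  assumes "second_order_on V u G H"
  shows "second_order_on V (\<lambda>y. c * u y) (\<lambda>y. c *\<^sub>R G y) (\<lambda>y. c *\<^sub>R H y)"
  using assms unfolding second_order_on_def
  by (auto intro!: derivative_eq_intros continuous_intros simp: scaleR_matrix_vector_assoc)

lemma second_order_on_diff:
  assumes "second_order_on V u G H" "second_order_on V u' G' H'"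
  shows "second_order_on V (\<lambda>y. u y - u' y) (\<lambda>y. G y - G' y) (\<lambda>y. H y - H' y)"
  using second_order_on_add[OF assms(1) second_order_on_cmul[OF assms(2), of "-1"]] by simp

lemma second_order_on_affine:
  assumes "open V"
  shows "second_order_on V (\<lambda>y. a + b \<bullet> (y - p)) (\<lambda>y. b) (\<lambda>y. 0)"
  using assms unfolding second_order_on_def by (auto intro!: derivative_eq_intros)

lemma second_order_on_square:
  fixes p :: "real^'n"
  assumes "open V"
  shows "second_order_on V (\<lambda>y. (norm (y - p))\<^sup>2) (\<lambda>y. 2 *\<^sub>R (y - p)) (\<lambda>y. mat 2)"
  unfolding second_order_on_def power2_norm_eq_inner mat_vector_mult
proof (intro conjI ballI assms continuous_intros)
  fix y :: "real^'n"
  show "((\<lambda>y. (y - p) \<bullet> (y - p)) has_derivative (\<bullet>) (2 *\<^sub>R (y - p))) (at y)"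
    by (rule derivative_eq_intros | rule refl | simp add: fun_eq_iff inner_commute algebra_simps)+
  have "((\<lambda>y. 2 *\<^sub>R (y - p)) has_derivative (\<lambda>v. 2 *\<^sub>R (v - 0))) (at y)"
    by (intro derivative_intros)
  then show "((\<lambda>y. 2 *\<^sub>R (y - p)) has_derivative (*\<^sub>R) 2) (at y)" by simp
qed

lemma second_order_on_exp:
  assumes "second_order_on V u G H"
  shows "second_order_on V (\<lambda>y. exp (u y)) (\<lambda>y. exp (u y) *\<^sub>R G y)
           (\<lambda>y. exp (u y) *\<^sub>R (H y + tensor (G y) (G y)))"
  unfolding second_order_on_def
proof (intro conjI ballI)
  note D = second_order_onD[OF assms]
  show "open V" by (rule D)
  show "((\<lambda>y. exp (u y)) has_derivative (\<lambda>v. exp (u y) *\<^sub>R G y \<bullet> v)) (at y)" if "y \<in> V" for y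
    using D(2)[OF that] by (auto intro!: derivative_eq_intros)
  show "((\<lambda>y. exp (u y) *\<^sub>R G y) has_derivative (*v) (exp (u y) *\<^sub>R (H y + tensor (G y) (G y)))) (at y)"
    if "y \<in> V" for y
    using D(2,3)[OF that]
    by (auto intro!: derivative_eq_intros
        simp: scaleR_matrix_vector_assoc[symmetric] matrix_vector_mult_add_rdistrib tensor_vector_mult
         algebra_simps)
  show "continuous_on V (\<lambda>y. exp (u y) *\<^sub>R (H y + tensor (G y) (G y)))"
    using second_order_on_continuous[OF assms] by (intro continuous_intros)
qed

lemma dir_deriv_eq:
  assumes "(f has_derivative f') (at x)"
  shows "dir_deriv v f x = f' v"
proof -
  have "((\<lambda>t. f (x + t *\<^sub>R v)) has_derivative (\<lambda>t. f' (t *\<^sub>R v))) (at 0)"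
    by (rule has_derivative_compose[where f = "\<lambda>t. x + t *\<^sub>R v" and g = f])
      (auto intro!: derivative_eq_intros assms)
  moreover have "f' (t *\<^sub>R v) = f' v * t" for t
    using linear_scale[OF has_derivative_linear[OF assms], of t v] by simp
  ultimately have "((\<lambda>t. f (x + t *\<^sub>R v)) has_field_derivative f' v) (at 0)"
    by (simp add: has_field_derivative_def)
  then show ?thesis by (simp add: dir_deriv_def DERIV_imp_deriv)
qed

lemma partial_eq:
  assumes "second_order_on V u G H" "y \<in> V"
  shows "partial i u y = G y $ i"
  using dir_deriv_eq[OF second_order_onD(2)[OF assms]] by (simp add: inner_axis)

lemma partial_partial_eq:
  assumes "second_order_on V u G H" "y \<in> V"
  shows "partial i (partial j u) y = H y $ j $ i"
proof -
  have "((\<lambda>z. G z $ j) has_derivative (\<lambda>v. (H y *v v) $ j)) (at y)"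
    using second_order_onD(3)[OF assms] bounded_linear.has_derivative[OF bounded_linear_vec_nth] by blast
  then have "(partial j u has_derivative (\<lambda>v. (H y *v v) $ j)) (at y)"
    by (rule has_derivative_transform_within_open[OF _ second_order_onD(1)[OF assms(1)] assms(2)])
      (simp add: partial_eq[OF assms(1)])
  from dir_deriv_eq[OF this] show ?thesis by (simp add: matrix_vector_axis)
qed

lemma grad_eq: "second_order_on V u G H \<Longrightarrow> y \<in> V \<Longrightarrow> grad u y = G y"
  by (simp add: grad_def vec_eq_iff partial_eq)

lemma hessian_eq: "second_order_on V u G H \<Longrightarrow> y \<in> V \<Longrightarrow> hessian u y = transpose (H y)"
  by (simp add: hessian_def transpose_def vec_eq_iff partial_partial_eq)

lemma laplacian_eq:
  "second_order_on V u G H \<Longrightarrow> y \<in> V \<Longrightarrow> laplacian u y = (\<Sum>i\<in>UNIV. H y $ i $ i)"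
  by (simp add: laplacian_def partial_partial_eq)

lemma axis_expansion: "(\<Sum>i\<in>UNIV. v $ i *\<^sub>R axis i 1) = (v :: real^'n)"
  using basis_expansion[of v] by (simp only: scalar_mult_eq_scaleR)

text \<open>The linear functional \<open>f' x\<close> is represented by the vector of its values on the standard basis, and this
representation is linear, so it can be applied to the derivative of \<open>f'\<close>.\<close>

lemma C2_on_imp_second_order_on:
  fixes u :: "real^'n \<Rightarrow> real"
  assumes "C2_on V u" "open V"
  obtains G H where "second_order_on V u G H"
proof -
  obtain f' where f': "\<And>x. x \<in> V \<Longrightarrow> (u has_derivative blinfun_apply (f' x)) (at x within V)"
    and "C1_on V f'"
    using assms(1) unfolding C2_on_def by blast
  then obtain f'' where
    f'': "\<And>x. x \<in> V \<Longrightarrow> (f' has_derivative blinfun_apply (f'' x)) (at x within V)"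
    and cont: "continuous_on V f''"
    unfolding C1_on_def by blast
  let ?L = "\<lambda>\<phi> :: (real^'n) \<Rightarrow>\<^sub>L real. (\<chi> i. blinfun_apply \<phi> (axis i 1)) :: real^'n"
  have L: "bounded_linear ?L"
  proof (rule bounded_linear_intro)
    fix \<phi> :: "(real^'n) \<Rightarrow>\<^sub>L real"
    have "\<bar>\<phi> (axis i 1)\<bar> \<le> norm \<phi>" for i
      using norm_blinfun[of \<phi> "axis i 1"] by simp
    then have "(\<Sum>i\<in>UNIV. \<bar>\<phi> (axis i 1)\<bar>) \<le> real CARD('n) * norm \<phi>"
      by (meson sum_bounded_above UNIV_I)
    then show "norm (?L \<phi>) \<le> norm \<phi> * real CARD('n)"
      using norm_le_l1_cart[of "?L \<phi>"] by (simp add: mult.commute)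
  qed (auto simp: vec_eq_iff blinfun.add_left blinfun.scaleR_left)
  have repr: "\<phi> v = ?L \<phi> \<bullet> v" for \<phi> :: "(real^'n) \<Rightarrow>\<^sub>L real" and v
  proof -
    have "\<phi> v = \<phi> (\<Sum>i\<in>UNIV. v $ i *\<^sub>R axis i 1)"
      by (simp add: axis_expansion)
    also have "\<dots> = ?L \<phi> \<bullet> v"
      by (simp add: blinfun.sum_right blinfun.scaleR_right inner_vec_def mult.commute)
    finally show ?thesis .
  qed
  let ?H = "\<lambda>x. (\<chi> i j. f'' x (axis j 1) (axis i 1)) :: real^'n^'n"
  have H: "?L (f'' x v) = ?H x *v v" for x v
  proof -
    have "f'' x v = f'' x (\<Sum>i\<in>UNIV. v $ i *\<^sub>R axis i 1)"
      by (simp add: axis_expansion)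
    also have "\<dots> = (\<Sum>i\<in>UNIV. v $ i *\<^sub>R f'' x (axis i 1))"
      by (simp add: blinfun.sum_right blinfun.scaleR_right)
    finally have *: "f'' x v = (\<Sum>i\<in>UNIV. v $ i *\<^sub>R f'' x (axis i 1))" .
    show ?thesis
      unfolding * by (simp add: vec_eq_iff matrix_vector_mult_def blinfun.sum_left blinfun.scaleR_left mult.commute)
  qed
  have "second_order_on V u (\<lambda>x. ?L (f' x)) ?H"
    unfolding second_order_on_def
  proof (intro conjI ballI)
    fix x assume x: "x \<in> V"
    note w = at_within_open[OF x assms(2)]
    show "(u has_derivative (\<lambda>v. ?L (f' x) \<bullet> v)) (at x)"
      using f'[OF x] unfolding w repr[of "f' x", symmetric] .
    show "((\<lambda>x. ?L (f' x)) has_derivative (*v) (?H x)) (at x)"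
      using bounded_linear.has_derivative[OF L f''[OF x]] unfolding w H .
  next
    show "continuous_on V ?H"
      by (intro continuous_intros cont)
  qed (rule assms)
  then show ?thesis by (rule that)
qed

text \<open>If \<open>v \<bullet> (H p *v v)\<close> were negative, then the derivative of \<open>g\<close> along the line through \<open>p\<close> in direction \<open>v\<close>,
which vanishes at \<open>p\<close>, would be negative just after \<open>p\<close>, and \<open>g\<close> would drop below \<open>g p\<close>.\<close>

lemma second_order_on_min:
  assumes so: "second_order_on V g G H" and p: "p \<in> V" and min: "\<And>y. y \<in> V \<Longrightarrow> g p \<le> g y"
  shows "G p = 0" and "0 \<le> v \<bullet> (H p *v v)"
proof -
  note D = second_order_onD[OF so]
  have 0: "G p \<bullet> v = 0" for v
  proof -
    have "(\<lambda>v. G p \<bullet> v) = (\<lambda>v. 0)"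
      by (rule differential_zero_maxmin[OF p D(1) D(2)[OF p]]) (use min in blast)
    then show ?thesis by metis
  qed
  show "G p = 0" using 0[of "G p"] by simp
  show "0 \<le> v \<bullet> (H p *v v)"
  proof (rule ccontr)
    assume neg: "\<not> 0 \<le> v \<bullet> (H p *v v)"
    have "((\<lambda>t. G (p + t *\<^sub>R v) \<bullet> v) has_derivative (\<lambda>t. (H p *v (t *\<^sub>R v)) \<bullet> v)) (at 0)"
      by (intro derivative_intros has_derivative_compose[where f = "\<lambda>t. p + t *\<^sub>R v" and g = G])
        (auto intro!: derivative_eq_intros D(3)[OF p])
    then have "((\<lambda>t. G (p + t *\<^sub>R v) \<bullet> v) has_real_derivative (v \<bullet> (H p *v v))) (at 0)"
      by (simp add: has_field_derivative_def matrix_vector_mult_scaleR inner_commute mult_commute_abs)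
    from has_real_derivative_neg_dec_right[OF this] neg 0
    obtain d where d: "d > 0" "\<And>t. 0 < t \<Longrightarrow> t < d \<Longrightarrow> G (p + t *\<^sub>R v) \<bullet> v < 0"
      by auto
    have "((\<lambda>t. p + t *\<^sub>R v) \<longlongrightarrow> p + 0 *\<^sub>R v) (nhds 0)" by (intro tendsto_intros filterlim_ident)
    then have "eventually (\<lambda>t. p + t *\<^sub>R v \<in> V) (nhds 0)"
      using D(1) p by (intro topological_tendstoD) auto
    then obtain r where r: "r > 0" "\<And>t. \<bar>t\<bar> < r \<Longrightarrow> p + t *\<^sub>R v \<in> V"
      unfolding eventually_nhds_metric by (auto simp: dist_real_def)
    let ?t = "min d r / 2"
    have t: "0 < ?t" "?t < d" "?t < r" using d(1) r(1) by auto
    have "g (p + ?t *\<^sub>R v) < g (p + 0 *\<^sub>R v)"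
    proof (rule DERIV_neg_imp_decreasing_open[of 0 ?t "\<lambda>t. g (p + t *\<^sub>R v)"])
      have dg: "((\<lambda>t. g (p + t *\<^sub>R v)) has_real_derivative (G (p + s *\<^sub>R v) \<bullet> v)) (at s)"
        if "0 \<le> s" "s \<le> ?t" for s
      proof -
        have "p + s *\<^sub>R v \<in> V" using r(2)[of s] that t by auto
        from D(2)[OF this]
        have "((\<lambda>t. g (p + t *\<^sub>R v)) has_derivative (\<lambda>t. G (p + s *\<^sub>R v) \<bullet> (t *\<^sub>R v))) (at s)"
          by (intro has_derivative_compose[where f = "\<lambda>t. p + t *\<^sub>R v" and g = g])
            (auto intro!: derivative_eq_intros)
        then show ?thesis by (simp add: has_field_derivative_def mult_commute_abs)
      qed
      show "\<exists>y. ((\<lambda>t. g (p + t *\<^sub>R v)) has_real_derivative y) (at s) \<and> y < 0" if "0 < s" "s < ?t" for s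
        using dg[of s] d(2)[of s] that t by force
      show "continuous_on {0..?t} (\<lambda>t. g (p + t *\<^sub>R v))"
        by (rule continuous_at_imp_continuous_on) (use dg DERIV_isCont in \<open>meson atLeastAtMost_iff\<close>)
    qed (use t in auto)
    moreover have "g p \<le> g (p + ?t *\<^sub>R v)" using min r(2)[of ?t] t by auto
    ultimately show False by simp
  qed
qed

section \<open>The conformal Hessian as a function of the two-jet\<close>

text \<open>The arguments stand for the value, the gradient and the Hessian of the function at one point.\<close>

definition conf_op :: "real \<Rightarrow> real^'n \<Rightarrow> real^'n^'n \<Rightarrow> real^'n^'n" where
  "conf_op t g H = (let n = real CARD('n) in
     (- (2 / (n - 2)) * t powr (- ((n + 2) / (n - 2)))) *\<^sub>R H
     + (2 * n / (n - 2)\<^sup>2 * t powr (- (2 * n / (n - 2)))) *\<^sub>R tensor g g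
     - (2 / (n - 2)\<^sup>2 * t powr (- (2 * n / (n - 2))) * (norm g)\<^sup>2) *\<^sub>R mat 1)"

text \<open>The directional derivative of \<open>conf_op\<close> at \<open>(t, g, H)\<close> in direction \<open>(t', g', H')\<close>.\<close>

definition conf_op_deriv :: "real \<Rightarrow> real^'n \<Rightarrow> real^'n^'n \<Rightarrow> real \<Rightarrow> real^'n \<Rightarrow> real^'n^'n \<Rightarrow> real^'n^'n" where
  "conf_op_deriv t g H t' g' H' = (let n = real CARD('n);
       a = - ((n + 2) / (n - 2)); b = - (2 * n / (n - 2)) in
     (- (2 / (n - 2))) *\<^sub>R ((a * t powr (a - 1) * t') *\<^sub>R H + (t powr a) *\<^sub>R H')
     + (2 * n / (n - 2)\<^sup>2) *\<^sub>R ((b * t powr (b - 1) * t') *\<^sub>R tensor g g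
          + (t powr b) *\<^sub>R (tensor g g' + tensor g' g))
     - (2 / (n - 2)\<^sup>2 * (b * t powr (b - 1) * t' * (g \<bullet> g) + t powr b * (2 * (g \<bullet> g')))) *\<^sub>R mat 1)"

lemma conf_hessian_eq:
  assumes "second_order_on V u G H" "y \<in> V" "H y \<in> sym_mats"
  shows "conf_hessian u y = conf_op (u y) (G y) (H y)"
  using assms(3) unfolding conf_hessian_def conf_op_def grad_eq[OF assms(1,2)] hessian_eq[OF assms(1,2)]
  by (simp add: sym_mats_def)

lemma conf_op_in_sym_mats:
  fixes H :: "real^'n^'n"
  assumes "H \<in> sym_mats" shows "conf_op t g H \<in> sym_mats"
  unfolding conf_op_def Let_def
  by (intro subspace_add subspace_diff subspace_scale subspace_sym_mats) (use assms in auto)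

text \<open>All terms of \<open>conf_op\<close> other than the multiple of \<open>H\<close> are symmetric. So the symmetry of the Hessian of a
solution comes for free with \<open>U\<close> consisting of symmetric matrices.\<close>

lemma second_derivative_in_sym_mats:
  fixes H :: "real^'n^'n"
  assumes "CARD('n) \<ge> 3" "0 < t" "conf_op t g H \<in> sym_mats" shows "H \<in> sym_mats"
proof -
  define c where "c = - (2 / (real CARD('n) - 2)) * t powr (- ((real CARD('n) + 2) / (real CARD('n) - 2)))"
  have c: "c \<noteq> 0" using assms(1,2) by (simp add: c_def)
  have "conf_op t g H - conf_op t g 0 = c *\<^sub>R H"
    by (simp add: conf_op_def c_def Let_def)
  moreover have "conf_op t g 0 \<in> sym_mats"
    by (rule conf_op_in_sym_mats) (simp add: sym_mats_iff)
  ultimately have "c *\<^sub>R H \<in> sym_mats"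
    using subspace_diff[OF subspace_sym_mats assms(3)] by metis
  then have "(1 / c) *\<^sub>R c *\<^sub>R H \<in> sym_mats"
    by (rule subspace_scale[OF subspace_sym_mats])
  then show ?thesis using c by simp
qed

lemma conf_op_has_vector_derivative:
  fixes g :: "real^'n"
  assumes "0 < t + s * t'"
  shows "((\<lambda>s. conf_op (t + s * t') (g + s *\<^sub>R g') (H + s *\<^sub>R H')) has_vector_derivative
     conf_op_deriv (t + s * t') (g + s *\<^sub>R g') (H + s *\<^sub>R H') t' g' H') (at s)"
proof -
  have p: "((\<lambda>s. (t + s * t') powr a) has_real_derivative a * (t + s * t') powr (a - 1) * t') (at s)" for a
    using assms by (auto intro!: derivative_eq_intros)
  note vd = p[unfolded has_real_derivative_iff_has_vector_derivative]
  have l: "((\<lambda>s. g + s *\<^sub>R g') has_vector_derivative g') (at s)"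
    by (auto intro!: derivative_eq_intros)
  have lH: "((\<lambda>s. H + s *\<^sub>R H') has_vector_derivative H') (at s)"
    by (auto intro!: derivative_eq_intros)
  have q: "((\<lambda>s. (g + s *\<^sub>R g') \<bullet> (g + s *\<^sub>R g')) has_real_derivative 2 * ((g + s *\<^sub>R g') \<bullet> g')) (at s)"
    unfolding has_real_derivative_iff_has_vector_derivative
    using bounded_bilinear.has_vector_derivative[OF bounded_bilinear_inner l l]
    by (simp add: inner_commute)
  have t: "((\<lambda>s. tensor (g + s *\<^sub>R g') (g + s *\<^sub>R g')) has_vector_derivative
      tensor (g + s *\<^sub>R g') g' + tensor g' (g + s *\<^sub>R g')) (at s)"
    by (rule has_vector_derivative_tensor[OF l l])
  have h: "((\<lambda>s. (c * (t + s * t') powr a) *\<^sub>R (H + s *\<^sub>R H')) has_vector_derivative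
      c *\<^sub>R ((a * (t + s * t') powr (a - 1) * t') *\<^sub>R (H + s *\<^sub>R H') + ((t + s * t') powr a) *\<^sub>R H')) (at s)" for c a
    by (rule has_vector_derivative_eq_rhs[OF has_vector_derivative_scaleR[OF DERIV_cmult[OF p] lH]])
      (simp add: scaleR_add_right)
  have g: "((\<lambda>s. (c * (t + s * t') powr b) *\<^sub>R tensor (g + s *\<^sub>R g') (g + s *\<^sub>R g')) has_vector_derivative
      c *\<^sub>R ((b * (t + s * t') powr (b - 1) * t') *\<^sub>R tensor (g + s *\<^sub>R g') (g + s *\<^sub>R g')
         + ((t + s * t') powr b) *\<^sub>R (tensor (g + s *\<^sub>R g') g' + tensor g' (g + s *\<^sub>R g')))) (at s)" for c b
    by (rule has_vector_derivative_eq_rhs[OF has_vector_derivative_scaleR[OF DERIV_cmult[OF p] t]])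
      (simp add: scaleR_add_right)
  have m: "((\<lambda>s. (c * (t + s * t') powr b * ((g + s *\<^sub>R g') \<bullet> (g + s *\<^sub>R g'))) *\<^sub>R (mat 1 :: real^'n^'n))
      has_vector_derivative
      (c * (b * (t + s * t') powr (b - 1) * t' * ((g + s *\<^sub>R g') \<bullet> (g + s *\<^sub>R g'))
         + (t + s * t') powr b * (2 * ((g + s *\<^sub>R g') \<bullet> g')))) *\<^sub>R mat 1) (at s)" for c b
    by (rule has_vector_derivative_eq_rhs[OF has_vector_derivative_scaleR[OF DERIV_mult[OF DERIV_cmult[OF p] q]
          has_vector_derivative_const]]) (simp add: distrib_left mult_ac)
  show ?thesis
    unfolding conf_op_def conf_op_deriv_def Let_def power2_norm_eq_inner
    by (intro has_vector_derivative_add has_vector_derivative_diff h g m)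
qed

lemma tendsto_conf_op_deriv:
  fixes g :: "'a \<Rightarrow> real^'n"
  assumes "(t \<longlongrightarrow> t0) F" "t0 \<noteq> 0" "(g \<longlongrightarrow> g0) F" "(H \<longlongrightarrow> H0) F"
    "(t' \<longlongrightarrow> t0') F" "(g' \<longlongrightarrow> g0') F" "(H' \<longlongrightarrow> H0') F"
  shows "((\<lambda>z. conf_op_deriv (t z) (g z) (H z) (t' z) (g' z) (H' z)) \<longlongrightarrow>
    conf_op_deriv t0 g0 H0 t0' g0' H0') F"
  unfolding conf_op_deriv_def Let_def
  by (intro assms tendsto_const tendsto_add tendsto_diff tendsto_scaleR tendsto_mult tendsto_powr
      tendsto_tensor tendsto_inner)

lemma tendsto_conf_op:
  fixes g :: "'a \<Rightarrow> real^'n"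
  assumes "(t \<longlongrightarrow> t0) F" "t0 \<noteq> 0" "(g \<longlongrightarrow> g0) F" "(H \<longlongrightarrow> H0) F"
  shows "((\<lambda>z. conf_op (t z) (g z) (H z)) \<longlongrightarrow> conf_op t0 g0 H0) F"
  unfolding conf_op_def Let_def
  by (intro assms tendsto_const tendsto_add tendsto_diff tendsto_scaleR tendsto_mult tendsto_powr
      tendsto_tensor tendsto_power tendsto_norm)

section \<open>Ellipticity and monotonicity\<close>

text \<open>The derivative within \<open>U\<close> determines \<open>dF M\<close> on symmetric matrices only; \<open>dF\<close> is one continuous choice.\<close>

locale elliptic_equation =
  fixes U :: "(real^'n::finite^'n) set"
    and F :: "real^'n^'n \<Rightarrow> real"
    and dF :: "real^'n^'n \<Rightarrow> (real^'n^'n) \<Rightarrow>\<^sub>L real"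
  assumes dim: "CARD('n) \<ge> 3"
    and U_open: "openin (top_of_set sym_mats) U"
    and U_convex: "\<And>M N. M \<in> sym_mats \<Longrightarrow> pos_def N \<Longrightarrow>
                     convex (U \<inter> {M + t *\<^sub>R N |t. 0 < t})"
    and F_deriv: "\<And>M. M \<in> U \<Longrightarrow> (F has_derivative blinfun_apply (dF M)) (at M within U)"
    and dF_cont: "continuous_on U dF"
    and F_elliptic: "\<And>M. M \<in> U \<Longrightarrow> pos_def (mat_grad F M)"
begin

lemma U_sym: "M \<in> U \<Longrightarrow> M \<in> sym_mats"
  using openin_imp_subset[OF U_open] by auto

lemma eventually_in_U:
  assumes "(a \<longlongrightarrow> M) net" "M \<in> U" "eventually (\<lambda>z. a z \<in> sym_mats) net"
  shows "eventually (\<lambda>z. a z \<in> U) net"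
proof -
  obtain T where T: "open T" "U = sym_mats \<inter> T" using U_open by (auto simp: openin_open)
  have "eventually (\<lambda>z. a z \<in> T) net"
    using topological_tendstoD[OF assms(1) T(1)] assms(2) T(2) by simp
  with assms(3) show ?thesis by eventually_elim (use T in auto)
qed

text \<open>\<open>F\<close> is differentiable only relative to \<open>U\<close>; for a curve of symmetric matrices this is enough, because \<open>U\<close> is
open among them and the curve stays in \<open>U\<close> for a while.\<close>

lemma F_along_curve:
  assumes c: "(c has_vector_derivative S) (at t)" and ct: "c t \<in> U"
    and sym: "eventually (\<lambda>s. c s \<in> sym_mats) (nhds t)"
  shows "((\<lambda>s. F (c s)) has_real_derivative dF (c t) S) (at t)"
proof -
  have "(c \<longlongrightarrow> c t) (nhds t)"
    using has_vector_derivative_continuous[OF c] by (simp add: isCont_def tendsto_at_iff_tendsto_nhds)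
  from eventually_in_U[OF this ct sym]
  obtain W where W: "open W" "t \<in> W" "\<And>s. s \<in> W \<Longrightarrow> c s \<in> U"
    by (auto simp: eventually_nhds)
  have "((\<lambda>s. F (c s)) has_derivative (\<lambda>h. dF (c t) (h *\<^sub>R S))) (at t within W)"
  proof (rule has_derivative_in_compose[where g = F and g' = "blinfun_apply (dF (c t))"])
    show "(c has_derivative (\<lambda>h. h *\<^sub>R S)) (at t within W)"
      using c by (simp add: has_vector_derivative_def has_derivative_at_withinI)
    show "(F has_derivative dF (c t)) (at (c t) within c ` W)"
      by (rule has_derivative_subset[OF F_deriv[OF ct]]) (use W in auto)
  qed
  then show ?thesis
    unfolding at_within_open[OF W(2,1)] has_field_derivative_def blinfun.scaleR_right
    by (simp add: mult_commute_abs)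
qed

lemma dF_rank_one:
  assumes "M \<in> U" shows "dF M (tensor v v) = v \<bullet> (mat_grad F M *v v)"
proof -
  have unit: "mat_grad F M $ i $ j = dF M (sym_unit i j)" for i j
  proof -
    have S: "sym_unit i j \<in> sym_mats"
      by (auto simp: sym_mats_iff sym_unit_def axis_def)
    have "((\<lambda>t. F (M + t *\<^sub>R sym_unit i j)) has_real_derivative dF (M + 0 *\<^sub>R sym_unit i j) (sym_unit i j)) (at 0)"
    proof (rule F_along_curve)
      show "((\<lambda>t. M + t *\<^sub>R sym_unit i j) has_vector_derivative sym_unit i j) (at 0)"
        by (auto intro!: derivative_eq_intros)
      show "\<forall>\<^sub>F s in nhds 0. M + s *\<^sub>R sym_unit i j \<in> sym_mats"
        using S U_sym[OF assms] by (simp add: subspace_add subspace_scale subspace_sym_mats)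
    qed (use assms in simp)
    then show ?thesis by (simp add: mat_grad_def dir_deriv_def DERIV_imp_deriv)
  qed
  have "(\<Sum>i\<in>UNIV. \<Sum>j\<in>UNIV. (v $ i * v $ j) *\<^sub>R sym_unit i j) $ a $ b = tensor v v $ a $ b" for a b
  proof -
    have ax: "(\<Sum>i\<in>UNIV. v $ i * axis i 1 $ c) = v $ c" for c
      using arg_cong[OF axis_expansion[of v], of "\<lambda>x. x $ c"] by simp
    have unit: "sym_unit i j $ a $ b = axis i 1 $ a * axis j 1 $ b / 2 + axis j 1 $ a * axis i 1 $ b / (2::real)"
      for i j :: 'n
      by (auto simp: sym_unit_def axis_def)
    have "(\<Sum>i\<in>UNIV. \<Sum>j\<in>UNIV. (v $ i * v $ j) *\<^sub>R sym_unit i j) $ a $ b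
      = (\<Sum>i\<in>UNIV. \<Sum>j\<in>UNIV. (v $ i * axis i 1 $ a) * (v $ j * axis j 1 $ b) / 2
            + (v $ i * axis i 1 $ b) * (v $ j * axis j 1 $ a) / 2)"
      by (simp add: unit algebra_simps)
    also have "\<dots> = (v $ a * v $ b) / 2 + (v $ b * v $ a) / 2"
      unfolding sum.distrib sum_divide_distrib[symmetric] sum_product[symmetric] ax ..
    finally show ?thesis by (simp add: tensor_def)
  qed
  then have "tensor v v = (\<Sum>i\<in>UNIV. \<Sum>j\<in>UNIV. (v $ i * v $ j) *\<^sub>R sym_unit i j)"
    by (simp add: vec_eq_iff)
  then have "dF M (tensor v v) = (\<Sum>i\<in>UNIV. \<Sum>j\<in>UNIV. v $ i * v $ j * mat_grad F M $ i $ j)"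
    by (simp add: blinfun.sum_right blinfun.scaleR_right unit)
  also have "\<dots> = v \<bullet> (mat_grad F M *v v)"
    by (simp add: inner_vec_def matrix_vector_mult_def sum_distrib_left mult_ac)
  finally show ?thesis .
qed

lemma dF_rank_one_pos: "M \<in> U \<Longrightarrow> v \<noteq> 0 \<Longrightarrow> 0 < dF M (tensor v v)"
  using F_elliptic by (simp add: dF_rank_one pos_def_def)

lemma dF_nonneg:
  assumes "M \<in> U" "pos_semidef N" shows "0 \<le> dF M N"
  using assms(2)
proof (induction rule: pos_semidef_rank_one_induct)
  case (add N v)
  have "0 \<le> dF M (tensor v v)"
    using dF_rank_one_pos[OF assms(1), of v] dF_rank_one[OF assms(1), of v] by (cases "v = 0") auto
  with add show ?case by (simp add: blinfun.add_right)
qed (simp add: blinfun.zero_right)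

text \<open>This is where the convexity of \<open>U\<close> along rays is used. It speaks of rays in positive definite directions, so
\<open>N\<close> is replaced by \<open>N + \<eta> I\<close>: then the segment from \<open>M\<close> to \<open>M + N + \<eta> I\<close> lies in \<open>U\<close>, \<open>F\<close> is
nondecreasing along it, and \<open>\<eta>\<close> tends to 0.\<close>

lemma F_mono:
  assumes M: "M \<in> U" and MN: "M + N \<in> U" and N: "pos_semidef N"
  shows "F M \<le> F (M + N)"
proof -
  have Ns: "N \<in> sym_mats" using N by (simp add: pos_semidef_def)
  let ?c = "\<lambda>\<eta>. M + N + \<eta> *\<^sub>R mat 1"
  have sym: "?c \<eta> \<in> sym_mats" for \<eta>
    by (intro subspace_add subspace_scale subspace_sym_mats) (use Ns U_sym[OF M] in auto)
  have lim: "(?c \<longlongrightarrow> M + N + 0 *\<^sub>R mat 1) (nhds 0)" by (intro tendsto_intros filterlim_ident)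
  then have in_U: "\<forall>\<^sub>F \<eta> in nhds 0. ?c \<eta> \<in> U"
    by (rule eventually_in_U) (use MN sym in auto)
  have "((\<lambda>\<eta>. F (?c \<eta>)) has_real_derivative dF (?c 0) (mat 1)) (at 0)"
  proof (rule F_along_curve)
    show "(?c has_vector_derivative mat 1) (at 0)" by (auto intro!: derivative_eq_intros)
  qed (use MN sym in auto)
  then have "((\<lambda>\<eta>. F (?c \<eta>)) \<longlongrightarrow> F (?c 0)) (at_right 0)"
    using DERIV_isCont isCont_def filterlim_at_split by blast
  moreover have "\<forall>\<^sub>F \<eta> in at_right 0. F M \<le> F (?c \<eta>)"
  proof -
    have "\<forall>\<^sub>F \<eta> in at_right 0. ?c \<eta> \<in> U \<and> \<eta> > 0"
      using in_U by (auto simp: eventually_at_filter elim: eventually_mono)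
    then show ?thesis
    proof eventually_elim
      case (elim \<eta>)
      let ?N = "N + \<eta> *\<^sub>R mat 1"
      have pd: "0 \<le> x \<bullet> (?N *v x)" "x \<noteq> 0 \<Longrightarrow> 0 < x \<bullet> (?N *v x)" for x
        using N elim unfolding pos_semidef_def
        by (auto simp: matrix_vector_mult_add_rdistrib scaleR_matrix_vector_assoc[symmetric]
            inner_add_right intro!: add_nonneg_pos)
      have Nsym: "?N \<in> sym_mats"
        by (intro subspace_add subspace_scale subspace_sym_mats Ns) simp
      have PD: "pos_def ?N" and PSD: "pos_semidef ?N"
        using pd Nsym by (auto simp: pos_def_def pos_semidef_def)
      \<comment> \<open>the ray starts one step before \<open>M\<close>, so that \<open>M\<close> itself is one of its points\<close>
      let ?K = "U \<inter> {M - ?N + t *\<^sub>R ?N |t. 0 < t}"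
      have conv: "convex ?K"
        by (rule U_convex[OF _ PD]) (use subspace_diff[OF subspace_sym_mats U_sym[OF M] Nsym] in simp)
      have a: "M \<in> ?K" using M by (auto intro!: exI[of _ 1])
      have b: "?c \<eta> \<in> ?K"
        using elim by (auto intro!: exI[of _ 2] simp: scaleR_2)
      have seg: "M + s *\<^sub>R ?N \<in> U" if "0 \<le> s" "s \<le> 1" for s
      proof -
        have "(1 - s) *\<^sub>R M + s *\<^sub>R ?c \<eta> \<in> ?K"
          using convexD[OF conv a b, of "1 - s" s] that by simp
        moreover have "(1 - s) *\<^sub>R M + s *\<^sub>R ?c \<eta> = M + s *\<^sub>R ?N" by (simp add: algebra_simps)
        ultimately show ?thesis by simp
      qed
      have "F (M + 0 *\<^sub>R ?N) \<le> F (M + 1 *\<^sub>R ?N)"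
      proof (rule DERIV_nonneg_imp_nondecreasing[where f = "\<lambda>s. F (M + s *\<^sub>R ?N)"])
        fix s :: real assume s: "0 \<le> s" "s \<le> 1"
        have "((\<lambda>s. F (M + s *\<^sub>R ?N)) has_real_derivative dF (M + s *\<^sub>R ?N) ?N) (at s)"
        proof (rule F_along_curve)
          show "((\<lambda>s. M + s *\<^sub>R ?N) has_vector_derivative ?N) (at s)"
            by (auto intro!: derivative_eq_intros)
          show "\<forall>\<^sub>F s in nhds s. M + s *\<^sub>R ?N \<in> sym_mats"
            using Nsym U_sym[OF M] by (simp add: subspace_add subspace_scale subspace_sym_mats)
        qed (rule seg[OF s])
        with dF_nonneg[OF seg[OF s] PSD]
        show "\<exists>y. ((\<lambda>s. F (M + s *\<^sub>R ?N)) has_real_derivative y) (at s) \<and> 0 \<le> y" by blast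
      qed simp
      then show ?case by (simp add: add.assoc)
    qed
  qed
  ultimately have "F M \<le> F (?c 0)"
    by (rule tendsto_lowerbound) simp
  then show ?thesis by simp
qed

end

section \<open>Barriers at a point of contact\<close>

context elliptic_equation
begin

definition solution_on where
  "solution_on V u G H \<longleftrightarrow> second_order_on V u G H \<and>
     (\<forall>y\<in>V. 0 < u y \<and> conf_op (u y) (G y) (H y) \<in> U \<and> F (conf_op (u y) (G y) (H y)) = 1)"

lemma solution_onD:
  assumes "solution_on V u G H"
  shows "second_order_on V u G H" "y \<in> V \<Longrightarrow> 0 < u y" "y \<in> V \<Longrightarrow> conf_op (u y) (G y) (H y) \<in> U"
    "y \<in> V \<Longrightarrow> F (conf_op (u y) (G y) (H y)) = 1"
  using assms by (auto simp: solution_on_def)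

lemma solution_on_subset: "solution_on V u G H \<Longrightarrow> open W \<Longrightarrow> W \<subseteq> V \<Longrightarrow> solution_on W u G H"
  unfolding solution_on_def using second_order_on_subset by blast

lemma solution_on_sym:
  assumes "solution_on V u G H" "y \<in> V" shows "H y \<in> sym_mats"
  by (rule second_derivative_in_sym_mats[OF dim solution_onD(2)[OF assms] U_sym[OF solution_onD(3)[OF assms]]])

text \<open>At a point of contact from below the gradients agree and the Hessian of \<open>u\<close> dominates that of \<open>w\<close>. The Hessian
enters \<open>conf_op\<close> with a negative factor, so the matrix of \<open>w\<close> is the larger one, and \<open>F\<close> is monotone.\<close>

lemma no_touching_strict_subsolution:
  assumes u: "solution_on V u G H" and w: "second_order_on V w Gw Hw" and x: "x \<in> V"
    and le: "\<And>y. y \<in> V \<Longrightarrow> w y \<le> u y" and eq: "w x = u x"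
    and U: "conf_op (w x) (Gw x) (Hw x) \<in> U"
  shows "1 \<le> F (conf_op (w x) (Gw x) (Hw x))"
proof -
  note uD = solution_onD[OF u]
  have d: "second_order_on V (\<lambda>y. u y - w y) (\<lambda>y. G y - Gw y) (\<lambda>y. H y - Hw y)"
    by (rule second_order_on_diff[OF uD(1) w])
  have min: "u x - w x \<le> u y - w y" if "y \<in> V" for y using le[OF that] eq by simp
  have G: "Gw x = G x" using second_order_on_min(1)[OF d x min] by simp
  have Hw: "Hw x \<in> sym_mats"
    using second_derivative_in_sym_mats[OF dim _ U_sym[OF U]] eq uD(2)[OF x] by simp
  have psd: "pos_semidef (H x - Hw x)"
    unfolding pos_semidef_def
    using second_order_on_min(2)[OF d x min] subspace_diff[OF subspace_sym_mats solution_on_sym[OF u x] Hw]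
    by simp
  define c where "c = 2 / (real CARD('n) - 2) * u x powr (- ((real CARD('n) + 2) / (real CARD('n) - 2)))"
  have "0 \<le> c" using dim by (simp add: c_def)
  have N: "conf_op (w x) (Gw x) (Hw x) = conf_op (u x) (G x) (H x) + c *\<^sub>R (H x - Hw x)"
    unfolding eq G by (simp add: conf_op_def c_def Let_def scaleR_diff_right)
  have "F (conf_op (u x) (G x) (H x)) \<le> F (conf_op (w x) (Gw x) (Hw x))"
    using F_mono[OF uD(3)[OF x] _ pos_semidef_scale[OF psd \<open>0 \<le> c\<close>]] U unfolding N by blast
  then show ?thesis using uD(4)[OF x] by simp
qed

text \<open>For a unit vector \<open>e\<close>, this is nonnegative on the half-space \<open>0 \<le> e \<bullet> (y - p)\<close> if \<open>\<kappa> = 0\<close>, and on the closed ball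
of radius \<open>1 / (2 \<kappa>)\<close> with \<open>p\<close> on its boundary and inner normal \<open>e\<close> if \<open>0 < \<kappa>\<close>.\<close>

definition barrier_shape :: "real^'n \<Rightarrow> real^'n \<Rightarrow> real \<Rightarrow> real^'n \<Rightarrow> real" where
  "barrier_shape p e \<kappa> y = e \<bullet> (y - p) - \<kappa> * (norm (y - p))\<^sup>2"

lemma second_order_on_barrier_shape:
  "second_order_on UNIV (barrier_shape p e \<kappa>) (\<lambda>y. e - (2 * \<kappa>) *\<^sub>R (y - p)) (\<lambda>y. - \<kappa> *\<^sub>R mat 2)"
  using second_order_on_diff[OF second_order_on_affine[of UNIV 0 e p]
      second_order_on_cmul[OF second_order_on_square[of UNIV p], of \<kappa>]]
  by (simp add: barrier_shape_def[abs_def] mult.commute[of \<kappa> 2])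

lemma barrier_shape_center [simp]: "barrier_shape p e \<kappa> p = 0"
  by (simp add: barrier_shape_def)

text \<open>With \<open>h = exp (\<alpha> \<phi>) - 1\<close>, the derivative of \<open>F\<close> along \<open>w + \<epsilon> (h - \<tau>)\<close> at \<open>\<epsilon> = \<tau> = 0\<close> and \<open>y = p\<close> is
\<open>\<alpha> X - \<alpha>\<^sup>2 c dF (tensor e e)\<close> with \<open>c > 0\<close> and \<open>X\<close> independent of \<open>\<alpha>\<close>. By ellipticity it is negative for
large \<open>\<alpha>\<close>, and by continuity it stays negative for \<open>(\<epsilon>, \<tau>, y)\<close> near \<open>(0, 0, p)\<close>. Integrating in \<open>\<epsilon>\<close>
from \<open>F = 1\<close> at \<open>\<epsilon> = 0\<close> gives the strict inequality.\<close>

lemma barrier_strict_subsolution: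
  fixes p e :: "real^'n" and \<kappa> :: real
  assumes w: "solution_on V w Gw Hw" and p: "p \<in> V" and e: "norm e = 1"
  obtains \<alpha> d h Gh Hh where "0 < \<alpha>" "0 < d" "second_order_on UNIV h Gh Hh"
    "h = (\<lambda>y. exp (\<alpha> * barrier_shape p e \<kappa> y) - 1)"
    "\<And>\<epsilon> \<tau> y. 0 < \<epsilon> \<Longrightarrow> \<epsilon> < d \<Longrightarrow> 0 \<le> \<tau> \<Longrightarrow> \<tau> < d \<Longrightarrow> norm (y - p) < d \<Longrightarrow>
       y \<in> V \<and> conf_op (w y + \<epsilon> * (h y - \<tau>)) (Gw y + \<epsilon> *\<^sub>R Gh y) (Hw y + \<epsilon> *\<^sub>R Hh y) \<in> U \<and>
       F (conf_op (w y + \<epsilon> * (h y - \<tau>)) (Gw y + \<epsilon> *\<^sub>R Gh y) (Hw y + \<epsilon> *\<^sub>R Hh y)) < 1"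
proof -
  note wD = solution_onD[OF w]
  note wt = second_order_on_tendsto[OF wD(1) p]
  let ?M = "conf_op (w p) (Gw p) (Hw p)"
  have wp: "0 < w p" using wD(2)[OF p] .
  define c where "c = 2 / (real CARD('n) - 2) * w p powr (- ((real CARD('n) + 2) / (real CARD('n) - 2)))"
  have c: "0 < c" using dim wp by (simp add: c_def)
  let ?X = "conf_op_deriv (w p) (Gw p) (Hw p) 0 e (- \<kappa> *\<^sub>R mat 2)"
  have e0: "e \<noteq> 0" using e by auto
  have pos: "0 < c * dF ?M (tensor e e)"
    using dF_rank_one_pos[OF wD(3)[OF p] e0] c by simp
  obtain \<alpha> where \<alpha>: "0 < \<alpha>" "dF ?M ?X < \<alpha> * (c * dF ?M (tensor e e))"
  proof -
    let ?D = "c * dF ?M (tensor e e)"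
    let ?a = "\<bar>dF ?M ?X\<bar> / ?D + 1"
    have "?a * ?D = \<bar>dF ?M ?X\<bar> + ?D"
      unfolding distrib_right using pos by (metis less_irrefl mult_1 nonzero_eq_divide_eq)
    then have "\<bar>dF ?M ?X\<bar> < ?a * ?D" using pos by linarith
    moreover have "0 < ?a" using pos by (simp add: add_nonneg_pos)
    ultimately show ?thesis by (intro that[of ?a]) linarith+
  qed
  define \<phi> where "\<phi> = barrier_shape p e \<kappa>"
  define h where "h = (\<lambda>y. exp (\<alpha> * \<phi> y) - 1)"
  define q where "q = (\<lambda>y. e - (2 * \<kappa>) *\<^sub>R (y - p))"
  define Gh where "Gh = (\<lambda>y. exp (\<alpha> * \<phi> y) *\<^sub>R (\<alpha> *\<^sub>R q y))"
  define Hh where "Hh = (\<lambda>y. exp (\<alpha> * \<phi> y) *\<^sub>R (\<alpha> *\<^sub>R (- \<kappa> *\<^sub>R mat 2) + tensor (\<alpha> *\<^sub>R q y) (\<alpha> *\<^sub>R q y)))"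
  have so: "second_order_on UNIV h Gh Hh"
    using second_order_on_add[OF second_order_on_exp[OF second_order_on_cmul[OF
            second_order_on_barrier_shape[of p e \<kappa>], of \<alpha>]] second_order_on_affine[of UNIV "-1" 0 0]]
    by (simp add: h_def Gh_def Hh_def \<phi>_def q_def)
  note ht = second_order_on_tendsto[OF so UNIV_I, of p]
  have at_p: "h p = 0" "Gh p = \<alpha> *\<^sub>R e" "Hh p = \<alpha> *\<^sub>R (- \<kappa> *\<^sub>R mat 2) + tensor (\<alpha> *\<^sub>R e) (\<alpha> *\<^sub>R e)"
    by (simp_all add: h_def Gh_def Hh_def \<phi>_def q_def)
  let ?t = "\<lambda>(\<epsilon>, \<tau>, y). w y + \<epsilon> * (h y - \<tau>)"
  let ?g = "\<lambda>(\<epsilon>, \<tau> :: real, y). Gw y + \<epsilon> *\<^sub>R Gh y"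
  let ?H = "\<lambda>(\<epsilon>, \<tau> :: real, y). Hw y + \<epsilon> *\<^sub>R Hh y"
  let ?a = "\<lambda>z. conf_op (?t z) (?g z) (?H z)"
  let ?da = "\<lambda>z. conf_op_deriv (?t z) (?g z) (?H z) (case z of (\<epsilon>, \<tau>, y) \<Rightarrow> h y - \<tau>)
     (case z of (\<epsilon> :: real, \<tau> :: real, y) \<Rightarrow> Gh y) (case z of (\<epsilon> :: real, \<tau> :: real, y) \<Rightarrow> Hh y)"
  let ?z = "(0 :: real, 0 :: real, p)"
  have f1: "filterlim fst (nhds 0) (nhds ?z)"
    using tendsto_fst[OF filterlim_ident[of "nhds ?z"]] by simp
  have f2: "filterlim (\<lambda>z. fst (snd z)) (nhds 0) (nhds ?z)"
    using tendsto_fst[OF tendsto_snd[OF filterlim_ident[of "nhds ?z"]]] by simp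
  have f3: "filterlim (\<lambda>z. snd (snd z)) (nhds p) (nhds ?z)"
    using tendsto_snd[OF tendsto_snd[OF filterlim_ident[of "nhds ?z"]]] by simp
  note cw = filterlim_compose[OF wt(1) f3] filterlim_compose[OF wt(2) f3] filterlim_compose[OF wt(3) f3]
  note ch = filterlim_compose[OF ht(1) f3] filterlim_compose[OF ht(2) f3] filterlim_compose[OF ht(3) f3]
  have t: "(?t \<longlongrightarrow> w p) (nhds ?z)"
    using tendsto_add[OF cw(1) tendsto_mult[OF f1 tendsto_diff[OF ch(1) f2]]] by (simp add: case_prod_unfold)
  have g: "(?g \<longlongrightarrow> Gw p) (nhds ?z)"
    using tendsto_add[OF cw(2) tendsto_scaleR[OF f1 ch(2)]] by (simp add: case_prod_unfold)
  have H: "(?H \<longlongrightarrow> Hw p) (nhds ?z)"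
    using tendsto_add[OF cw(3) tendsto_scaleR[OF f1 ch(3)]] by (simp add: case_prod_unfold)
  have t': "((\<lambda>z. case z of (\<epsilon>, \<tau>, y) \<Rightarrow> h y - \<tau>) \<longlongrightarrow> 0) (nhds ?z)"
    using tendsto_diff[OF ch(1) f2] by (simp add: case_prod_unfold at_p)
  have g': "((\<lambda>z. case z of (\<epsilon> :: real, \<tau> :: real, y) \<Rightarrow> Gh y) \<longlongrightarrow> Gh p) (nhds ?z)"
    using ch(2) by (simp add: case_prod_unfold)
  have H': "((\<lambda>z. case z of (\<epsilon> :: real, \<tau> :: real, y) \<Rightarrow> Hh y) \<longlongrightarrow> Hh p) (nhds ?z)"
    using ch(3) by (simp add: case_prod_unfold)
  have a: "(?a \<longlongrightarrow> ?M) (nhds ?z)"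
    by (rule tendsto_conf_op[OF t _ g H]) (use wp in simp)
  have da: "(?da \<longlongrightarrow> conf_op_deriv (w p) (Gw p) (Hw p) 0 (Gh p) (Hh p)) (nhds ?z)"
    by (rule tendsto_conf_op_deriv[OF t _ g H t' g' H']) (use wp in simp)
  have evV: "eventually (\<lambda>z. snd (snd z) \<in> V) (nhds ?z)"
    using topological_tendstoD[OF f3 second_order_onD(1)[OF wD(1)] p] .
  have Hh_sym: "Hh y \<in> sym_mats" for y
    unfolding Hh_def by (intro subspace_add subspace_scale subspace_sym_mats) auto
  have a_sym: "?a z \<in> sym_mats" if "snd (snd z) \<in> V" for z
    using solution_on_sym[OF w that] Hh_sym
    by (auto simp: case_prod_unfold intro!: conf_op_in_sym_mats subspace_add subspace_scale subspace_sym_mats)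
  have evU: "eventually (\<lambda>z. ?a z \<in> U) (nhds ?z)"
    using eventually_in_U[OF a wD(3)[OF p] eventually_mono[OF evV a_sym]] .
  have "((\<lambda>z. dF (?a z)) \<longlongrightarrow> dF ?M) (nhds ?z)"
    by (rule continuous_within_tendsto_compose[OF _ evU a])
      (use dF_cont wD(3)[OF p] in \<open>simp add: continuous_on_eq_continuous_within\<close>)
  then have "((\<lambda>z. dF (?a z) (?da z)) \<longlongrightarrow>
      dF ?M (conf_op_deriv (w p) (Gw p) (Hw p) 0 (Gh p) (Hh p))) (nhds ?z)"
    by (rule blinfun.tendsto[OF _ da])
  moreover have "dF ?M (conf_op_deriv (w p) (Gw p) (Hw p) 0 (Gh p) (Hh p)) < 0"
  proof -
    have tt: "tensor (\<alpha> *\<^sub>R e) (\<alpha> *\<^sub>R e) = (\<alpha> * \<alpha>) *\<^sub>R tensor e e"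
      "tensor (Gw p) (\<alpha> *\<^sub>R e) = \<alpha> *\<^sub>R tensor (Gw p) e" "tensor (\<alpha> *\<^sub>R e) (Gw p) = \<alpha> *\<^sub>R tensor e (Gw p)"
      by (simp_all add: bilinear_lmul[OF bilinear_tensor] bilinear_rmul[OF bilinear_tensor])
    have "conf_op_deriv (w p) (Gw p) (Hw p) 0 (Gh p) (Hh p) = \<alpha> *\<^sub>R ?X - (\<alpha> * (\<alpha> * c)) *\<^sub>R tensor e e"
      unfolding at_p tt by (simp add: conf_op_deriv_def Let_def c_def tt algebra_simps)
    then have "dF ?M (conf_op_deriv (w p) (Gw p) (Hw p) 0 (Gh p) (Hh p))
       = \<alpha> * dF ?M ?X - \<alpha> * (\<alpha> * c) * dF ?M (tensor e e)"
      by (simp only: blinfun.diff_right blinfun.scaleR_right real_scaleR_def)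
    also have "\<dots> = \<alpha> * (dF ?M ?X - \<alpha> * (c * dF ?M (tensor e e)))"
      by (simp only: right_diff_distrib mult.assoc)
    also have "\<dots> < 0" using \<alpha> by (intro mult_pos_neg) auto
    finally show ?thesis .
  qed
  ultimately have evneg: "eventually (\<lambda>z. dF (?a z) (?da z) < 0) (nhds ?z)"
    by (rule order_tendstoD)
  have evt: "eventually (\<lambda>z. 0 < ?t z) (nhds ?z)" using order_tendstoD(1)[OF t wp] .
  have "eventually (\<lambda>z. snd (snd z) \<in> V \<and> ?a z \<in> U \<and> dF (?a z) (?da z) < 0 \<and> 0 < ?t z) (nhds ?z)"
    using evV evU evneg evt by eventually_elim simp
  then obtain d where d: "0 < d" and good:
    "\<And>z. dist z ?z < d \<Longrightarrow> snd (snd z) \<in> V \<and> ?a z \<in> U \<and> dF (?a z) (?da z) < 0 \<and> 0 < ?t z"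
    unfolding eventually_nhds_metric by blast
  have box: "dist (\<epsilon>, \<tau>, y) ?z < d" if "0 \<le> \<epsilon>" "\<epsilon> < d / 3" "0 \<le> \<tau>" "\<tau> < d / 3" "norm (y - p) < d / 3" for \<epsilon> \<tau> y
  proof -
    have "dist (\<epsilon>, \<tau>, y) ?z \<le> dist \<epsilon> 0 + dist (\<tau>, y) (0, p)"
      unfolding dist_Pair_Pair by (rule sqrt_sum_squares_le_sum) auto
    also have "dist (\<tau>, y) (0, p) \<le> dist \<tau> 0 + dist y p"
      unfolding dist_Pair_Pair by (rule sqrt_sum_squares_le_sum) auto
    finally show ?thesis using that by (simp add: dist_norm)
  qed
  show ?thesis
  proof (rule that[OF \<alpha>(1) _ so h_def[unfolded \<phi>_def]])
    show "0 < d / 3" using d by simp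
    fix \<epsilon> \<tau> y assume A: "0 < \<epsilon>" "\<epsilon> < d / 3" "0 \<le> \<tau>" "\<tau> < d / 3" "norm (y - p) < d / 3"
    have z: "snd (snd (s, \<tau>, y)) \<in> V \<and> ?a (s, \<tau>, y) \<in> U \<and> dF (?a (s, \<tau>, y)) (?da (s, \<tau>, y)) < 0 \<and> 0 < ?t (s, \<tau>, y)"
      if "0 \<le> s" "s \<le> \<epsilon>" for s
      using good[OF box[of s \<tau> y]] A that by auto
    have y: "y \<in> V" using z[of 0] A by simp
    let ?c = "\<lambda>s. conf_op (w y + s * (h y - \<tau>)) (Gw y + s *\<^sub>R Gh y) (Hw y + s *\<^sub>R Hh y)"
    have "F (?c \<epsilon>) < F (?c 0)"
    proof (rule DERIV_neg_imp_decreasing[OF A(1)])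
      fix s assume s: "0 \<le> s" "s \<le> \<epsilon>"
      have "((\<lambda>s. F (?c s)) has_real_derivative
        dF (?c s) (conf_op_deriv (w y + s * (h y - \<tau>)) (Gw y + s *\<^sub>R Gh y) (Hw y + s *\<^sub>R Hh y)
           (h y - \<tau>) (Gh y) (Hh y))) (at s)"
      proof (rule F_along_curve)
        show "(?c has_vector_derivative conf_op_deriv (w y + s * (h y - \<tau>)) (Gw y + s *\<^sub>R Gh y) (Hw y + s *\<^sub>R Hh y)
           (h y - \<tau>) (Gh y) (Hh y)) (at s)"
          by (rule conf_op_has_vector_derivative) (use z[OF s] in simp)
        show "?c s \<in> U" using z[OF s] by simp
        show "\<forall>\<^sub>F s in nhds s. ?c s \<in> sym_mats"
          using a_sym[of "(_, \<tau>, y)"] y by (intro always_eventually) auto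
      qed
      then show "\<exists>y. ((\<lambda>s. F (?c s)) has_real_derivative y) (at s) \<and> y < 0"
        using z[OF s] by auto
    qed
    then show "y \<in> V \<and> ?c \<epsilon> \<in> U \<and> F (?c \<epsilon>) < 1"
      using y z[of \<epsilon>] A wD(4)[OF y] by auto
  qed
qed

text \<open>The functions are compared only away from \<open>p\<close>, so \<open>p\<close> may be an isolated singularity of \<open>u\<close>.
For \<open>\<tau> > 0\<close> the set \<open>{h \<ge> \<tau>}\<close> stays away from \<open>p\<close>, so the quotient of \<open>h - \<tau>\<close> by \<open>u - w > 0\<close> has a maximum
on it. If this maximum exceeds \<open>1 / \<epsilon>\<close>, its reciprocal \<open>\<delta>\<close> makes the strict subsolution \<open>w + \<delta> (h - \<tau>)\<close>
touch \<open>u\<close> from below at an interior point, which is impossible. Then \<open>\<tau>\<close> tends to 0.\<close>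

lemma barrier_bound:
  fixes p e :: "real^'n" and \<kappa> :: real
  assumes w: "solution_on V w Gw Hw" and p: "p \<in> V" and e: "norm e = 1"
    and u: "solution_on (V - {p}) u G H"
    and above: "\<And>y. y \<in> V - {p} \<Longrightarrow> 0 \<le> barrier_shape p e \<kappa> y \<Longrightarrow> w y < u y"
  obtains c r where "0 < c" "0 < r"
    "\<And>y. y \<in> ball p r - {p} \<Longrightarrow> 0 \<le> barrier_shape p e \<kappa> y \<Longrightarrow> c * barrier_shape p e \<kappa> y \<le> u y - w y"
proof -
  obtain \<alpha> d h Gh Hh where \<alpha>: "0 < \<alpha>" and d: "0 < d" and so: "second_order_on UNIV h Gh Hh"
    and h: "h = (\<lambda>y. exp (\<alpha> * barrier_shape p e \<kappa> y) - 1)"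
    and strict: "\<And>\<epsilon> \<tau> y. 0 < \<epsilon> \<Longrightarrow> \<epsilon> < d \<Longrightarrow> 0 \<le> \<tau> \<Longrightarrow> \<tau> < d \<Longrightarrow> norm (y - p) < d \<Longrightarrow>
       y \<in> V \<and> conf_op (w y + \<epsilon> * (h y - \<tau>)) (Gw y + \<epsilon> *\<^sub>R Gh y) (Hw y + \<epsilon> *\<^sub>R Hh y) \<in> U \<and>
       F (conf_op (w y + \<epsilon> * (h y - \<tau>)) (Gw y + \<epsilon> *\<^sub>R Gh y) (Hw y + \<epsilon> *\<^sub>R Hh y)) < 1"
    by (rule barrier_strict_subsolution[OF w p e, of \<kappa>]) (rule that, assumption+)
  define r where "r = d / 2"
  have r: "0 < r" "r < d" using d by (auto simp: r_def)
  have V: "cball p r \<subseteq> V"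
  proof
    fix y assume "y \<in> cball p r"
    then show "y \<in> V" using strict[of "d / 2" 0 y] d r by (auto simp: dist_norm norm_minus_commute)
  qed
  have hc: "continuous_on S h" for S
    using second_order_on_continuous(1)[OF so] continuous_on_subset by blast
  have hp: "h p = 0" by (simp add: h)
  have h_iff: "0 \<le> h y \<longleftrightarrow> 0 \<le> barrier_shape p e \<kappa> y" for y
    using \<alpha> by (simp add: h zero_le_mult_iff)
  define \<psi> where "\<psi> = (\<lambda>y. u y - w y)"
  have \<psi>c: "continuous_on (V - {p}) \<psi>"
    unfolding \<psi>_def
    using second_order_on_continuous(1)[OF solution_onD(1)[OF u]] second_order_on_continuous(1)[OF solution_onD(1)[OF w]]
    by (intro continuous_on_diff) (auto elim: continuous_on_subset)
  have \<psi>pos: "0 < \<psi> y" if "y \<in> V - {p}" "0 \<le> h y" for y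
    using above[OF that(1)] that(2) h_iff by (simp add: \<psi>_def)
  obtain B where B: "0 < B" "\<And>y. y \<in> cball p r \<Longrightarrow> h y \<le> B"
  proof -
    have "compact (h ` cball p r)" by (intro compact_continuous_image hc compact_cball)
    then have "bounded (h ` cball p r)" by (rule compact_imp_bounded)
    then obtain B where "0 < B" "\<forall>y\<in>h ` cball p r. norm y \<le> B" by (auto simp: bounded_pos)
    then show ?thesis by (intro that[of B]) force+
  qed
  obtain m where m: "0 < m" "\<And>y. y \<in> sphere p r \<Longrightarrow> 0 \<le> h y \<Longrightarrow> m \<le> \<psi> y"
  proof (cases "sphere p r \<inter> {y. 0 \<le> h y} = {}")
    case True
    then show ?thesis by (intro that[of 1]) auto
  next
    case False
    have "closed {y. 0 \<le> h y}" by (intro closed_Collect_le continuous_on_const hc)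
    then have "compact (sphere p r \<inter> {y. 0 \<le> h y})" by (intro compact_Int_closed compact_sphere)
    moreover have sub: "sphere p r \<inter> {y. 0 \<le> h y} \<subseteq> V - {p}" using V r by auto
    ultimately obtain x where "x \<in> sphere p r \<inter> {y. 0 \<le> h y}"
      "\<And>y. y \<in> sphere p r \<inter> {y. 0 \<le> h y} \<Longrightarrow> \<psi> x \<le> \<psi> y"
      using continuous_attains_inf[OF _ False continuous_on_subset[OF \<psi>c sub]] by blast
    moreover from this sub have "x \<in> V - {p}" "0 \<le> h x" by blast+
    ultimately show ?thesis using \<psi>pos[of x] by (intro that[of "\<psi> x"]) auto
  qed
  \<comment> \<open>on the sphere of radius \<open>r\<close> the barrier stays below \<open>u - w\<close>, so no contact occurs there\<close>
  define \<epsilon> where "\<epsilon> = min (d / 2) (m / (2 * B))"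
  have \<epsilon>: "0 < \<epsilon>" "\<epsilon> < d" "\<epsilon> * B < m"
  proof -
    show "0 < \<epsilon>" "\<epsilon> < d" using d m B by (auto simp: \<epsilon>_def)
    have "\<epsilon> * B \<le> m / (2 * B) * B" using B by (intro mult_right_mono) (auto simp: \<epsilon>_def)
    also have "\<dots> < m" using B m by simp
    finally show "\<epsilon> * B < m" .
  qed
  have claim: "\<epsilon> * (h y - \<tau>) \<le> \<psi> y" if \<tau>: "0 < \<tau>" "\<tau> < d" and y: "y \<in> cball p r" "\<tau> \<le> h y" for \<tau> y
  proof (rule ccontr)
    assume neg: "\<not> \<epsilon> * (h y - \<tau>) \<le> \<psi> y"
    define K where "K = cball p r \<inter> {y. \<tau> \<le> h y}"
    have K: "compact K" unfolding K_def
      by (intro compact_Int_closed compact_cball closed_Collect_le continuous_on_const hc)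
    have yK: "y \<in> K" using y by (simp add: K_def)
    have sub: "K \<subseteq> V - {p}" using V \<tau> hp by (auto simp: K_def)
    have pos: "0 < \<psi> x" if "x \<in> K" for x
      using \<psi>pos[of x] sub that \<tau> by (force simp: K_def)
    let ?\<rho> = "\<lambda>y. (h y - \<tau>) / \<psi> y"
    have "continuous_on K ?\<rho>"
      by (intro continuous_on_divide continuous_on_diff continuous_on_const hc continuous_on_subset[OF \<psi>c sub])
        (use pos in force)
    then obtain x where x: "x \<in> K" "\<And>y. y \<in> K \<Longrightarrow> ?\<rho> y \<le> ?\<rho> x"
      using continuous_attains_sup[OF K] yK by blast
    have "1 / \<epsilon> < ?\<rho> y" using neg pos[OF yK] \<epsilon> by (simp add: field_simps)
    then have big: "1 / \<epsilon> < ?\<rho> x" using x(2)[OF yK] by simp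
    define \<delta> where "\<delta> = 1 / ?\<rho> x"
    have \<rho>x: "0 < ?\<rho> x" using big \<epsilon>(1) by (meson divide_pos_pos less_trans zero_less_one)
    have \<delta>: "0 < \<delta>" "\<delta> < \<epsilon>"
    proof -
      show "0 < \<delta>" unfolding \<delta>_def by (rule divide_pos_pos[OF zero_less_one \<rho>x])
      have "1 / R < \<epsilon>" if "1 / \<epsilon> < R" "0 < R" for R
        using that \<epsilon>(1) by (simp add: field_simps)
      from this[OF big \<rho>x] show "\<delta> < \<epsilon>" by (simp only: \<delta>_def)
    qed
    have hx: "\<tau> < h x" using \<rho>x pos[OF x(1)] by (simp add: zero_less_divide_iff)
    have eq: "\<psi> x = \<delta> * (h x - \<tau>)" using hx pos[OF x(1)] by (simp add: \<delta>_def)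
    have le: "\<delta> * (h z - \<tau>) \<le> \<psi> z" if "z \<in> K" for z
    proof -
      have "\<delta> * ?\<rho> z \<le> \<delta> * ?\<rho> x" using x(2)[OF that] \<delta> by (intro mult_left_mono) auto
      also have "\<dots> = 1" using \<rho>x unfolding \<delta>_def by (metis less_irrefl nonzero_eq_divide_eq times_divide_eq_left)
      finally show ?thesis using pos[OF that] by (simp add: field_simps)
    qed
    have "x \<notin> sphere p r"
    proof
      assume xs: "x \<in> sphere p r"
      have "\<psi> x \<le> \<epsilon> * B"
        unfolding eq using \<delta> \<epsilon> hx \<tau> B(2)[of x] xs by (intro mult_mono) auto
      moreover have "m \<le> \<psi> x" using m(2)[OF xs] hx \<tau> by simp
      ultimately show False using \<epsilon> by simp
    qed
    then have xb: "x \<in> ball p r" using x(1) by (auto simp: K_def)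
    define W where "W = ball p r \<inter> {y. \<tau> < h y}"
    have W: "open W" "x \<in> W" "W \<subseteq> K" "W \<subseteq> V" "W \<subseteq> V - {p}"
      unfolding W_def using xb hx sub V \<tau> hp
      by (auto intro!: open_Int open_Collect_less continuous_on_const hc simp: K_def)
    have "1 \<le> F (conf_op (w x + \<delta> * (h x - \<tau>)) (Gw x + \<delta> *\<^sub>R Gh x) (Hw x + \<delta> *\<^sub>R Hh x))"
    proof (rule no_touching_strict_subsolution[OF solution_on_subset[OF u W(1,5)]])
      show "second_order_on W (\<lambda>y. w y + \<delta> * (h y - \<tau>)) (\<lambda>y. Gw y + \<delta> *\<^sub>R Gh y) (\<lambda>y. Hw y + \<delta> *\<^sub>R Hh y)"
        using second_order_on_add[OF second_order_on_subset[OF solution_onD(1)[OF w] W(1,4)]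
            second_order_on_cmul[OF second_order_on_diff[OF second_order_on_subset[OF so W(1)]
                second_order_on_affine[OF W(1), of \<tau> 0 0]], of \<delta>]] by simp
      show "w y + \<delta> * (h y - \<tau>) \<le> u y" if "y \<in> W" for y
        using le[of y] that W(3) by (auto simp: \<psi>_def)
      show "w x + \<delta> * (h x - \<tau>) = u x" using eq by (simp add: \<psi>_def)
    qed (use W strict[of \<delta> \<tau> x] \<delta> \<epsilon> \<tau> xb r in \<open>auto simp: dist_norm norm_minus_commute\<close>)
    moreover have "F (conf_op (w x + \<delta> * (h x - \<tau>)) (Gw x + \<delta> *\<^sub>R Gh x) (Hw x + \<delta> *\<^sub>R Hh x)) < 1"
      using strict[of \<delta> \<tau> x] \<delta> \<epsilon> \<tau> xb r by (auto simp: dist_norm norm_minus_commute)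
    ultimately show False by simp
  qed
  show ?thesis
  proof (rule that[of "\<epsilon> * \<alpha>" r])
    show "0 < \<epsilon> * \<alpha>" "0 < r" using \<epsilon> \<alpha> r by auto
    fix y assume y: "y \<in> ball p r - {p}" "0 \<le> barrier_shape p e \<kappa> y"
    have hy: "0 \<le> h y" using y(2) h_iff by simp
    have "\<epsilon> * h y \<le> \<psi> y"
    proof (cases "h y = 0")
      case True
      then show ?thesis using \<psi>pos[of y] y V by force
    next
      case False
      have "((\<lambda>\<tau>. \<epsilon> * (h y - \<tau>)) \<longlongrightarrow> \<epsilon> * (h y - 0)) (at_right 0)"
        by (intro tendsto_intros)
      moreover have "\<forall>\<^sub>F \<tau> in at_right 0. \<epsilon> * (h y - \<tau>) \<le> \<psi> y"
        using eventually_at_right_real[of 0 "min d (h y)"] d hy False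
        by (auto elim!: eventually_mono intro!: claim simp: less_imp_le) (use y in auto)
      ultimately show ?thesis using tendsto_upperbound[of "\<lambda>\<tau>. \<epsilon> * (h y - \<tau>)" "\<epsilon> * (h y - 0)"] by simp
    qed
    moreover have "\<alpha> * barrier_shape p e \<kappa> y \<le> h y"
      using exp_ge_add_one_self[of "\<alpha> * barrier_shape p e \<kappa> y"] unfolding h by linarith
    then have "\<epsilon> * (\<alpha> * barrier_shape p e \<kappa> y) \<le> \<epsilon> * h y"
      using \<epsilon> by (intro mult_left_mono) auto
    ultimately show "\<epsilon> * \<alpha> * barrier_shape p e \<kappa> y \<le> u y - w y"
      by (simp add: \<psi>_def mult.assoc)
  qed
qed

end

section \<open>Superharmonic functions on a punctured ball\<close>

lemma has_derivative_inner_self_powr: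
  fixes x :: "'a::real_inner"
  assumes "y \<noteq> x"
  shows "((\<lambda>y. ((y - x) \<bullet> (y - x)) powr b) has_derivative
     (\<lambda>v. 2 * b * ((y - x) \<bullet> (y - x)) powr (b - 1) * ((y - x) \<bullet> v))) (at y)"
proof -
  have "((\<lambda>t. t powr b) has_derivative (\<lambda>h. (b * ((y - x) \<bullet> (y - x)) powr (b - 1)) * h)) (at ((y - x) \<bullet> (y - x)))"
    using has_real_derivative_powr[of "(y - x) \<bullet> (y - x)" b] assms by (simp add: has_field_derivative_def)
  moreover have "((\<lambda>y. (y - x) \<bullet> (y - x)) has_derivative (\<lambda>v. 2 * ((y - x) \<bullet> v))) (at y)"
    by (rule has_derivative_eq_rhs[OF has_derivative_inner]) (auto intro!: derivative_eq_intros simp: inner_commute fun_eq_iff)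
  ultimately have "((\<lambda>y. ((y - x) \<bullet> (y - x)) powr b) has_derivative
     (\<lambda>v. (b * ((y - x) \<bullet> (y - x)) powr (b - 1)) * (2 * ((y - x) \<bullet> v)))) (at y)"
    by (rule has_derivative_compose[rotated])
  then show ?thesis by (simp add: mult_ac)
qed

lemma ball_subset_punctured_ball:
  fixes x :: "'a::real_normed_vector"
  assumes "0 < r" "r \<le> norm x" "norm x + r \<le> R"
  shows "ball x r \<subseteq> ball 0 R - {0}"
proof
  fix y assume "y \<in> ball x r"
  then have "norm (x - y) < r" by (simp add: dist_norm)
  moreover have "norm x \<le> norm (x - y) + norm y" using norm_triangle_ineq[of "x - y" y] by simp
  moreover have "norm y \<le> norm x + norm (x - y)" using norm_triangle_ineq4[of x "x - y"] by simp
  ultimately have "0 < norm y" "norm y < R" using assms by linarith+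
  then show "y \<in> ball 0 R - {0}" by simp
qed

lemma second_order_on_norm_powr:
  fixes a :: real
  shows "second_order_on (UNIV - {0}) (\<lambda>x :: real^'n. (x \<bullet> x) powr a)
     (\<lambda>x. (2 * a * (x \<bullet> x) powr (a - 1)) *\<^sub>R x)
     (\<lambda>x. (2 * a * (x \<bullet> x) powr (a - 1)) *\<^sub>R mat 1 + (4 * a * (a - 1) * (x \<bullet> x) powr (a - 2)) *\<^sub>R tensor x x)"
  unfolding second_order_on_def
proof (intro conjI ballI)
  have D: "((\<lambda>x :: real^'n. (x \<bullet> x) powr b) has_derivative (\<lambda>v. 2 * b * (x \<bullet> x) powr (b - 1) * (x \<bullet> v))) (at x)"
    if "x \<noteq> 0" for b :: real and x
    using has_derivative_inner_self_powr[OF that, of b] by simp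
  show "open (UNIV - {0 :: real^'n})" by auto
  fix x :: "real^'n" assume x: "x \<in> UNIV - {0}"
  then show "((\<lambda>x. (x \<bullet> x) powr a) has_derivative (\<bullet>) ((2 * a * (x \<bullet> x) powr (a - 1)) *\<^sub>R x)) (at x)"
    using D[of x a] by (simp add: inner_scaleR_left[abs_def])
  have "((\<lambda>x. (2 * a * (x \<bullet> x) powr (a - 1)) *\<^sub>R x) has_derivative
     (\<lambda>v. (2 * a * (x \<bullet> x) powr (a - 1)) *\<^sub>R v + (2 * a * (2 * (a - 1) * (x \<bullet> x) powr (a - 1 - 1) * (x \<bullet> v))) *\<^sub>R x)) (at x)"
    using x by (intro has_derivative_scaleR has_derivative_mult_right D has_derivative_ident) auto
  then show "((\<lambda>x. (2 * a * (x \<bullet> x) powr (a - 1)) *\<^sub>R x) has_derivative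
       (*v) ((2 * a * (x \<bullet> x) powr (a - 1)) *\<^sub>R mat 1 + (4 * a * (a - 1) * (x \<bullet> x) powr (a - 2)) *\<^sub>R tensor x x)) (at x)"
    by (rule has_derivative_eq_rhs)
      (simp add: fun_eq_iff matrix_vector_mult_add_rdistrib scaleR_matrix_vector_assoc[symmetric] mat_vector_mult
        tensor_vector_mult algebra_simps)
qed (intro continuous_intros; simp)

text \<open>The function \<open>|x| powr (- 1 / 2)\<close> is strictly superharmonic away from 0, since \<open>0 < 1 / 2 < n - 2\<close>, and it tends to
infinity at 0. Adding a small multiple of it to \<open>g\<close> excludes an interior minimum and makes the sum large on small
spheres, so the puncture does not matter; then the multiple tends to 0.\<close>

lemma superharmonic_minimum_principle:
  fixes g :: "real^'n \<Rightarrow> real"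
  assumes dim: "CARD('n) \<ge> 3"
    and so: "second_order_on (ball 0 R - {0}) g G H"
    and super: "\<And>x. x \<in> ball 0 R - {0} \<Longrightarrow> (\<Sum>i\<in>UNIV. H x $ i $ i) \<le> 0"
    and below: "\<And>x. x \<in> ball 0 R - {0} \<Longrightarrow> B \<le> g x"
    and s: "0 < s" "s < R" and bdry: "\<And>x. norm x = s \<Longrightarrow> m \<le> g x"
    and y: "norm y \<le> s" "y \<noteq> 0"
  shows "m \<le> g y"
proof -
  let ?N = "\<lambda>x :: real^'n. (x \<bullet> x) powr (- 1 / 4)"
  have N: "?N x = norm x powr (- 1 / 2)" for x
  proof -
    have "x \<bullet> x = norm x powr 2" by (simp add: power2_norm_eq_inner)
    then show ?thesis unfolding powr_powr by (simp only: powr_powr) simp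
  qed
  have claim: "m \<le> g y + \<epsilon> * ?N y" if \<epsilon>: "0 < \<epsilon>" for \<epsilon>
  proof (rule ccontr)
    assume neg: "\<not> m \<le> g y + \<epsilon> * ?N y"
    let ?q = "\<lambda>x. g x + \<epsilon> * ?N x"
    let ?z = "(\<bar>m - B\<bar> + 1) / \<epsilon>"
    \<comment> \<open>the second bound makes the added term exceed \<open>m - B\<close> on the sphere of radius \<open>\<rho>\<close>\<close>
    define \<rho> where "\<rho> = min (norm y / 2) (?z powr (- 2))"
    have z: "0 < ?z" using \<epsilon> by (intro divide_pos_pos) auto
    have \<rho>: "0 < \<rho>" "\<rho> < norm y" "\<rho> \<le> ?z powr (-2)"
      using y(2) z by (auto simp: \<rho>_def min_less_iff_disj)
    have "(?z powr (-2)) powr (- 1 / 2) \<le> \<rho> powr (- 1 / 2)"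
      using \<rho> by (intro powr_mono2') auto
    moreover have "(a powr (-2)) powr (- 1 / 2) = a" if "0 < a" for a :: real
      using that by (simp add: powr_powr)
    ultimately have "?z \<le> \<rho> powr (- 1 / 2)" using z by metis
    then have "\<epsilon> * ?z \<le> \<epsilon> * \<rho> powr (- 1 / 2)" using \<epsilon> by (intro mult_left_mono) auto
    then have big: "m - B < \<epsilon> * \<rho> powr (- 1 / 2)" using \<epsilon> by simp
    let ?K = "cball 0 s - ball 0 \<rho> :: (real^'n) set"
    have K: "compact ?K" by (intro compact_diff compact_cball open_ball)
    have yK: "y \<in> ?K" using y \<rho> by auto
    have KV: "?K \<subseteq> ball 0 R - {0}" using s \<rho> by auto
    have qso: "second_order_on (ball 0 R - {0}) ?q
      (\<lambda>x. G x + \<epsilon> *\<^sub>R ((2 * (- 1 / 4) * (x \<bullet> x) powr (- 1 / 4 - 1)) *\<^sub>R x))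
      (\<lambda>x. H x + \<epsilon> *\<^sub>R ((2 * (- 1 / 4) * (x \<bullet> x) powr (- 1 / 4 - 1)) *\<^sub>R mat 1
          + (4 * (- 1 / 4) * (- 1 / 4 - 1) * (x \<bullet> x) powr (- 1 / 4 - 2)) *\<^sub>R tensor x x))"
      (is "second_order_on _ _ ?Gq ?Hq")
      by (intro second_order_on_add second_order_on_cmul so
          second_order_on_subset[OF second_order_on_norm_powr]) auto
    obtain x where x: "x \<in> ?K" "\<And>z. z \<in> ?K \<Longrightarrow> ?q x \<le> ?q z"
      using continuous_attains_inf[OF K _ continuous_on_subset[OF second_order_on_continuous(1)[OF qso] KV]] yK
      by blast
    have qx: "?q x < m" using x(2)[OF yK] neg by simp
    have "norm x \<noteq> s"
    proof
      assume "norm x = s"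
      then have "m \<le> g x" by (rule bdry)
      moreover have "0 \<le> \<epsilon> * ?N x" using \<epsilon> by simp
      ultimately show False using qx by linarith
    qed
    moreover have "norm x \<noteq> \<rho>"
    proof
      assume "norm x = \<rho>"
      moreover have "B \<le> g x" using below x(1) KV by blast
      ultimately show False using qx big unfolding N by simp
    qed
    ultimately have xW: "x \<in> ball 0 s - cball 0 \<rho>" using x(1) by auto
    have W: "open (ball 0 s - cball 0 \<rho> :: (real^'n) set)" by auto
    have Wsub: "ball 0 s - cball 0 \<rho> \<subseteq> ball 0 R - {0 :: real^'n}" using s \<rho> by auto
    have psd: "0 \<le> v \<bullet> (?Hq x *v v)" for v
      by (rule second_order_on_min(2)[OF second_order_on_subset[OF qso W Wsub] xW]) (use x(2) in auto)
    have diag: "0 \<le> ?Hq x $ i $ i" for i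
      using psd[of "axis i 1"] by (simp only: inner_axis' matrix_vector_axis inner_real_def mult_1)
    let ?s = "x \<bullet> x"
    have s0: "0 < ?s" using xW \<rho> by auto
    have "?s powr (- 1 / 4 - 2) * ?s = ?s powr (- 1 / 4 - 1)"
      using powr_mult_base[of ?s "- 1 / 4 - 2"] s0 by (simp add: mult.commute)
    then have p: "?s powr (- 1 / 4 - 2) * (\<Sum>i\<in>UNIV. x $ i * x $ i) = ?s powr (- 1 / 4 - 1)"
      by (simp add: inner_vec_def)
    let ?T = "?s powr (- 1 / 4 - 1)" and ?T2 = "?s powr (- 1 / 4 - 2)"
    have "(\<Sum>i\<in>UNIV. ?Hq x $ i $ i)
      = (\<Sum>i\<in>UNIV. H x $ i $ i + (- \<epsilon> / 2 * ?T + \<epsilon> * 5 / 4 * (?T2 * (x $ i * x $ i))))"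
      by (rule sum.cong) (auto simp: mat_def tensor_def algebra_simps)
    also have "\<dots> = (\<Sum>i\<in>UNIV. H x $ i $ i) + real CARD('n) * (- \<epsilon> / 2 * ?T)
       + \<epsilon> * 5 / 4 * (?T2 * (\<Sum>i\<in>UNIV. x $ i * x $ i))"
      by (simp only: sum.distrib sum_distrib_left sum_constant)
    also have "\<dots> = (\<Sum>i\<in>UNIV. H x $ i $ i) + \<epsilon> * ?T * (5 / 4 - real CARD('n) / 2)"
      unfolding p by (simp add: algebra_simps)
    also have "\<dots> < 0"
    proof -
      have "\<epsilon> * ?T * (5 / 4 - real CARD('n) / 2) < 0"
        using \<epsilon> s0 dim by (intro mult_pos_neg mult_pos_pos) auto
      moreover have "(\<Sum>i\<in>UNIV. H x $ i $ i) \<le> 0" using super x(1) KV by blast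
      ultimately show ?thesis by linarith
    qed
    finally show False using sum_nonneg[of UNIV "\<lambda>i. ?Hq x $ i $ i"] diag by (meson not_le)
  qed
  have "((\<lambda>\<epsilon>. g y + \<epsilon> * ?N y) \<longlongrightarrow> g y + 0 * ?N y) (at_right 0)" by (intro tendsto_intros)
  moreover have "\<forall>\<^sub>F \<epsilon> in at_right 0. m \<le> g y + \<epsilon> * ?N y"
    using claim by (auto simp: eventually_at_filter)
  ultimately show ?thesis using tendsto_lowerbound[of _ "g y + 0 * ?N y" "at_right (0::real)" m] by simp
qed

section \<open>Ordered solutions: strong maximum principle, boundary point lemma, isolated singularity\<close>

context elliptic_equation
begin

text \<open>The boundary point lemma: \<open>u - w\<close> dominates a positive multiple of \<open>barrier_shape p e \<kappa>\<close>, whose derivative at \<open>p\<close>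
in direction \<open>e\<close> is 1.\<close>

lemma hopf:
  assumes u: "solution_on V u G H" and w: "solution_on V w Gw Hw" and p: "p \<in> V" and eq: "u p = w p"
    and e: "norm e = 1"
    and above: "\<And>y. y \<in> V - {p} \<Longrightarrow> 0 \<le> barrier_shape p e \<kappa> y \<Longrightarrow> w y < u y"
  shows "0 < (G p - Gw p) \<bullet> e"
proof -
  note V = second_order_onD(1)[OF solution_onD(1)[OF u]]
  have u': "solution_on (V - {p}) u G H" by (rule solution_on_subset[OF u]) (use V in auto)
  obtain c r where c: "0 < c" "0 < r" and
    low: "\<And>y. y \<in> ball p r - {p} \<Longrightarrow> 0 \<le> barrier_shape p e \<kappa> y \<Longrightarrow> c * barrier_shape p e \<kappa> y \<le> u y - w y"
    by (rule barrier_bound[OF w p e u' above]) (assumption+, rule that, assumption+)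
  define g where "g = (\<lambda>y. u y - w y - c * barrier_shape p e \<kappa> y)"
  have "(g has_derivative (\<lambda>v. G p \<bullet> v - Gw p \<bullet> v - c * ((e - (2 * \<kappa>) *\<^sub>R (p - p)) \<bullet> v))) (at p)"
    unfolding g_def
    by (intro has_derivative_diff has_derivative_mult_right second_order_onD(2)[OF solution_onD(1)[OF u] p]
        second_order_onD(2)[OF solution_onD(1)[OF w] p] second_order_onD(2)[OF second_order_on_barrier_shape UNIV_I])
  then have gd: "(g has_derivative (\<lambda>v. (G p - Gw p - c *\<^sub>R e) \<bullet> v)) (at p)"
    by (simp add: inner_diff_left)
  have "((\<lambda>t. g (p + t *\<^sub>R e)) has_derivative (\<lambda>t. (G p - Gw p - c *\<^sub>R e) \<bullet> (t *\<^sub>R e))) (at 0)"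
    by (rule has_derivative_compose[where f = "\<lambda>t. p + t *\<^sub>R e" and g = g])
      (use gd in \<open>auto intro!: derivative_eq_intros\<close>)
  then have der: "((\<lambda>t. g (p + t *\<^sub>R e)) has_real_derivative (G p - Gw p) \<bullet> e - c) (at 0)"
    using e by (simp add: has_field_derivative_def inner_diff_left mult_commute_abs norm_eq_1)
  show ?thesis
  proof (rule ccontr)
    assume "\<not> ?thesis"
    then have "(G p - Gw p) \<bullet> e - c < 0" using c by simp
    from has_real_derivative_neg_dec_right[OF der this]
    obtain d where d: "d > 0" "\<And>t. 0 < t \<Longrightarrow> t < d \<Longrightarrow> g (p + t *\<^sub>R e) < g p"
      by auto
    have gp: "g p = 0" using eq by (simp add: g_def)
    define t where "t = min (d / 2) (min (r / 2) (1 / (\<bar>\<kappa>\<bar> + 1)))"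
    have t: "0 < t" "t < d" "t < r" "t \<le> 1 / (\<bar>\<kappa>\<bar> + 1)" using d c by (auto simp: t_def)
    have "\<kappa> * t \<le> \<bar>\<kappa>\<bar> * (1 / (\<bar>\<kappa>\<bar> + 1))" using t by (intro mult_mono) auto
    also have "\<dots> \<le> 1" by simp
    finally have "\<kappa> * t * t \<le> 1 * t" using t by (intro mult_right_mono) auto
    then have "0 \<le> barrier_shape p e \<kappa> (p + t *\<^sub>R e)"
      using e e[unfolded norm_eq_1] t by (simp add: barrier_shape_def power2_eq_square)
    moreover have "p + t *\<^sub>R e \<in> ball p r - {p}" using t e by (auto simp: dist_norm)
    ultimately have "0 \<le> g (p + t *\<^sub>R e)" using low by (simp add: g_def)
    then show False using d(2)[of t] t gp by simp
  qed
qed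

text \<open>Otherwise some ball in \<open>{w < u}\<close> about a point \<open>y\<close> near \<open>p\<close> has a contact point \<open>q\<close> on its boundary. The
boundary point lemma then gives \<open>u - w\<close> a nonzero gradient at \<open>q\<close>, although \<open>u - w\<close> has a minimum there.\<close>

lemma strong_maximum_principle:
  assumes u: "solution_on V u G H" and w: "solution_on V w Gw Hw"
    and le: "\<And>y. y \<in> V \<Longrightarrow> w y \<le> u y" and p: "p \<in> V" "u p = w p"
  obtains r where "0 < r" "ball p r \<subseteq> V" "\<And>y. y \<in> ball p r \<Longrightarrow> u y = w y"
proof -
  note V = second_order_onD(1)[OF solution_onD(1)[OF u]]
  obtain r where r: "0 < r" "cball p (2 * r) \<subseteq> V"
  proof -
    obtain r where "0 < r" "cball p r \<subseteq> V" using V p(1) open_contains_cball by blast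
    then show ?thesis by (intro that[of "r / 2"]) auto
  qed
  have "u y = w y" if y: "y \<in> ball p r" for y
  proof (rule ccontr)
    assume ne: "u y \<noteq> w y"
    define Z where "Z = {z \<in> cball p (2 * r). u z - w z = 0}"
    have "continuous_on (cball p (2 * r)) (\<lambda>z. u z - w z)"
      using second_order_on_continuous(1)[OF solution_onD(1)[OF u]]
        second_order_on_continuous(1)[OF solution_onD(1)[OF w]] r
      by (intro continuous_on_diff) (auto elim: continuous_on_subset)
    then have "closed Z" unfolding Z_def
      using continuous_closed_preimage_constant[of "cball p (2 * r)" "\<lambda>z. u z - w z" 0] by simp
    moreover have pZ: "p \<in> Z" using r p by (simp add: Z_def)
    ultimately obtain q where q: "q \<in> Z" "\<And>z. z \<in> Z \<Longrightarrow> dist y q \<le> dist y z"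
      using distance_attains_inf[of Z y] by auto
    define R where "R = dist y q"
    have R: "R < r" using q(2)[OF pZ] y by (simp add: R_def dist_commute)
    have yq: "y \<noteq> q" using ne q(1) by (auto simp: Z_def)
    then have R0: "0 < R" by (simp add: R_def)
    have qb: "q \<in> ball p (2 * r)"
      using dist_triangle[of p q y] y R by (simp add: R_def)
    have pos: "w z < u z" if "dist y z < R" for z
    proof -
      have "dist p z < 2 * r" using dist_triangle[of p z y] y that R by simp
      then have "z \<in> cball p (2 * r)" by simp
      moreover have "z \<notin> Z" using q(2)[of z] that by (auto simp: R_def)
      ultimately have "u z \<noteq> w z" "z \<in> V" using r by (auto simp: Z_def)
      with le[of z] show ?thesis by simp
    qed
    define e where "e = (1 / R) *\<^sub>R (y - q)"
    have e: "norm e = 1" using R0 by (simp add: e_def R_def dist_norm)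
    have qV: "q \<in> V" using qb r by auto
    \<comment> \<open>\<open>\<kappa> = 1 / R\<close> belongs to the ball of half the radius, which meets the sphere of radius \<open>R\<close> only in \<open>q\<close>\<close>
    have "0 < (G q - Gw q) \<bullet> e"
    proof (rule hopf[OF u w qV _ e])
      show "u q = w q" using q(1) by (simp add: Z_def)
      fix z assume z: "z \<in> V - {q}" "0 \<le> barrier_shape q e (1 / R) z"
      have zy: "z - y = (z - q) - R *\<^sub>R e" using R0 by (simp add: e_def)
      have "(norm (z - y))\<^sup>2 = (norm (z - q))\<^sup>2 - 2 * R * (e \<bullet> (z - q)) + R\<^sup>2"
        unfolding zy power2_norm_eq_inner using e[unfolded norm_eq_1]
        by (simp add: inner_diff_left inner_diff_right inner_commute power2_eq_square algebra_simps)
      also have "\<dots> < R\<^sup>2"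
      proof -
        have "(norm (z - q))\<^sup>2 \<le> R * (e \<bullet> (z - q))"
          using z(2) R0 by (simp add: barrier_shape_def field_simps)
        moreover have "0 < (norm (z - q))\<^sup>2" using z(1) by simp
        ultimately show ?thesis by linarith
      qed
      finally have "norm (z - y) < R" using R0 by (simp add: power_less_imp_less_base)
      then show "w z < u z" by (intro pos) (simp add: dist_norm norm_minus_commute)
    qed
    moreover have "G q - Gw q = 0"
      by (rule second_order_on_min(1)[OF second_order_on_diff[OF solution_onD(1)[OF u] solution_onD(1)[OF w]] qV])
        (use le q(1) in \<open>auto simp: Z_def\<close>)
    ultimately show False by simp
  qed
  then show ?thesis using r by (intro that[of r]) auto
qed

text \<open>Barriers with \<open>\<kappa> = 0\<close> in the directions of all positive and negative basis vectors give \<open>u y - w y \<ge> c |y|\<close> near 0.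
So \<open>u\<close> minus the first-order Taylor polynomial of \<open>w\<close> at 0 is a superharmonic function with a positive lower bound on a small sphere,
and by the minimum principle this bound persists up to the origin.\<close>

lemma gap_at_singularity:
  assumes w: "solution_on (ball 0 r0) w Gw Hw" and u: "solution_on (ball 0 r0 - {0}) u G H"
    and super: "\<And>x. x \<in> ball 0 r0 - {0} \<Longrightarrow> (\<Sum>i\<in>UNIV. H x $ i $ i) \<le> 0"
    and less: "\<And>y. y \<in> ball 0 r0 - {0} \<Longrightarrow> w y < u y" and r0: "0 < r0"
  obtains c r where "0 < c" "0 < r" "\<And>y. y \<in> ball 0 r - {0} \<Longrightarrow> w y + c \<le> u y"
proof -
  have 0: "(0 :: real^'n) \<in> ball 0 r0" using r0 by simp
  define E where "E = range (\<lambda>i. axis i (1::real) :: real^'n) \<union> range (\<lambda>i. - axis i 1)"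
  have "\<exists>c r. 0 < c \<and> 0 < r \<and> (\<forall>y\<in>ball 0 r - {0}. 0 \<le> e \<bullet> y \<longrightarrow> c * (e \<bullet> y) \<le> u y - w y)"
    if "e \<in> E" for e
  proof -
    have "norm e = 1" using that by (auto simp: E_def)
    then obtain c r where "0 < c" "0 < r"
      "\<And>y. y \<in> ball 0 r - {0} \<Longrightarrow> 0 \<le> barrier_shape 0 e 0 y \<Longrightarrow> c * barrier_shape 0 e 0 y \<le> u y - w y"
      using barrier_bound[OF w 0 _ u less, of e 0] by blast
    then show ?thesis by (intro exI[of _ c] exI[of _ r]) (auto simp: barrier_shape_def)
  qed
  then obtain c r where cr: "\<And>e. e \<in> E \<Longrightarrow> 0 < c e" "\<And>e. e \<in> E \<Longrightarrow> 0 < r e"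
    "\<And>e y. e \<in> E \<Longrightarrow> y \<in> ball 0 (r e) - {0} \<Longrightarrow> 0 \<le> e \<bullet> y \<Longrightarrow> c e * (e \<bullet> y) \<le> u y - w y"
    by metis
  have E: "finite E" "E \<noteq> {}" by (auto simp: E_def)
  define c0 where "c0 = Min (c ` E)"
  define r1 where "r1 = min r0 (Min (r ` E))"
  have c0: "0 < c0" "\<And>e. e \<in> E \<Longrightarrow> c0 \<le> c e" using E cr by (auto simp: c0_def)
  have r1: "0 < r1" "r1 \<le> r0" "\<And>e. e \<in> E \<Longrightarrow> r1 \<le> r e" using E cr r0 by (auto simp: r1_def min_le_iff_disj)
  have comp: "c0 * \<bar>y $ i\<bar> \<le> u y - w y" if y: "y \<in> ball 0 r1 - {0}" for y i
  proof -
    have "c0 * (e \<bullet> y) \<le> u y - w y" if "e \<in> E" "0 \<le> e \<bullet> y" for e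
    proof -
      have "c0 * (e \<bullet> y) \<le> c e * (e \<bullet> y)" using c0(2)[OF that(1)] that(2) by (rule mult_right_mono)
      moreover have "y \<in> ball 0 (r e) - {0}" using y r1(3)[OF that(1)] by auto
      ultimately show ?thesis using cr(3)[OF that(1) _ that(2)] by fastforce
    qed
    from this[of "axis i 1"] this[of "- axis i 1"] show ?thesis
      by (cases "0 \<le> y $ i") (auto simp: E_def inner_axis')
  qed
  define c1 where "c1 = c0 / real CARD('n)"
  have c1: "0 < c1" using c0 by (simp add: c1_def)
  have lin: "c1 * norm y \<le> u y - w y" if y: "y \<in> ball 0 r1 - {0}" for y
  proof -
    have "c0 * norm y \<le> c0 * (\<Sum>i\<in>UNIV. \<bar>y $ i\<bar>)" using norm_le_l1_cart[of y] c0 by (intro mult_left_mono) auto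
    also have "\<dots> = (\<Sum>i\<in>UNIV. c0 * \<bar>y $ i\<bar>)" by (simp add: sum_distrib_left)
    also have "\<dots> \<le> real CARD('n) * (u y - w y)"
      using comp[OF y] by (meson sum_bounded_above UNIV_I)
    finally show ?thesis by (simp add: c1_def field_simps)
  qed
  have "(w has_derivative (\<bullet>) (Gw 0)) (at 0)"
    using second_order_onD(2)[OF solution_onD(1)[OF w] 0] .
  then obtain r2 where r2: "0 < r2" and
    wlin: "\<And>y. norm y < r2 \<Longrightarrow> \<bar>w y - w 0 - Gw 0 \<bullet> y\<bar> \<le> c1 / 2 * norm y"
    using c1 unfolding has_derivative_at_alt by (auto dest!: spec[of _ "c1 / 2"])
  define s where "s = min r1 r2 / 2"
  have s: "0 < s" "s < r1" "s < r2" using r1(1) r2 by (auto simp: s_def)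
  define g where "g = (\<lambda>y. u y - (w 0 + Gw 0 \<bullet> (y - 0)))"
  have sub: "ball 0 r1 - {0} \<subseteq> ball 0 r0 - {0 :: real^'n}" using r1(2) by auto
  have gso: "second_order_on (ball 0 r1 - {0}) g (\<lambda>y. G y - Gw 0) (\<lambda>y. H y - 0)"
    unfolding g_def
    by (intro second_order_on_diff second_order_on_affine second_order_on_subset[OF solution_onD(1)[OF u] _ sub]) auto
  have glow: "- \<bar>w 0\<bar> - norm (Gw 0) * r1 \<le> g x" if "x \<in> ball 0 r1 - {0}" for x
  proof -
    have "Gw 0 \<bullet> x \<le> norm (Gw 0) * norm x" by (rule norm_cauchy_schwarz)
    also have "\<dots> \<le> norm (Gw 0) * r1" using that by (intro mult_left_mono) auto
    finally have "Gw 0 \<bullet> x \<le> norm (Gw 0) * r1" .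
    moreover have "0 < u x" using solution_onD(2)[OF u] that sub by blast
    ultimately show ?thesis by (simp add: g_def)
  qed
  have gsup: "(\<Sum>i\<in>UNIV. (H x - 0) $ i $ i) \<le> 0" if "x \<in> ball 0 r1 - {0}" for x
    using super that sub by auto
  have gbd: "c1 / 2 * s \<le> g x" if "norm x = s" for x
  proof -
    have "x \<in> ball 0 r1 - {0}" using that s by auto
    from lin[OF this] wlin[of x] that s
    have "c1 * s \<le> u x - w x" "\<bar>w x - w 0 - Gw 0 \<bullet> x\<bar> \<le> c1 / 2 * s" by simp_all
    moreover have "c1 * s = c1 / 2 * s + c1 / 2 * s" by simp
    moreover have "g x = u x - w 0 - Gw 0 \<bullet> x" by (simp add: g_def)
    ultimately show ?thesis by linarith
  qed
  have glb: "c1 / 2 * s \<le> g y" if "norm y \<le> s" "y \<noteq> 0" for y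
    by (rule superharmonic_minimum_principle[OF dim gso gsup glow s(1,2) gbd that])
  show ?thesis
  proof (rule that[of "c1 / 4 * s" "s / 2"])
    show "0 < c1 / 4 * s" "0 < s / 2" using c1 s by auto
    fix y :: "real^'n" assume y: "y \<in> ball 0 (s / 2) - {0}"
    have "c1 / 2 * s \<le> g y" using glb[of y] y s by auto
    moreover have "\<bar>w y - w 0 - Gw 0 \<bullet> y\<bar> \<le> c1 / 2 * norm y" using wlin[of y] y s by auto
    moreover have "c1 / 2 * norm y \<le> c1 / 2 * (s / 2)" using y c1 by (intro mult_left_mono) auto
    moreover have "g y = u y - w 0 - Gw 0 \<bullet> y" by (simp add: g_def)
    moreover have "c1 / 2 * (s / 2) = c1 / 4 * s" "c1 / 2 * s = 2 * (c1 / 4 * s)" by simp_all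
    ultimately show "w y + c1 / 4 * s \<le> u y" by linarith
  qed
qed

end

section \<open>The Kelvin transform and conformal invariance\<close>

lemma bilinear_matrix_matrix_mult:
  "bilinear ((**) :: real^'n^'m \<Rightarrow> real^'k^'n \<Rightarrow> real^'k^'m)"
  unfolding bilinear_def linear_iff
  by (auto simp: matrix_matrix_mult_def vec_eq_iff sum.distrib sum_distrib_left algebra_simps)

lemmas continuous_on_matrix_matrix_mult =
  bounded_bilinear.continuous_on [OF bilinear_matrix_matrix_mult[unfolded bilinear_conv_bounded_bilinear]]

definition inversion :: "real^'n \<Rightarrow> real \<Rightarrow> real^'n \<Rightarrow> real^'n" where
  "inversion x \<mu> y = x + (\<mu>\<^sup>2 / ((y - x) \<bullet> (y - x))) *\<^sub>R (y - x)"

definition kelvin :: "real^'n \<Rightarrow> real \<Rightarrow> (real^'n \<Rightarrow> real) \<Rightarrow> real^'n \<Rightarrow> real" where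
  "kelvin x \<mu> u y = (\<mu>\<^sup>2 / ((y - x) \<bullet> (y - x))) powr ((real CARD('n) - 2) / 2) * u (inversion x \<mu> y)"

definition reflection :: "real^'n \<Rightarrow> real^'n^'n" where
  "reflection z = mat 1 - (2 / (z \<bullet> z)) *\<^sub>R tensor z z"

lemma reflection_vector: "reflection z *v v = v - (2 / (z \<bullet> z) * (z \<bullet> v)) *\<^sub>R z"
  by (simp add: reflection_def matrix_vector_mult_diff_rdistrib scaleR_matrix_vector_assoc[symmetric]
      tensor_vector_mult)

lemma reflection_involution:
  assumes "z \<noteq> 0" shows "reflection z ** reflection z = mat 1"
proof -
  have "(reflection z ** reflection z) *v v = mat 1 *v v" for v
    using assms by (simp add: matrix_vector_mul_assoc[symmetric] reflection_vector inner_diff_right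
        vec_eq_iff field_simps)
  then show ?thesis by (simp add: matrix_eq)
qed

lemma reflection_sym: "transpose (reflection z) = reflection z"
proof -
  have "reflection z \<in> sym_mats" unfolding reflection_def
    by (intro subspace_diff subspace_scale subspace_sym_mats) auto
  then show ?thesis by (simp add: sym_mats_def)
qed

lemma orthogonal_reflection: "z \<noteq> 0 \<Longrightarrow> orthogonal_matrix (reflection z)"
  by (simp add: orthogonal_matrix_def reflection_sym reflection_involution)

lemma matrix_inv_reflection:
  assumes "z \<noteq> 0" shows "matrix_inv (reflection z) = reflection z"
proof -
  have "\<exists>A. reflection z ** A = mat 1 \<and> A ** reflection z = mat 1"
    using reflection_involution[OF assms] by blast
  then have "matrix_inv (reflection z) ** reflection z = mat 1"
    unfolding matrix_inv_def by (rule someI2_ex) blast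
  then show ?thesis
    by (metis matrix_mul_assoc matrix_mul_lid matrix_mul_rid reflection_involution[OF assms])
qed

text \<open>The gradient and the Hessian of the Kelvin transform, with \<open>m = \<mu>\<^sup>2 / s\<close> the conformal factor of the inversion, whose
derivative is \<open>m\<close> times a reflection.\<close>

definition kelvin_grad where
  "kelvin_grad x \<mu> u G y = (let n = real CARD('n); z = y - x; s = z \<bullet> z; m = \<mu>\<^sup>2 / s; I = inversion x \<mu> y in
     m powr ((n - 2) / 2) *\<^sub>R (m *\<^sub>R (reflection z *v G I) - ((n - 2) * u I / s) *\<^sub>R z))"
  for x :: "real^'n"

definition kelvin_hess where
  "kelvin_hess x \<mu> u G H y = (let n = real CARD('n); z = y - x; s = z \<bullet> z; m = \<mu>\<^sup>2 / s; I = inversion x \<mu> y; b = z \<bullet> G I in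
     m powr ((n - 2) / 2) *\<^sub>R (m\<^sup>2 *\<^sub>R (reflection z ** H I ** reflection z)
       + (n / s * ((n - 2) * u I / s + 4 * m * b / s)) *\<^sub>R tensor z z
       - (n * m / s) *\<^sub>R (tensor z (G I) + tensor (G I) z)
       - ((n - 2) * u I / s + 2 * m * b / s) *\<^sub>R mat 1))"
  for x :: "real^'n"

lemma has_derivative_inversion:
  assumes "y \<noteq> x"
  shows "(inversion x \<mu> has_derivative
    (\<lambda>v. (\<mu>\<^sup>2 / ((y - x) \<bullet> (y - x))) *\<^sub>R (reflection (y - x) *v v))) (at y)"
proof -
  have s: "(y - x) \<bullet> (y - x) \<noteq> 0" using assms by simp
  have d: "((\<lambda>y. (y - x) \<bullet> (y - x)) has_derivative (\<lambda>v. 2 * ((y - x) \<bullet> v))) (at y)"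
    by (rule has_derivative_eq_rhs[OF has_derivative_inner]) (auto intro!: derivative_eq_intros simp: inner_commute fun_eq_iff)
  have l: "((\<lambda>y. y - x) has_derivative (\<lambda>v. v)) (at y)"
    by (auto intro!: derivative_eq_intros)
  have q: "((\<lambda>y. \<mu>\<^sup>2 / ((y - x) \<bullet> (y - x))) has_derivative
      (\<lambda>v. - (\<mu>\<^sup>2 * (2 * ((y - x) \<bullet> v)) / ((y - x) \<bullet> (y - x))\<^sup>2))) (at y)"
    by (rule has_derivative_eq_rhs[OF has_derivative_divide[OF has_derivative_const d s]])
      (use s in \<open>simp add: fun_eq_iff field_simps power2_eq_square\<close>)
  show ?thesis
    unfolding inversion_def[abs_def]
    by (rule has_derivative_eq_rhs[OF has_derivative_add[OF has_derivative_const has_derivative_scaleR[OF q l]]])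
      (use s in \<open>simp add: fun_eq_iff reflection_vector vec_eq_iff field_simps power2_eq_square\<close>)
qed

lemma kelvin_powr_eq:
  assumes "y \<noteq> x" "0 < \<mu>"
  shows "(\<mu>\<^sup>2 / ((y - x) \<bullet> (y - x))) powr a = \<mu> powr (2 * a) * ((y - x) \<bullet> (y - x)) powr (- a)"
proof -
  have "\<mu>\<^sup>2 = \<mu> powr 2" using assms(2) by simp
  then show ?thesis using assms
    by (simp only: powr_divide powr_powr powr_minus_divide) (simp add: powr_divide powr_powr powr_minus_divide)
qed

text \<open>One component of the derivative of \<open>kelvin_grad\<close> in direction \<open>v\<close>. Here \<open>p\<close>, \<open>q\<close>, \<open>b\<close>, \<open>h\<close> stand for the inner
products \<open>z \<bullet> v\<close>, \<open>G \<bullet> v\<close>, \<open>z \<bullet> G\<close>, \<open>z \<bullet> Hx\<close>, where \<open>Hx\<close> is \<open>H\<close> applied to the reflection of \<open>v\<close>.\<close>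

lemma kelvin_hess_algebra:
  fixes c s m u k p q b h Hi zi vi Gi :: real
  assumes "s \<noteq> 0"
  shows "c / s * (m * s * (m * Hi) - k * (m * (q - 2 / s * p * b)) * zi - k * u * vi
           - 2 * (m * s) * (((q + m * h) / s - b * (2 * p) / s\<^sup>2) * zi + b / s * vi))
         - c * (k + 2) / s\<^sup>2 * p * (m * s * Gi - k * u * zi - 2 * (m * s) * (b / s) * zi)
       = c * (m\<^sup>2 * (Hi - 2 / s * h * zi) + (k + 2) / s * (k * u / s + 4 * m * b / s) * p * zi
           - (k + 2) * m / s * (q * zi + p * Gi) - (k * u / s + 2 * m * b / s) * vi)"
  using assms by (simp add: field_simps power2_eq_square)

text \<open>The gradient is differentiated in the form \<open>(\<mu> powr k * s powr (- k / 2 - 1)) *\<^sub>R P\<close> with \<open>k = n - 2\<close>, which keeps the single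
power of \<open>s\<close> apart from the vector \<open>P\<close> of products and quotients.\<close>

lemma second_order_on_kelvin:
  fixes x :: "real^'n"
  assumes so: "second_order_on V u G H" and \<mu>: "0 < \<mu>"
  shows "second_order_on {y. y \<noteq> x \<and> inversion x \<mu> y \<in> V} (kelvin x \<mu> u)
     (kelvin_grad x \<mu> u G) (kelvin_hess x \<mu> u G H)"
proof -
  let ?V = "{y. y \<noteq> x \<and> inversion x \<mu> y \<in> V}"
  note D = second_order_onD[OF so] and C = second_order_on_continuous[OF so]
  define k where "k = real CARD('n) - 2"
  have n: "real CARD('n) = k + 2" by (simp add: k_def)
  have icont: "continuous_on (UNIV - {x}) (inversion x \<mu>)"
    by (rule continuous_at_imp_continuous_on) (use has_derivative_inversion has_derivative_continuous in blast)
  have Veq: "?V = (UNIV - {x}) \<inter> inversion x \<mu> -` V" by auto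
  have "open ?V" unfolding Veq
    by (rule continuous_open_preimage[OF icont _ D(1)]) auto
  moreover have "(kelvin x \<mu> u has_derivative (\<lambda>v. kelvin_grad x \<mu> u G y \<bullet> v)) (at y)"
    and "(kelvin_grad x \<mu> u G has_derivative (\<lambda>v. kelvin_hess x \<mu> u G H y *v v)) (at y)"
    if y: "y \<in> ?V" for y
  proof -
    from y have yx: "y \<noteq> x" and IV: "inversion x \<mu> y \<in> V" by auto
    define z where "z = y - x"
    define s where "s = z \<bullet> z"
    define m where "m = \<mu>\<^sup>2 / s"
    define I where "I = inversion x \<mu> y"
    define c where "c = m powr (k / 2)"
    have s0: "s \<noteq> 0" "0 < s" using yx by (auto simp: s_def z_def)
    have ms: "\<mu>\<^sup>2 = m * s" using s0 by (simp add: m_def)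
    have dI: "(inversion x \<mu> has_derivative (\<lambda>v. m *\<^sub>R (reflection z *v v))) (at y)"
      using has_derivative_inversion[OF yx, of \<mu>] by (simp add: m_def s_def z_def)
    have uI: "((\<lambda>y. u (inversion x \<mu> y)) has_derivative (\<lambda>v. G I \<bullet> (m *\<^sub>R (reflection z *v v)))) (at y)"
      by (rule has_derivative_compose[OF dI]) (use D(2)[OF IV] in \<open>simp add: I_def\<close>)
    have GI: "((\<lambda>y. G (inversion x \<mu> y)) has_derivative (\<lambda>v. H I *v (m *\<^sub>R (reflection z *v v)))) (at y)"
      by (rule has_derivative_compose[OF dI]) (use D(3)[OF IV] in \<open>simp add: I_def\<close>)
    have l: "((\<lambda>y. y - x) has_derivative (\<lambda>v. v)) (at y)"
      by (auto intro!: derivative_eq_intros)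
    have ss: "((\<lambda>y. (y - x) \<bullet> (y - x)) has_derivative (\<lambda>v. 2 * (z \<bullet> v))) (at y)"
      by (rule has_derivative_eq_rhs[OF has_derivative_inner[OF l l]]) (simp add: fun_eq_iff inner_commute z_def)
    have pw: "((\<lambda>y. ((y - x) \<bullet> (y - x)) powr b) has_derivative (\<lambda>v. 2 * b * s powr (b - 1) * (z \<bullet> v))) (at y)" for b
      using has_derivative_inner_self_powr[OF yx, of b] by (simp add: s_def z_def)
    have c_eq: "c = \<mu> powr k * s powr (- k / 2)"
      using kelvin_powr_eq[OF yx \<mu>, of "k / 2"] by (simp add: c_def m_def s_def z_def)
    have s_powr: "s powr (b - 1) = s powr b / s" for b
      using s0 by (simp add: powr_diff)
    let ?w = "\<lambda>y. \<mu> powr k * ((y - x) \<bullet> (y - x)) powr (- k / 2) * u (inversion x \<mu> y)"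
    have dw: "(?w has_derivative (\<lambda>v. c * (G I \<bullet> (m *\<^sub>R (reflection z *v v)))
         + (\<mu> powr k * (2 * (- k / 2) * s powr (- k / 2 - 1) * (z \<bullet> v))) * u I)) (at y)"
      by (rule has_derivative_eq_rhs[OF has_derivative_mult[OF has_derivative_mult_right[OF pw] uI]])
        (simp add: fun_eq_iff c_eq s_def z_def I_def)
    have grad: "kelvin_grad x \<mu> u G y = c *\<^sub>R (m *\<^sub>R (reflection z *v G I) - (k * u I / s) *\<^sub>R z)"
      by (simp add: kelvin_grad_def Let_def c_def m_def s_def z_def k_def I_def)
    have "(\<lambda>v. c * (G I \<bullet> (m *\<^sub>R (reflection z *v v)))
         + (\<mu> powr k * (2 * (- k / 2) * s powr (- k / 2 - 1) * (z \<bullet> v))) * u I)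
       = (\<lambda>v. kelvin_grad x \<mu> u G y \<bullet> v)"
    proof
      fix v
      have f: "\<mu> powr k * (2 * (- k / 2) * s powr (- k / 2 - 1) * (z \<bullet> v)) = - (k * c / s) * (z \<bullet> v)"
        unfolding s_powr c_eq by simp
      show "c * (G I \<bullet> (m *\<^sub>R (reflection z *v v)))
         + (\<mu> powr k * (2 * (- k / 2) * s powr (- k / 2 - 1) * (z \<bullet> v))) * u I = kelvin_grad x \<mu> u G y \<bullet> v"
        unfolding f grad reflection_vector using s0
        by (simp add: inner_diff_left inner_diff_right inner_add_left s_def[symmetric] inner_commute[of "G I"] field_simps)
    qed
    with dw have dw': "(?w has_derivative (\<lambda>v. kelvin_grad x \<mu> u G y \<bullet> v)) (at y)" by simp
    show "(kelvin x \<mu> u has_derivative (\<lambda>v. kelvin_grad x \<mu> u G y \<bullet> v)) (at y)"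
    proof (rule has_derivative_transform_within_open[OF dw', of "UNIV - {x}"])
      show "?w y = kelvin x \<mu> u y" if "y \<in> UNIV - {x}" for y
      proof -
        have "(\<mu>\<^sup>2 / ((y - x) \<bullet> (y - x))) powr (k / 2) = \<mu> powr k * ((y - x) \<bullet> (y - x)) powr (- k / 2)"
          using kelvin_powr_eq[of y x \<mu> "k / 2"] that \<mu> by simp
        then show ?thesis unfolding kelvin_def k_def[symmetric] by simp
      qed
    qed (use yx in auto)
    let ?b = "\<lambda>y. (y - x) \<bullet> G (inversion x \<mu> y)"
    define b where "b = z \<bullet> G I"
    have bI: "(?b has_derivative (\<lambda>v. z \<bullet> (H I *v (m *\<^sub>R (reflection z *v v))) + v \<bullet> G I)) (at y)"
      by (rule has_derivative_eq_rhs[OF has_derivative_inner[OF l GI]]) (simp add: z_def I_def)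
    have bs: "((\<lambda>y. ?b y / ((y - x) \<bullet> (y - x))) has_derivative
       (\<lambda>v. (z \<bullet> (H I *v (m *\<^sub>R (reflection z *v v))) + v \<bullet> G I) / s - b * (2 * (z \<bullet> v)) / s\<^sup>2)) (at y)"
      by (rule has_derivative_eq_rhs[OF has_derivative_divide[OF bI ss]])
        (use s0 in \<open>simp_all add: fun_eq_iff s_def[symmetric] z_def[symmetric] I_def[symmetric] b_def
          field_simps power2_eq_square\<close>)
    let ?P = "\<lambda>y. \<mu>\<^sup>2 *\<^sub>R G (inversion x \<mu> y) - (k * u (inversion x \<mu> y)) *\<^sub>R (y - x)
        - (2 * \<mu>\<^sup>2 * (?b y / ((y - x) \<bullet> (y - x)))) *\<^sub>R (y - x)"
    have dP: "(?P has_derivative (\<lambda>v. \<mu>\<^sup>2 *\<^sub>R (H I *v (m *\<^sub>R (reflection z *v v)))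
        - ((k * u I) *\<^sub>R v + (k * (G I \<bullet> (m *\<^sub>R (reflection z *v v)))) *\<^sub>R z)
        - ((2 * \<mu>\<^sup>2 * (b / s)) *\<^sub>R v + (2 * \<mu>\<^sup>2 * ((z \<bullet> (H I *v (m *\<^sub>R (reflection z *v v))) + v \<bullet> G I) / s
            - b * (2 * (z \<bullet> v)) / s\<^sup>2)) *\<^sub>R z))) (at y)"
      by (rule has_derivative_eq_rhs[OF has_derivative_diff[OF has_derivative_diff[OF
              has_derivative_scaleR_right[OF GI] has_derivative_scaleR[OF has_derivative_mult_right[OF uI] l]]
              has_derivative_scaleR[OF has_derivative_mult_right[OF bs] l]]])
        (simp add: s_def z_def I_def b_def)
    let ?GW = "\<lambda>y. (\<mu> powr k * ((y - x) \<bullet> (y - x)) powr (- k / 2 - 1)) *\<^sub>R ?P y"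
    have c_eq2: "\<mu> powr k * s powr (- k / 2 - 1) = c / s" unfolding s_powr c_eq by simp
    define P where "P = \<mu>\<^sup>2 *\<^sub>R G I - (k * u I) *\<^sub>R z - (2 * \<mu>\<^sup>2 * (b / s)) *\<^sub>R z"
    have dGW: "(?GW has_derivative (\<lambda>v. (c / s) *\<^sub>R (\<mu>\<^sup>2 *\<^sub>R (H I *v (m *\<^sub>R (reflection z *v v)))
        - ((k * u I) *\<^sub>R v + (k * (G I \<bullet> (m *\<^sub>R (reflection z *v v)))) *\<^sub>R z)
        - ((2 * \<mu>\<^sup>2 * (b / s)) *\<^sub>R v + (2 * \<mu>\<^sup>2 * ((z \<bullet> (H I *v (m *\<^sub>R (reflection z *v v))) + v \<bullet> G I) / s
            - b * (2 * (z \<bullet> v)) / s\<^sup>2)) *\<^sub>R z))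
       + (\<mu> powr k * (2 * (- k / 2 - 1) * s powr (- k / 2 - 1 - 1) * (z \<bullet> v))) *\<^sub>R P)) (at y)"
      by (rule has_derivative_eq_rhs[OF has_derivative_scaleR[OF has_derivative_mult_right[OF pw] dP]])
        (simp only: s_def[symmetric] z_def[symmetric] I_def[symmetric] b_def[symmetric] P_def c_eq2)
    have hess: "kelvin_hess x \<mu> u G H y = c *\<^sub>R (m\<^sup>2 *\<^sub>R (reflection z ** H I ** reflection z)
       + ((k + 2) / s * (k * u I / s + 4 * m * b / s)) *\<^sub>R tensor z z
       - ((k + 2) * m / s) *\<^sub>R (tensor z (G I) + tensor (G I) z)
       - (k * u I / s + 2 * m * b / s) *\<^sub>R mat 1)"
      by (simp add: kelvin_hess_def Let_def c_def m_def s_def z_def k_def I_def b_def)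
    have dGW': "(?GW has_derivative (\<lambda>v. kelvin_hess x \<mu> u G H y *v v)) (at y)"
    proof (rule has_derivative_eq_rhs[OF dGW], rule ext)
      fix v
      define Hx where "Hx = H I *v (reflection z *v v)"
      define p where "p = z \<bullet> v"
      define q where "q = G I \<bullet> v"
      define h where "h = z \<bullet> Hx"
      have e1: "\<mu> powr k * (2 * (- k / 2 - 1) * s powr (- k / 2 - 1 - 1) * (z \<bullet> v)) = - (c * (k + 2) / s\<^sup>2 * p)"
      proof -
        have "A * (2 * (- k / 2 - 1) * (X / s / s) * p) = - (A * X * (k + 2) / s\<^sup>2 * p)" for A X
          using s0 by (simp add: field_simps power2_eq_square)
        then show ?thesis unfolding s_powr c_eq p_def .
      qed
      have e2: "H I *v (m *\<^sub>R (reflection z *v v)) = m *\<^sub>R Hx"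
        by (simp add: matrix_vector_mult_scaleR Hx_def)
      have e3: "G I \<bullet> (m *\<^sub>R (reflection z *v v)) = m * (q - 2 / s * p * b)"
        by (simp add: reflection_vector inner_diff_right q_def p_def b_def s_def inner_commute)
      have e4: "z \<bullet> (m *\<^sub>R Hx) + v \<bullet> G I = q + m * h" by (simp add: h_def q_def inner_commute)
      have rhs: "kelvin_hess x \<mu> u G H y *v v = c *\<^sub>R (m\<^sup>2 *\<^sub>R (Hx - (2 / s * h) *\<^sub>R z)
          + ((k + 2) / s * (k * u I / s + 4 * m * b / s) * p) *\<^sub>R z
          - ((k + 2) * m / s) *\<^sub>R (q *\<^sub>R z + p *\<^sub>R G I) - (k * u I / s + 2 * m * b / s) *\<^sub>R v)"
        unfolding hess
        by (simp add: matrix_vector_mult_add_rdistrib matrix_vector_mult_diff_rdistrib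
            scaleR_matrix_vector_assoc[symmetric] tensor_vector_mult matrix_vector_mul_assoc[symmetric]
            Hx_def[symmetric] reflection_vector[of z Hx] h_def[symmetric] p_def[symmetric] q_def[symmetric] s_def[symmetric])
      show "(c / s) *\<^sub>R (\<mu>\<^sup>2 *\<^sub>R (H I *v (m *\<^sub>R (reflection z *v v)))
        - ((k * u I) *\<^sub>R v + (k * (G I \<bullet> (m *\<^sub>R (reflection z *v v)))) *\<^sub>R z)
        - ((2 * \<mu>\<^sup>2 * (b / s)) *\<^sub>R v + (2 * \<mu>\<^sup>2 * ((z \<bullet> (H I *v (m *\<^sub>R (reflection z *v v))) + v \<bullet> G I) / s
            - b * (2 * (z \<bullet> v)) / s\<^sup>2)) *\<^sub>R z))
       + (\<mu> powr k * (2 * (- k / 2 - 1) * s powr (- k / 2 - 1 - 1) * (z \<bullet> v))) *\<^sub>R P = kelvin_hess x \<mu> u G H y *v v"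
        unfolding rhs e1 e2 e3 e4 P_def ms unfolding p_def[symmetric]
      proof (simp only: vec_eq_iff vector_add_component vector_minus_component vector_scaleR_component
          real_scaleR_def, intro allI, goal_cases)
        case (1 i)
        show ?case
          using kelvin_hess_algebra[OF s0(1), of c m "Hx $ i" k q p b "z $ i" "u I" "v $ i" h "G I $ i"]
          by (simp add: algebra_simps)
      qed
    qed
    show "(kelvin_grad x \<mu> u G has_derivative (\<lambda>v. kelvin_hess x \<mu> u G H y *v v)) (at y)"
    proof (rule has_derivative_transform_within_open[OF dGW', of "UNIV - {x}"])
      fix y assume "y \<in> UNIV - {x}"
      then have yx: "y \<noteq> x" by simp
      define s where "s = (y - x) \<bullet> (y - x)"
      have s0: "0 < s" using yx by (simp add: s_def)
      have e: "\<mu> powr k * s powr (- k / 2 - 1) = (\<mu>\<^sup>2 / s) powr (k / 2) / s"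
        using kelvin_powr_eq[OF yx \<mu>, of "k / 2"] s0 by (simp add: s_def powr_diff)
      show "?GW y = kelvin_grad x \<mu> u G y"
        unfolding kelvin_grad_def Let_def s_def[symmetric] k_def[symmetric] e reflection_vector
        using s0 by (simp add: vec_eq_iff field_simps)
    qed (use yx in auto)
  qed
  moreover have "continuous_on ?V (kelvin_hess x \<mu> u G H)"
  proof -
    have i: "continuous_on ?V (inversion x \<mu>)" by (rule continuous_on_subset[OF icont]) auto
    have uI: "continuous_on ?V (\<lambda>y. u (inversion x \<mu> y))" and GI: "continuous_on ?V (\<lambda>y. G (inversion x \<mu> y))"
      and HI: "continuous_on ?V (\<lambda>y. H (inversion x \<mu> y))"
      using i C by (auto intro!: continuous_on_compose2[OF _ i])
    have s: "continuous_on ?V (\<lambda>y. (y - x) \<bullet> (y - x))" by (intro continuous_intros)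
    show ?thesis
      unfolding kelvin_hess_def[abs_def] Let_def reflection_def
      by (intro continuous_on_scaleR continuous_on_add continuous_on_diff continuous_on_powr' continuous_on_divide
          continuous_on_mult continuous_on_matrix_matrix_mult continuous_on_tensor continuous_on_inner
          continuous_on_power continuous_on_const continuous_on_id uI GI HI s)
        (use \<mu> in auto)
  qed
  ultimately show ?thesis unfolding second_order_on_def by blast
qed

text \<open>After the power of \<open>t\<close> is taken out, what remains is a polynomial in \<open>t\<close>, \<open>g\<close> and \<open>H\<close>, so that conformal invariance
becomes a polynomial identity.\<close>

lemma conf_op_factor:
  fixes H :: "real^'n^'n"
  assumes dim: "CARD('n) \<ge> 3" and t: "0 < t"
  defines "n \<equiv> real CARD('n)"
  shows "conf_op t g H = t powr (- (2 * n / (n - 2))) *\<^sub>R ((- (2 / (n - 2)) * t) *\<^sub>R H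
     + (2 * n / (n - 2)\<^sup>2) *\<^sub>R tensor g g - (2 / (n - 2)\<^sup>2 * (g \<bullet> g)) *\<^sub>R mat 1)"
proof -
  have "n - 2 \<noteq> 0" using dim by (simp add: n_def)
  then have e: "- ((n + 2) / (n - 2)) = - (2 * n / (n - 2)) + 1" by (simp add: field_simps)
  have "t powr (- ((n + 2) / (n - 2))) = t powr (- (2 * n / (n - 2))) * t"
    unfolding e by (subst powr_add) (use t in simp)
  then show ?thesis
    unfolding conf_op_def Let_def n_def[symmetric] power2_norm_eq_inner
    by (simp add: scaleR_add_right scaleR_diff_right mult_ac)
qed

text \<open>One component of that identity, in the notation of \<open>kelvin_hess_algebra\<close>, with \<open>g\<close> for \<open>G \<bullet> G\<close>.\<close>

lemma conf_op_kelvin_algebra: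
  fixes s m u k p q b h g Hi zi vi Gi :: real
  assumes "s \<noteq> 0" "k \<noteq> 0"
  shows "- (2 / k) * u * (m\<^sup>2 * (Hi - 2 / s * h * zi) + (k + 2) / s * (k * u / s + 4 * m * b / s) * p * zi
           - (k + 2) * m / s * (q * zi + p * Gi) - (k * u / s + 2 * m * b / s) * vi)
     + 2 * (k + 2) / k\<^sup>2 * (m * (q - 2 / s * p * b) - k * u / s * p) * (m * (Gi - 2 / s * b * zi) - k * u / s * zi)
     - 2 / k\<^sup>2 * (m\<^sup>2 * g + 2 * m * k * u * b / s + k\<^sup>2 * u\<^sup>2 / s) * vi
   = m\<^sup>2 * (- (2 / k) * u * (Hi - 2 / s * h * zi) + 2 * (k + 2) / k\<^sup>2 * (q - 2 / s * p * b) * (Gi - 2 / s * b * zi)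
     - 2 / k\<^sup>2 * g * vi)"
  using assms by (simp add: field_simps power2_eq_square)


text \<open>Conformal invariance: the matrix of the Kelvin transform is the matrix of \<open>u\<close> at the inverted point, conjugated by a
reflection. The scalar factor \<open>c\<^sup>2 m\<^sup>2\<close> of the polynomial part is a power of \<open>m\<close> that cancels against the power of
\<open>c\<close> coming from the value of the Kelvin transform.\<close>

lemma conf_op_kelvin:
  fixes x :: "real^'n"
  assumes dim: "CARD('n) \<ge> 3" and \<mu>: "0 < \<mu>" and yx: "y \<noteq> x" and upos: "0 < u (inversion x \<mu> y)"
  shows "conf_op (kelvin x \<mu> u y) (kelvin_grad x \<mu> u G y) (kelvin_hess x \<mu> u G H y) =
    reflection (y - x) ** conf_op (u (inversion x \<mu> y)) (G (inversion x \<mu> y)) (H (inversion x \<mu> y)) ** reflection (y - x)"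
proof -
  define k where "k = real CARD('n) - 2"
  have n: "real CARD('n) = k + 2" and k: "k \<noteq> 0" using dim by (simp_all add: k_def)
  define z where "z = y - x"
  define s where "s = z \<bullet> z"
  define m where "m = \<mu>\<^sup>2 / s"
  define I where "I = inversion x \<mu> y"
  define c where "c = m powr (k / 2)"
  define b where "b = z \<bullet> G I"
  have s0: "s \<noteq> 0" "0 < s" using yx by (auto simp: s_def z_def)
  have m0: "0 < m" using s0 \<mu> by (simp add: m_def)
  have c0: "0 < c" using m0 by (simp add: c_def)
  have uI: "0 < u I" using upos by (simp add: I_def)
  have w: "kelvin x \<mu> u y = c * u I"
    by (simp add: kelvin_def c_def m_def s_def z_def I_def k_def)
  let ?g = "m *\<^sub>R (reflection z *v G I) - (k * u I / s) *\<^sub>R z"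
  have grad: "kelvin_grad x \<mu> u G y = c *\<^sub>R ?g"
    by (simp add: kelvin_grad_def Let_def c_def m_def s_def z_def k_def I_def)
  let ?h = "m\<^sup>2 *\<^sub>R (reflection z ** H I ** reflection z)
       + ((k + 2) / s * (k * u I / s + 4 * m * b / s)) *\<^sub>R tensor z z
       - ((k + 2) * m / s) *\<^sub>R (tensor z (G I) + tensor (G I) z)
       - (k * u I / s + 2 * m * b / s) *\<^sub>R mat 1"
  have hess: "kelvin_hess x \<mu> u G H y = c *\<^sub>R ?h"
    by (simp add: kelvin_hess_def Let_def c_def m_def s_def z_def k_def I_def b_def)
  have zR: "z \<bullet> (reflection z *v v) = - (z \<bullet> v)" for v
    using s0 by (simp add: reflection_vector inner_diff_right s_def)
  have RR: "reflection z *v (reflection z *v v) = v" for v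
    using yx by (simp add: matrix_vector_mul_assoc reflection_involution z_def)
  have RGRG: "(reflection z *v G I) \<bullet> (reflection z *v G I) = G I \<bullet> G I"
    using sym_mats_inner[of "reflection z" "reflection z *v G I" "G I"] reflection_sym[of z]
    by (simp add: sym_mats_def RR)
  have Rz: "(reflection z *v G I) \<bullet> z = - b"
    unfolding inner_commute[of _ z] zR b_def ..
  have gg: "?g \<bullet> ?g = m\<^sup>2 * (G I \<bullet> G I) + 2 * m * k * u I * b / s + k\<^sup>2 * (u I)\<^sup>2 / s"
  proof -
    have "?g \<bullet> ?g = m * m * (G I \<bullet> G I) + 2 * (m * (k * u I / s) * b) + (k * u I / s) * (k * u I / s) * s"
      by (simp add: inner_diff_left inner_diff_right RGRG Rz inner_commute[of z "_ *v _"] s_def algebra_simps)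
    then show ?thesis using s0 by (simp add: power2_eq_square field_simps)
  qed
  let ?Bw = "(- (2 / k) * (c * u I)) *\<^sub>R (c *\<^sub>R ?h)
     + (2 * (k + 2) / k\<^sup>2) *\<^sub>R tensor (c *\<^sub>R ?g) (c *\<^sub>R ?g) - (2 / k\<^sup>2 * ((c *\<^sub>R ?g) \<bullet> (c *\<^sub>R ?g))) *\<^sub>R mat 1"
  let ?Bu = "(- (2 / k) * u I) *\<^sub>R H I
     + (2 * (k + 2) / k\<^sup>2) *\<^sub>R tensor (G I) (G I) - (2 / k\<^sup>2 * (G I \<bullet> G I)) *\<^sub>R mat 1"
  have B: "?Bw = (c\<^sup>2 * m\<^sup>2) *\<^sub>R (reflection z ** ?Bu ** reflection z)"
  proof -
    have "?Bw *v v = ((c\<^sup>2 * m\<^sup>2) *\<^sub>R (reflection z ** ?Bu ** reflection z)) *v v" for v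
    proof -
      define Hx where "Hx = H I *v (reflection z *v v)"
      define p where "p = z \<bullet> v"
      define q where "q = G I \<bullet> v"
      define h where "h = z \<bullet> Hx"
      have hv: "?h *v v = m\<^sup>2 *\<^sub>R (Hx - (2 / s * h) *\<^sub>R z)
          + ((k + 2) / s * (k * u I / s + 4 * m * b / s) * p) *\<^sub>R z
          - ((k + 2) * m / s) *\<^sub>R (q *\<^sub>R z + p *\<^sub>R G I) - (k * u I / s + 2 * m * b / s) *\<^sub>R v"
        by (simp add: matrix_vector_mult_add_rdistrib matrix_vector_mult_diff_rdistrib
            scaleR_matrix_vector_assoc[symmetric] tensor_vector_mult matrix_vector_mul_assoc[symmetric]
            Hx_def[symmetric] reflection_vector[of z Hx] h_def[symmetric] p_def[symmetric] q_def[symmetric] s_def[symmetric])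
      have RG: "reflection z *v G I = G I - (2 / s * b) *\<^sub>R z"
        by (simp add: reflection_vector s_def b_def)
      have GR: "G I \<bullet> (reflection z *v v) = q - 2 / s * p * b"
        by (simp add: reflection_vector inner_diff_right q_def p_def b_def s_def inner_commute)
      have gv: "?g \<bullet> v = m * (q - 2 / s * p * b) - k * u I / s * p"
        unfolding RG by (simp add: inner_diff_left q_def p_def)
      have l: "?Bw *v v = c\<^sup>2 *\<^sub>R ((- (2 / k) * u I) *\<^sub>R (?h *v v)
         + (2 * (k + 2) / k\<^sup>2 * (?g \<bullet> v)) *\<^sub>R ?g - (2 / k\<^sup>2 * (?g \<bullet> ?g)) *\<^sub>R v)"
      proof -
        have t: "tensor (c *\<^sub>R ?g) (c *\<^sub>R ?g) *v v = (c\<^sup>2 * (?g \<bullet> v)) *\<^sub>R ?g"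
          unfolding tensor_vector_mult inner_scaleR_left scaleR_scaleR by (simp add: power2_eq_square mult_ac)
        have i: "(c *\<^sub>R ?g) \<bullet> (c *\<^sub>R ?g) = c\<^sup>2 * (?g \<bullet> ?g)"
          unfolding inner_scaleR_left inner_scaleR_right by (simp only: power2_eq_square mult.assoc)
        show ?thesis
          unfolding matrix_vector_mult_add_rdistrib[of _ _ v] matrix_vector_mult_diff_rdistrib[of _ "_ *\<^sub>R mat 1"]
            scaleR_matrix_vector_assoc[symmetric] t i mat_vector_mult
          by (simp only: scaleR_add_right scaleR_diff_right scaleR_scaleR scaleR_one power2_eq_square mult_ac)
      qed
      have r: "((c\<^sup>2 * m\<^sup>2) *\<^sub>R (reflection z ** ?Bu ** reflection z)) *v v
        = (c\<^sup>2 * m\<^sup>2) *\<^sub>R ((- (2 / k) * u I) *\<^sub>R (Hx - (2 / s * h) *\<^sub>R z)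
           + (2 * (k + 2) / k\<^sup>2 * (q - 2 / s * p * b)) *\<^sub>R (G I - (2 / s * b) *\<^sub>R z) - (2 / k\<^sup>2 * (G I \<bullet> G I)) *\<^sub>R v)"
      proof -
        have "?Bu *v (reflection z *v v) = (- (2 / k) * u I) *\<^sub>R Hx
           + (2 * (k + 2) / k\<^sup>2 * (q - 2 / s * p * b)) *\<^sub>R G I - (2 / k\<^sup>2 * (G I \<bullet> G I)) *\<^sub>R (reflection z *v v)"
          unfolding matrix_vector_mult_add_rdistrib matrix_vector_mult_diff_rdistrib
            scaleR_matrix_vector_assoc[symmetric] tensor_vector_mult GR mat_vector_mult Hx_def by simp
        moreover have "reflection z *v Hx = Hx - (2 / s * h) *\<^sub>R z"
          by (simp add: reflection_vector s_def h_def)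
        ultimately have "reflection z *v (?Bu *v (reflection z *v v)) = (- (2 / k) * u I) *\<^sub>R (Hx - (2 / s * h) *\<^sub>R z)
           + (2 * (k + 2) / k\<^sup>2 * (q - 2 / s * p * b)) *\<^sub>R (G I - (2 / s * b) *\<^sub>R z) - (2 / k\<^sup>2 * (G I \<bullet> G I)) *\<^sub>R v"
          by (simp only: matrix_vector_right_distrib matrix_vector_mult_diff_distrib matrix_vector_mult_scaleR RG RR)
        then show ?thesis
          by (simp only: scaleR_matrix_vector_assoc[symmetric] matrix_vector_mul_assoc[symmetric])
      qed
      show ?thesis
        unfolding l r hv gv gg unfolding RG
      proof (simp only: vec_eq_iff vector_add_component vector_minus_component vector_scaleR_component
          real_scaleR_def mult.assoc[of "c\<^sup>2"], intro allI arg_cong[where f = "(*) (c\<^sup>2)"], goal_cases)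
        case (1 i)
        show ?case
          by (rule conf_op_kelvin_algebra[OF s0(1) k])
      qed
    qed
    then show ?thesis unfolding matrix_eq by blast
  qed
  let ?e = "- (2 * (k + 2) / k)"
  have scale: "(c * u I) powr ?e * (c\<^sup>2 * m\<^sup>2) = u I powr ?e"
  proof -
    have e: "k / 2 * ?e = - (k + 2)" using k by (simp add: field_simps)
    have c2: "c\<^sup>2 = m powr k" using m0 by (simp add: c_def power2_eq_square powr_add[symmetric])
    have m2: "m\<^sup>2 = m powr 2" using m0 by simp
    have "(c * u I) powr ?e * (c\<^sup>2 * m\<^sup>2) = m powr (k / 2 * ?e) * (m powr k * m powr 2) * u I powr ?e"
      unfolding c2 m2 using m0 uI by (simp add: powr_mult c_def powr_powr)
    also have "m powr (k / 2 * ?e) * (m powr k * m powr 2) = 1"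
      unfolding e powr_add[symmetric] using m0 by simp
    finally show ?thesis by simp
  qed
  have sc: "reflection z ** (a *\<^sub>R X) ** reflection z = a *\<^sub>R (reflection z ** X ** reflection z)" for a and X :: "real^'n^'n"
    using bilinear_lmul[OF bilinear_matrix_matrix_mult] bilinear_rmul[OF bilinear_matrix_matrix_mult] by metis
  have "conf_op (c * u I) (c *\<^sub>R ?g) (c *\<^sub>R ?h) = (c * u I) powr ?e *\<^sub>R ?Bw"
    using conf_op_factor[OF dim, of "c * u I" "c *\<^sub>R ?g" "c *\<^sub>R ?h"] c0 uI
    unfolding k_def[symmetric] n by simp
  also have "\<dots> = u I powr ?e *\<^sub>R (reflection z ** ?Bu ** reflection z)"
    unfolding B unfolding scaleR_scaleR scale ..
  also have "\<dots> = reflection z ** conf_op (u I) (G I) (H I) ** reflection z"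
    unfolding sc[symmetric] conf_op_factor[OF dim uI] k_def[symmetric] unfolding n ..
  finally show ?thesis
    unfolding w grad hess z_def[symmetric] I_def[symmetric] .
qed

locale conformal_equation = elliptic_equation U F dF
  for U :: "(real^'n::finite^'n) set" and F dF +
  assumes U_inv: "\<And>Q. orthogonal_matrix Q \<Longrightarrow> (\<lambda>M. matrix_inv Q ** M ** Q) ` U = U"
    and F_inv: "\<And>M Q. M \<in> U \<Longrightarrow> orthogonal_matrix Q \<Longrightarrow> F (matrix_inv Q ** M ** Q) = F M"
begin

lemma solution_on_kelvin:
  assumes u: "solution_on V u G H" and \<mu>: "0 < \<mu>"
  shows "solution_on {y. y \<noteq> x \<and> inversion x \<mu> y \<in> V} (kelvin x \<mu> u)
     (kelvin_grad x \<mu> u G) (kelvin_hess x \<mu> u G H)"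
  unfolding solution_on_def
proof (intro conjI ballI)
  show "second_order_on {y. y \<noteq> x \<and> inversion x \<mu> y \<in> V} (kelvin x \<mu> u)
     (kelvin_grad x \<mu> u G) (kelvin_hess x \<mu> u G H)"
    by (rule second_order_on_kelvin[OF solution_onD(1)[OF u] \<mu>])
  fix y assume "y \<in> {y. y \<noteq> x \<and> inversion x \<mu> y \<in> V}"
  then have yx: "y \<noteq> x" and I: "inversion x \<mu> y \<in> V" by auto
  note uD = solution_onD(2-4)[OF u I]
  show "0 < kelvin x \<mu> u y" using uD(1) yx \<mu> by (simp add: kelvin_def)
  let ?M = "conf_op (u (inversion x \<mu> y)) (G (inversion x \<mu> y)) (H (inversion x \<mu> y))"
  have z: "y - x \<noteq> 0" using yx by simp
  have eq: "conf_op (kelvin x \<mu> u y) (kelvin_grad x \<mu> u G y) (kelvin_hess x \<mu> u G H y) =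
    matrix_inv (reflection (y - x)) ** ?M ** reflection (y - x)"
    unfolding matrix_inv_reflection[OF z] by (rule conf_op_kelvin[where u = u, OF dim \<mu> yx uD(1)])
  show "conf_op (kelvin x \<mu> u y) (kelvin_grad x \<mu> u G y) (kelvin_hess x \<mu> u G H y) \<in> U"
    unfolding eq using U_inv[OF orthogonal_reflection[OF z]] uD(2) by blast
  show "F (conf_op (kelvin x \<mu> u y) (kelvin_grad x \<mu> u G y) (kelvin_hess x \<mu> u G H y)) = 1"
    unfolding eq using F_inv[OF uD(2) orthogonal_reflection[OF z]] uD(3) by simp
qed

end

section \<open>Moving spheres\<close>

text \<open>Continuous induction on an interval of radii; it runs the method of moving spheres.\<close>

lemma continuous_induction:
  fixes \<Lambda> :: real
  assumes start: "0 < l0" "\<And>l. 0 < l \<Longrightarrow> l < l0 \<Longrightarrow> P l"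
    and limit: "\<And>l. 0 < l \<Longrightarrow> l < \<Lambda> \<Longrightarrow> (\<And>\<mu>. 0 < \<mu> \<Longrightarrow> \<mu> < l \<Longrightarrow> P \<mu>) \<Longrightarrow> P l"
    and extend: "\<And>l. 0 < l \<Longrightarrow> l < \<Lambda> \<Longrightarrow> P l \<Longrightarrow> \<exists>\<eta>>0. \<forall>\<mu>. l < \<mu> \<longrightarrow> \<mu> < l + \<eta> \<longrightarrow> P \<mu>"
    and l: "0 < l" "l < \<Lambda>"
  shows "P l"
proof (rule ccontr)
  assume bad: "\<not> P l"
  define B where "B = {l. 0 < l \<and> l < \<Lambda> \<and> \<not> P l}"
  have lB: "l \<in> B" using bad l by (simp add: B_def)
  have low: "l0 \<le> b" if "b \<in> B" for b using that start(2)[of b] by (force simp: B_def)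
  have bdd: "bdd_below B" using low by (auto simp: bdd_below_def)
  define s where "s = Inf B"
  have "l0 \<le> s" unfolding s_def using lB low by (intro cInf_greatest) auto
  moreover have "s \<le> l" unfolding s_def by (rule cInf_lower[OF lB bdd])
  ultimately have s: "0 < s" "s < \<Lambda>" using start(1) l by linarith+
  have below: "P \<mu>" if "0 < \<mu>" "\<mu> < s" for \<mu>
    using that s cInf_lower[OF _ bdd, of \<mu>] by (force simp: B_def s_def)
  obtain \<eta> where \<eta>: "0 < \<eta>" "\<And>\<mu>. s < \<mu> \<Longrightarrow> \<mu> < s + \<eta> \<Longrightarrow> P \<mu>"
    using extend[OF s limit[OF s below]] by blast
  obtain b where b: "b \<in> B" "b < s + \<eta>"
    using cInf_lessD[of B "s + \<eta>"] lB \<eta>(1) by (auto simp: s_def)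
  moreover have "s \<le> b" unfolding s_def by (rule cInf_lower[OF b(1) bdd])
  ultimately show False
    using \<eta>(2)[of b] limit[OF s below] by (cases "s = b") (auto simp: B_def)
qed

lemma tendsto_inversion:
  assumes "(\<mu> \<longlongrightarrow> l) net" "(y \<longlongrightarrow> y0) net" "y0 \<noteq> x"
  shows "((\<lambda>n. inversion x (\<mu> n) (y n)) \<longlongrightarrow> inversion x l y0) net"
  unfolding inversion_def using assms by (intro tendsto_intros) auto

lemma tendsto_kelvin:
  fixes x :: "real^'n"
  assumes "(\<mu> \<longlongrightarrow> l) net" "(y \<longlongrightarrow> y0) net" "y0 \<noteq> x" "0 < l" "isCont u (inversion x l y0)"
  shows "((\<lambda>n. kelvin x (\<mu> n) u (y n)) \<longlongrightarrow> kelvin x l u y0) net"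
proof -
  have "((\<lambda>n. u (inversion x (\<mu> n) (y n))) \<longlongrightarrow> u (inversion x l y0)) net"
    by (rule isCont_tendsto_compose[OF assms(5) tendsto_inversion[OF assms(1-3)]])
  moreover have "((\<lambda>n. (\<mu> n)\<^sup>2 / ((y n - x) \<bullet> (y n - x))) \<longlongrightarrow> l\<^sup>2 / ((y0 - x) \<bullet> (y0 - x))) net"
    using assms by (intro tendsto_intros) auto
  ultimately show ?thesis
    unfolding kelvin_def using assms(3,4) by (intro tendsto_mult tendsto_powr tendsto_const) auto
qed

text \<open>The sphere about \<open>x\<close> is moved up to radius \<open>\<Lambda>\<close> without ever enclosing the origin. The bound \<open>S\<close> for \<open>u\<close> inside the
sphere and the lower bound \<open>c\<^sub>0\<close> are related by the last assumption, which keeps the Kelvin transforms below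
\<open>c\<^sub>0\<close> away from the origin, so that contact with \<open>u\<close> can only happen at points of norm less than 1/2.\<close>

locale moving_spheres = conformal_equation U F dF
  for U :: "(real^'n::finite^'n) set" and F dF +
  fixes u :: "real^'n \<Rightarrow> real" and G H and x :: "real^'n" and \<Lambda> S c\<^sub>0 :: real
  assumes solution: "solution_on (ball 0 2 - {0}) u G H"
    and superharmonic: "\<And>y. y \<in> ball 0 2 - {0} \<Longrightarrow> (\<Sum>i\<in>UNIV. H y $ i $ i) \<le> 0"
    and \<Lambda>_pos: "0 < \<Lambda>" and center: "\<Lambda> \<le> norm x" "norm x + \<Lambda> \<le> 1 / 4"
    and u_upper: "\<And>y. y \<in> ball x \<Lambda> \<Longrightarrow> u y \<le> S"
    and u_lower: "\<And>y. y \<in> ball 0 1 - {0} \<Longrightarrow> c\<^sub>0 \<le> u y"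
    and small: "(4 * \<Lambda>) powr (real CARD('n) - 2) * S < c\<^sub>0"
begin

abbreviation "D \<equiv> ball 0 2 - {0 :: real^'n}"

definition "k = real CARD('n) - 2"

text \<open>Along the ray from \<open>x\<close> through \<open>y\<close> the comparison of \<open>u\<close> with its Kelvin transforms is a statement about the one
function \<open>ray y\<close>: the transform with radius \<open>l\<close> has at \<open>y\<close> the value \<open>ray y (l\<^sup>2 / |y - x|\<^sup>2)\<close>, while \<open>u y = ray y 1\<close>.
The sign of the derivative of \<open>ray y\<close> is that of \<open>rate\<close>.\<close>

definition "rate y = k / 2 * u y + G y \<bullet> (y - x)"

definition "ray y t = t powr (k / 2) * u (x + t *\<^sub>R (y - x))"

lemma k_pos: "0 < k" using dim by (simp add: k_def)

lemma kelvin_eq_ray: "kelvin x l u y = ray y (l\<^sup>2 / ((y - x) \<bullet> (y - x)))"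
  by (simp add: kelvin_def inversion_def ray_def k_def)

lemma ray_one: "ray y 1 = u y" by (simp add: ray_def)

lemma ball_subset_D: "ball x \<Lambda> \<subseteq> D"
  using ball_subset_punctured_ball[OF \<Lambda>_pos center(1), of 2] center(2) by simp

lemma u_pos: "y \<in> D \<Longrightarrow> 0 < u y" using solution_onD(2)[OF solution] .

lemma u_cont: "y \<in> D \<Longrightarrow> isCont u y"
  using second_order_onD(2)[OF solution_onD(1)[OF solution]] has_derivative_continuous by blast

lemma rate_cont: "y \<in> D \<Longrightarrow> isCont rate y"
proof -
  assume y: "y \<in> D"
  have "isCont G y" using second_order_onD(3)[OF solution_onD(1)[OF solution] y] has_derivative_continuous by blast
  then show ?thesis unfolding rate_def using u_cont[OF y] by (intro continuous_intros) auto
qed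

lemma x_in_D: "x \<in> D" using ball_subset_D \<Lambda>_pos by (meson centre_in_ball subsetD)

lemma S_pos: "0 < S" using u_pos[OF x_in_D] u_upper[of x] \<Lambda>_pos by simp

lemma ray_deriv:
  assumes "0 < t" "x + t *\<^sub>R (y - x) \<in> D"
  shows "(ray y has_real_derivative t powr (k / 2 - 1) * rate (x + t *\<^sub>R (y - x))) (at t)"
proof -
  let ?z = "x + t *\<^sub>R (y - x)"
  have "((\<lambda>t. u (x + t *\<^sub>R (y - x))) has_derivative (\<lambda>h. G ?z \<bullet> (h *\<^sub>R (y - x)))) (at t)"
    by (rule has_derivative_compose[where f = "\<lambda>t. x + t *\<^sub>R (y - x)" and g = u])
      (use second_order_onD(2)[OF solution_onD(1)[OF solution] assms(2)] in \<open>auto intro!: derivative_eq_intros\<close>)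
  then have d: "((\<lambda>t. u (x + t *\<^sub>R (y - x))) has_real_derivative G ?z \<bullet> (y - x)) (at t)"
    by (simp add: has_field_derivative_def mult_commute_abs)
  have e: "t powr (k / 2) = t * t powr (k / 2 - 1)"
    using powr_mult_base[of t "k / 2 - 1"] assms(1) by simp
  have "(ray y has_real_derivative k / 2 * t powr (k / 2 - 1) * u ?z + G ?z \<bullet> (y - x) * t powr (k / 2)) (at t)"
    unfolding ray_def[abs_def]
    by (rule DERIV_cong[OF DERIV_mult[OF has_real_derivative_powr[OF assms(1)] d]]) simp
  then show ?thesis
    by (rule DERIV_cong) (simp add: rate_def e algebra_simps)
qed

lemma kelvin_le_of_rate_nonneg:
  assumes l: "0 < l" "l < norm (y - x)"
    and rate: "\<And>t. l\<^sup>2 / ((y - x) \<bullet> (y - x)) \<le> t \<Longrightarrow> t \<le> 1 \<Longrightarrow> x + t *\<^sub>R (y - x) \<in> D \<and> 0 \<le> rate (x + t *\<^sub>R (y - x))"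
  shows "kelvin x l u y \<le> u y"
proof -
  let ?\<tau> = "l\<^sup>2 / ((y - x) \<bullet> (y - x))"
  have s: "0 < norm (y - x)" using l by linarith
  have \<tau>: "0 < ?\<tau>" using l s by (intro divide_pos_pos) auto
  have "l\<^sup>2 \<le> (norm (y - x))\<^sup>2" using l by (intro power_mono) auto
  then have \<tau>1: "?\<tau> \<le> 1" using s by (simp add: power2_norm_eq_inner)
  have "ray y ?\<tau> \<le> ray y 1"
  proof (rule DERIV_nonneg_imp_nondecreasing[OF \<tau>1])
    fix t assume t: "?\<tau> \<le> t" "t \<le> 1"
    then have "0 < t" using \<tau> by linarith
    from ray_deriv[OF this] rate[OF t]
    show "\<exists>d. (ray y has_real_derivative d) (at t) \<and> 0 \<le> d" by (meson mult_nonneg_nonneg powr_ge_zero)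
  qed
  then show ?thesis by (simp add: kelvin_eq_ray ray_one)
qed

lemma inversion_in_ball:
  assumes "0 < l" "l < \<Lambda>" "l \<le> norm (y - x)"
  shows "inversion x l y \<in> ball x \<Lambda>"
proof -
  have s: "0 < norm (y - x)" using assms by linarith
  have "dist x (inversion x l y) = l\<^sup>2 / (norm (y - x))\<^sup>2 * norm (y - x)"
    by (simp add: inversion_def dist_norm power2_norm_eq_inner)
  also have "\<dots> = l * l / norm (y - x)" using s by (simp add: power2_eq_square)
  also have "\<dots> \<le> l" using assms s by (simp add: divide_le_eq)
  finally show ?thesis using assms by simp
qed

lemma kelvin_far:
  assumes l: "0 < l" "l < \<Lambda>" "l \<le> \<rho>" "\<rho> \<le> norm (y - x)"
  shows "kelvin x l u y \<le> (l / \<rho>) powr k * S"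
proof -
  have s: "0 < norm (y - x)" "0 < \<rho>" using l by linarith+
  have "l\<^sup>2 / ((y - x) \<bullet> (y - x)) = (l / norm (y - x))\<^sup>2" by (simp add: power2_norm_eq_inner[symmetric] power_divide)
  also have "\<dots> \<le> (l / \<rho>)\<^sup>2" using l s by (intro power_mono divide_left_mono) auto
  finally have "(l\<^sup>2 / ((y - x) \<bullet> (y - x))) powr (k / 2) \<le> ((l / \<rho>)\<^sup>2) powr (k / 2)"
    using k_pos by (intro powr_mono2) auto
  also have "\<dots> = ((l / \<rho>) powr 2) powr (k / 2)" using l s by simp
  also have "\<dots> = (l / \<rho>) powr k" unfolding powr_powr by simp
  finally have "(l\<^sup>2 / ((y - x) \<bullet> (y - x))) powr (k / 2) \<le> (l / \<rho>) powr k" .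
  moreover have I: "inversion x l y \<in> ball x \<Lambda>" by (rule inversion_in_ball) (use l in auto)
  ultimately show ?thesis
    unfolding kelvin_def k_def[symmetric]
    using u_upper[OF I] less_imp_le[OF u_pos[OF subsetD[OF ball_subset_D I]]] by (intro mult_mono) auto
qed

lemma kelvin_outside:
  assumes l: "0 < l" "l < \<Lambda>" and y: "1 / 2 \<le> norm y"
  shows "kelvin x l u y < c\<^sub>0"
proof -
  have "norm y \<le> norm (y - x) + norm x" using norm_triangle_ineq[of "y - x" x] by simp
  then have "1 / 4 \<le> norm (y - x)" using y center \<Lambda>_pos by linarith
  then have "kelvin x l u y \<le> (l / (1 / 4)) powr k * S"
    using l center norm_ge_zero[of x] by (intro kelvin_far) linarith+
  also have "\<dots> \<le> (4 * \<Lambda>) powr k * S"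
    using l S_pos k_pos by (intro mult_right_mono powr_mono2) auto
  also have "\<dots> < c\<^sub>0" using small by (simp add: k_def)
  finally show ?thesis .
qed

definition "sphere_below l \<longleftrightarrow>
  (\<forall>y. norm y < 1 \<longrightarrow> y \<noteq> 0 \<longrightarrow> l < norm (y - x) \<longrightarrow> kelvin x l u y \<le> u y)"

text \<open>Near \<open>x\<close> the rate is positive because \<open>u x > 0\<close>; at distance at least \<open>r0\<close> the transform is at most
\<open>(l / r0) powr k * S\<close>, which is below \<open>c\<^sub>0\<close> for small \<open>l\<close>.\<close>

lemma sphere_below_start: "\<exists>l0>0. \<forall>l. 0 < l \<longrightarrow> l < l0 \<longrightarrow> sphere_below l"
proof -
  have "rate x = k / 2 * u x" by (simp add: rate_def)
  then have "0 < rate x" using mult_pos_pos[OF k_pos u_pos[OF x_in_D]] by simp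
  then have "\<forall>\<^sub>F y in nhds x. 0 < rate y"
    using rate_cont[OF x_in_D] by (intro order_tendstoD) (auto simp: isCont_def tendsto_at_iff_tendsto_nhds)
  then obtain r where r: "0 < r" "\<And>y. dist y x < r \<Longrightarrow> 0 < rate y"
    unfolding eventually_nhds_metric by blast
  define r0 where "r0 = min r \<Lambda>"
  have r0: "0 < r0" "r0 \<le> r" "r0 \<le> \<Lambda>" using r \<Lambda>_pos by (auto simp: r0_def)
  have c0: "0 < c\<^sub>0" using small S_pos \<Lambda>_pos by (smt (verit) mult_nonneg_nonneg powr_ge_zero)
  define l0 where "l0 = min r0 (r0 * (c\<^sub>0 / S) powr (1 / k))"
  have "sphere_below l" if l: "0 < l" "l < l0" for l
    unfolding sphere_below_def
  proof (intro allI impI)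
    fix y :: "real^'n" assume y: "norm y < 1" "y \<noteq> 0" "l < norm (y - x)"
    show "kelvin x l u y \<le> u y"
    proof (cases "norm (y - x) < r0")
      case True
      show ?thesis
      proof (rule kelvin_le_of_rate_nonneg[OF l(1) y(3)])
        fix t assume t: "l\<^sup>2 / ((y - x) \<bullet> (y - x)) \<le> t" "t \<le> 1"
        have "0 \<le> l\<^sup>2 / ((y - x) \<bullet> (y - x))" by simp
        then have "0 \<le> t" using t by linarith
        then have "norm (t *\<^sub>R (y - x)) \<le> norm (y - x)" using t by (simp add: mult_left_le_one_le)
        then have "dist (x + t *\<^sub>R (y - x)) x < r0" using True by (simp add: dist_norm)
        moreover from this have "x + t *\<^sub>R (y - x) \<in> ball x \<Lambda>" using r0 by (simp add: dist_commute)
        ultimately show "x + t *\<^sub>R (y - x) \<in> D \<and> 0 \<le> rate (x + t *\<^sub>R (y - x))"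
          using r(2)[of "x + t *\<^sub>R (y - x)"] r0 subsetD[OF ball_subset_D] by (meson less_imp_le less_le_trans)
      qed
    next
      case False
      have lr: "l < r0" "l < r0 * (c\<^sub>0 / S) powr (1 / k)" using l by (auto simp: l0_def)
      have "kelvin x l u y \<le> (l / r0) powr k * S"
        using lr r0 l False by (intro kelvin_far) auto
      also have "(l / r0) powr k \<le> ((c\<^sub>0 / S) powr (1 / k)) powr k"
        using lr r0 l k_pos by (intro powr_mono2) (auto simp: divide_le_eq mult.commute)
      also have "\<dots> = c\<^sub>0 / S" unfolding powr_powr using k_pos c0 S_pos by simp
      finally have "kelvin x l u y \<le> c\<^sub>0" using S_pos by (simp add: mult_right_mono)
      also have "c\<^sub>0 \<le> u y" using u_lower y by simp
      finally show ?thesis .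
    qed
  qed
  moreover have "0 < l0" using r0 c0 S_pos by (simp add: l0_def)
  ultimately show ?thesis by blast
qed

lemma sphere_below_limit:
  assumes l: "0 < l" "l < \<Lambda>" and P: "\<And>\<mu>. 0 < \<mu> \<Longrightarrow> \<mu> < l \<Longrightarrow> sphere_below \<mu>"
  shows "sphere_below l"
  unfolding sphere_below_def
proof (intro allI impI)
  fix y :: "real^'n" assume y: "norm y < 1" "y \<noteq> 0" "l < norm (y - x)"
  have yx: "y \<noteq> x" using y l by auto
  have I: "inversion x l y \<in> D" using inversion_in_ball[OF l] y ball_subset_D by (meson less_imp_le subsetD)
  have "((\<lambda>\<mu>. kelvin x \<mu> u y) \<longlongrightarrow> kelvin x l u y) (at_left l)"
    by (rule tendsto_kelvin[OF _ tendsto_const yx l(1) u_cont[OF I]]) simp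
  moreover have "\<forall>\<^sub>F \<mu> in at_left l. kelvin x \<mu> u y \<le> u y"
    using eventually_at_left_real[OF l(1)]
    by eventually_elim (use P y in \<open>force simp: sphere_below_def\<close>)
  ultimately show "kelvin x l u y \<le> u y" by (rule tendsto_upperbound) simp
qed

text \<open>Complements of open balls in the unit ball are connected; the complement of the closed ball is the union of those of
slightly larger open balls, which have a point in common.\<close>

lemma connected_outside:
  assumes l: "0 < l" "l < \<Lambda>"
  shows "connected (ball 0 1 - cball x l - {0 :: real^'n})"
proof -
  have two: "2 \<le> DIM(real^'n)" using dim by simp
  obtain b :: "real^'n" where b: "norm b = 3 / 4" using vector_choose_size[of "3 / 4"] by auto
  have bx: "1 / 2 \<le> dist x b" using norm_triangle_ineq2[of b x] b center \<Lambda>_pos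
    by (simp add: dist_norm norm_minus_commute)
  let ?A = "\<lambda>\<mu>. ball 0 1 - ball x \<mu> :: (real^'n) set"
  have "connected (\<Union> (?A ` {l<..<1/2}))"
  proof (rule connected_Union)
    fix A assume "A \<in> ?A ` {l<..<1/2}"
    then obtain \<mu> where \<mu>: "A = ?A \<mu>" "l < \<mu>" "\<mu> < 1 / 2" by auto
    have "cball x \<mu> \<subseteq> ball 0 1"
    proof
      fix z assume "z \<in> cball x \<mu>"
      then have "norm (x - z) \<le> \<mu>" by (simp add: dist_norm)
      moreover have "norm z \<le> norm x + norm (x - z)" using norm_triangle_ineq4[of x "x - z"] by simp
      ultimately show "z \<in> ball 0 1" using \<mu> center \<Lambda>_pos by simp
    qed
    then show "connected A" unfolding \<mu>(1) by (intro connected_diff_ball two) auto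
  next
    have "b \<in> \<Inter> (?A ` {l<..<1/2})" using b bx by auto
    then show "\<Inter> (?A ` {l<..<1/2}) \<noteq> {}" by blast
  qed
  moreover have "\<Union> (?A ` {l<..<1/2}) = ball 0 1 - cball x l"
  proof (intro equalityI subsetI)
    fix z assume "z \<in> ball 0 1 - cball x l"
    moreover have l2: "l < 1 / 2" using l center norm_ge_zero[of x] by linarith
    ultimately obtain \<mu> where "l < \<mu>" "\<mu> < min (dist x z) (1 / 2)"
      using dense[of l "min (dist x z) (1 / 2)"] by auto
    then show "z \<in> \<Union> (?A ` {l<..<1/2})" using \<open>z \<in> _\<close> by (auto intro!: bexI[of _ \<mu>])
  qed auto
  ultimately have "connected (ball 0 1 - cball x l)" by simp
  then show ?thesis by (intro connected_open_delete two) auto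
qed

lemma outside_subset:
  assumes l: "0 < l" "l < \<Lambda>"
  shows "ball 0 1 - ball x l - {0} \<subseteq> {y. y \<noteq> x \<and> inversion x l y \<in> D} \<inter> D"
proof
  fix y assume y: "y \<in> ball 0 1 - ball x l - {0}"
  then have "l \<le> norm (y - x)" by (simp add: dist_norm norm_minus_commute)
  then have "inversion x l y \<in> D" using subsetD[OF ball_subset_D inversion_in_ball[OF l]] by blast
  then show "y \<in> {y. y \<noteq> x \<and> inversion x l y \<in> D} \<inter> D" using y l by auto
qed

lemma kelvin_solution:
  "0 < l \<Longrightarrow> solution_on {y. y \<noteq> x \<and> inversion x l y \<in> D} (kelvin x l u) (kelvin_grad x l u G) (kelvin_hess x l u G H)"
  by (rule solution_on_kelvin[OF solution])

text \<open>By the strong maximum principle the contact set is open and closed in a connected set, and it misses the points of norm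
3/4.\<close>

lemma sphere_strictly_below:
  assumes l: "0 < l" "l < \<Lambda>" and P: "sphere_below l" and y: "y \<in> ball 0 1 - cball x l - {0}"
  shows "kelvin x l u y < u y"
proof (rule ccontr)
  assume neg: "\<not> kelvin x l u y < u y"
  let ?\<Sigma> = "ball 0 1 - cball x l - {0 :: real^'n}"
  have op: "open ?\<Sigma>" by auto
  have sub: "?\<Sigma> \<subseteq> {y. y \<noteq> x \<and> inversion x l y \<in> D}" "?\<Sigma> \<subseteq> D"
    using outside_subset[OF l] by (auto simp: subset_iff)
  note us = solution_on_subset[OF solution op sub(2)] and ws = solution_on_subset[OF kelvin_solution[OF l(1)] op sub(1)]
  have le: "kelvin x l u z \<le> u z" if "z \<in> ?\<Sigma>" for z
    using P that by (auto simp: sphere_below_def dist_norm norm_minus_commute)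
  define Z where "Z = {z \<in> ?\<Sigma>. u z - kelvin x l u z = 0}"
  have yZ: "y \<in> Z" using neg le[OF y] y by (simp add: Z_def)
  have "openin (top_of_set ?\<Sigma>) Z"
  proof -
    have "open Z"
      unfolding open_contains_ball
    proof
      fix p assume p: "p \<in> Z"
      then have p': "p \<in> ?\<Sigma>" "u p = kelvin x l u p" by (auto simp: Z_def)
      obtain r where "0 < r" "ball p r \<subseteq> ?\<Sigma>" "\<And>z. z \<in> ball p r \<Longrightarrow> u z = kelvin x l u z"
        using strong_maximum_principle[OF us ws le p'] by blast
      then show "\<exists>e>0. ball p e \<subseteq> Z" by (intro exI[of _ r]) (auto simp: Z_def)
    qed
    moreover have "Z \<subseteq> ?\<Sigma>" by (auto simp: Z_def)
    ultimately show ?thesis using op by (simp add: openin_open_eq)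
  qed
  moreover have "closedin (top_of_set ?\<Sigma>) Z"
    unfolding Z_def
    using second_order_on_continuous(1)[OF solution_onD(1)[OF us]] second_order_on_continuous(1)[OF solution_onD(1)[OF ws]]
    by (intro continuous_closedin_preimage_constant continuous_on_diff)
  ultimately have Z: "Z = ?\<Sigma>"
    using connected_outside[OF l] yZ unfolding connected_clopen by blast
  obtain b :: "real^'n" where b: "norm b = 3 / 4" using vector_choose_size[of "3 / 4"] by auto
  have bx: "1 / 2 \<le> dist x b" using norm_triangle_ineq2[of b x] b center \<Lambda>_pos
    by (simp add: dist_norm norm_minus_commute)
  then have "b \<in> ?\<Sigma>" using b l center norm_ge_zero[of x] by auto
  then have "b \<in> Z" by (simp only: Z)
  then have "u b = kelvin x l u b" by (simp add: Z_def)
  moreover have "kelvin x l u b < c\<^sub>0" using kelvin_outside[OF l, of b] b by simp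
  moreover have "b \<noteq> 0" using b by auto
  then have "c\<^sub>0 \<le> u b" using u_lower[of b] b by simp
  ultimately show False by simp
qed

text \<open>On the sphere \<open>u\<close> agrees with its Kelvin transform, and the radial derivative of their difference is
\<open>2 / l * rate p\<close>. The exterior normal half-space at \<open>p\<close> touches the ball only in \<open>p\<close>, so the boundary point
lemma applies with \<open>\<kappa> = 0\<close>.\<close>

lemma rate_pos_on_sphere:
  assumes l: "0 < l" "l < \<Lambda>" and P: "sphere_below l" and p: "norm (p - x) = l"
  shows "0 < rate p"
proof -
  let ?V = "ball 0 1 \<inter> D \<inter> {y. y \<noteq> x \<and> inversion x l y \<in> D}"
  have op: "open ?V"
    using second_order_onD(1)[OF solution_onD(1)[OF kelvin_solution[OF l(1)]]] by auto
  have us: "solution_on ?V u G H" by (rule solution_on_subset[OF solution op]) auto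
  have ws: "solution_on ?V (kelvin x l u) (kelvin_grad x l u G) (kelvin_hess x l u G H)"
    by (rule solution_on_subset[OF kelvin_solution[OF l(1)] op]) auto
  have s: "(p - x) \<bullet> (p - x) = l\<^sup>2" using p by (simp add: power2_norm_eq_inner[symmetric])
  have I: "inversion x l p = p" using s l by (simp add: inversion_def)
  have pb: "p \<in> ball x \<Lambda>" using p l by (simp add: dist_norm norm_minus_commute)
  have "norm p < 1"
    using norm_triangle_ineq[of "p - x" x] p l center by simp
  moreover have pD: "p \<in> D" by (rule subsetD[OF ball_subset_D pb])
  ultimately have pV: "p \<in> ?V" using I p l by auto
  have eq: "u p = kelvin x l u p" using l by (simp add: kelvin_def I s)
  define e where "e = (1 / l) *\<^sub>R (p - x)"
  have e: "norm e = 1" using p l by (simp add: e_def)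
  have "0 < (G p - kelvin_grad x l u G p) \<bullet> e"
  proof (rule hopf[OF us ws pV eq e, of 0])
    fix y assume y: "y \<in> ?V - {p}" "0 \<le> barrier_shape p e 0 y"
    then have "0 \<le> (p - x) \<bullet> (y - p)" using l by (simp add: barrier_shape_def e_def zero_le_divide_iff)
    then have "(p - x) \<bullet> (p - x) < (y - x) \<bullet> (y - x)"
    proof -
      have "y - x = (y - p) + (p - x)" by simp
      then have "(y - x) \<bullet> (y - x) = (y - p) \<bullet> (y - p) + 2 * ((p - x) \<bullet> (y - p)) + (p - x) \<bullet> (p - x)"
        by (metis (no_types, lifting) inner_add_left inner_add_right inner_commute add.assoc mult_2)
      moreover have "0 < (y - p) \<bullet> (y - p)" using y by simp
      ultimately show ?thesis using \<open>0 \<le> (p - x) \<bullet> (y - p)\<close> by linarith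
    qed
    then have "l\<^sup>2 < (norm (y - x))\<^sup>2" unfolding s by (simp add: power2_norm_eq_inner)
    then have "l < norm (y - x)" by (rule power_less_imp_less_base) simp
    then show "kelvin x l u y < u y"
      using y by (intro sphere_strictly_below[OF l P]) (auto simp: dist_norm norm_minus_commute)
  qed
  moreover have "kelvin_grad x l u G p = reflection (p - x) *v G p - (k * u p / l\<^sup>2) *\<^sub>R (p - x)"
    using l by (simp add: kelvin_grad_def Let_def I s k_def)
  then have "(G p - kelvin_grad x l u G p) \<bullet> e = 2 / l * rate p"
  proof -
    have "kelvin_grad x l u G p = G p - (2 / l\<^sup>2 * ((p - x) \<bullet> G p)) *\<^sub>R (p - x) - (k * u p / l\<^sup>2) *\<^sub>R (p - x)"
      using \<open>kelvin_grad x l u G p = _\<close> by (simp add: reflection_vector s)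
    then have "G p - kelvin_grad x l u G p = (2 / l\<^sup>2 * ((p - x) \<bullet> G p) + k * u p / l\<^sup>2) *\<^sub>R (p - x)"
      by (simp add: scaleR_add_left)
    then have "(G p - kelvin_grad x l u G p) \<bullet> e = (2 / l\<^sup>2 * ((p - x) \<bullet> G p) + k * u p / l\<^sup>2) * (((p - x) \<bullet> (p - x)) / l)"
      by (simp only: e_def inner_scaleR_left inner_scaleR_right) simp
    moreover have "(2 / l\<^sup>2 * a + k * v / l\<^sup>2) * (l\<^sup>2 / l) = 2 / l * (k / 2 * v + a)" for a v
      using l by (simp add: field_simps power2_eq_square)
    ultimately show ?thesis unfolding s rate_def by (simp only: inner_commute)
  qed
  ultimately show ?thesis using l by (simp add: zero_less_divide_iff zero_less_mult_iff)
qed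

text \<open>If radii slightly larger than \<open>l\<close> fail, the points where they fail accumulate at some \<open>q\<close>. It cannot be the origin
because of the gap there, nor a point strictly outside the sphere because the inequality is strict, nor a point of the
sphere because the rate is positive near it.\<close>

lemma sphere_below_extend:
  assumes l: "0 < l" "l < \<Lambda>" and P: "sphere_below l"
  shows "\<exists>\<eta>>0. \<forall>\<mu>. l < \<mu> \<longrightarrow> \<mu> < l + \<eta> \<longrightarrow> sphere_below \<mu>"
proof (rule ccontr)
  assume "\<not> ?thesis"
  then have "\<exists>\<mu> y. l < \<mu> \<and> \<mu> < l + \<eta> \<and> norm y < 1 \<and> y \<noteq> 0 \<and> \<mu> < norm (y - x) \<and> u y < kelvin x \<mu> u y"
    if "0 < \<eta>" for \<eta>
    using that unfolding sphere_below_def by (meson not_le)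
  then have "\<forall>n. \<exists>\<mu> y. l < \<mu> \<and> \<mu> < l + (\<Lambda> - l) * inverse (real (Suc n)) \<and> norm y < 1 \<and> y \<noteq> 0 \<and> \<mu> < norm (y - x)
      \<and> u y < kelvin x \<mu> u y"
    using l by simp
  then obtain \<mu> y where bad: "\<And>n. l < \<mu> n" "\<And>n. \<mu> n < l + (\<Lambda> - l) * inverse (real (Suc n))"
    "\<And>n. norm (y n) < 1" "\<And>n. y n \<noteq> 0" "\<And>n. \<mu> n < norm (y n - x)" "\<And>n. u (y n) < kelvin x (\<mu> n) u (y n)"
    by metis
  have \<mu>\<Lambda>: "\<mu> n < \<Lambda>" for n
  proof -
    have "(\<Lambda> - l) * inverse (real (Suc n)) \<le> (\<Lambda> - l) * 1"
      using l by (intro mult_left_mono) (auto simp: inverse_le_1_iff)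
    then show ?thesis using bad(2)[of n] by simp
  qed
  have y_half: "norm (y n) < 1 / 2" for n
  proof (rule ccontr)
    assume "\<not> ?thesis"
    then have "kelvin x (\<mu> n) u (y n) < c\<^sub>0"
      using kelvin_outside[of "\<mu> n" "y n"] \<mu>\<Lambda>[of n] bad(1)[of n] l by simp
    also have "\<dots> \<le> u (y n)" using u_lower[of "y n"] bad(3,4)[of n] by simp
    finally show False using bad(6)[of n] by simp
  qed
  have "(\<lambda>n. l + (\<Lambda> - l) * inverse (real (Suc n))) \<longlonglongrightarrow> l + (\<Lambda> - l) * 0"
    by (intro tendsto_intros LIMSEQ_inverse_real_of_nat)
  then have \<mu>lim: "\<mu> \<longlonglongrightarrow> l"
    by (intro tendsto_sandwich[OF _ _ tendsto_const, of l \<mu>]) (use bad(1,2) in \<open>auto intro!: always_eventually less_imp_le\<close>)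
  obtain q r where q: "q \<in> cball 0 (1 / 2)" "strict_mono r" "(y \<circ> r) \<longlonglongrightarrow> q"
    using compact_cball[of "0 :: real^'n" "1 / 2"] y_half unfolding compact_def
    by (metis less_imp_le mem_cball_0)
  define \<mu>' where "\<mu>' = \<mu> \<circ> r"
  define y' where "y' = y \<circ> r"
  have lim: "\<mu>' \<longlonglongrightarrow> l" "y' \<longlonglongrightarrow> q"
    using LIMSEQ_subseq_LIMSEQ[OF \<mu>lim q(2)] q(3) by (auto simp: \<mu>'_def y'_def)
  have bad': "l < \<mu>' n" "\<mu>' n < norm (y' n - x)" "u (y' n) < kelvin x (\<mu>' n) u (y' n)" "y' n \<noteq> 0" "norm (y' n) < 1" for n
    using bad by (auto simp: \<mu>'_def y'_def)
  have ql: "l \<le> norm (q - x)"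
  proof (rule tendsto_lowerbound)
    show "(\<lambda>n. norm (y' n - x)) \<longlonglongrightarrow> norm (q - x)" by (intro tendsto_intros lim)
    show "\<forall>\<^sub>F n in sequentially. l \<le> norm (y' n - x)"
      using bad' by (intro always_eventually) (meson less_imp_le less_trans)
  qed simp
  then have qx: "q \<noteq> x" using l by auto
  have Iq: "inversion x l q \<in> D" using inversion_in_ball[OF l ql] ball_subset_D by blast
  have klim: "(\<lambda>n. kelvin x (\<mu>' n) u (y' n)) \<longlonglongrightarrow> kelvin x l u q"
    by (rule tendsto_kelvin[OF lim qx l(1) u_cont[OF Iq]])
  consider "q = 0" | "q \<noteq> 0" "l < norm (q - x)" | "norm (q - x) = l" using ql by linarith
  then show False
  proof cases
    case 1
    have xl: "l < norm x" using l center by linarith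
    define r0 where "r0 = min 1 (norm x - l)"
    have r0: "0 < r0" using xl by (simp add: r0_def)
    have sub0: "ball 0 r0 - {0} \<subseteq> ball 0 1 - cball x l - {0 :: real^'n}"
    proof
      fix z :: "real^'n" assume z: "z \<in> ball 0 r0 - {0}"
      have "norm x \<le> norm (x - z) + norm z" using norm_triangle_ineq[of "x - z" z] by simp
      then show "z \<in> ball 0 1 - cball x l - {0}" using z by (auto simp: r0_def dist_norm)
    qed
    have sub: "ball 0 r0 \<subseteq> {y. y \<noteq> x \<and> inversion x l y \<in> D}"
    proof
      fix z :: "real^'n" assume "z \<in> ball 0 r0"
      then show "z \<in> {y. y \<noteq> x \<and> inversion x l y \<in> D}"
        using Iq qx 1 sub0 outside_subset[OF l] l(1) by (cases "z = 0") (auto simp: subset_iff)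
    qed
    obtain c r where c: "0 < c" "0 < r" "\<And>y. y \<in> ball 0 r - {0} \<Longrightarrow> kelvin x l u y + c \<le> u y"
    proof (rule gap_at_singularity)
      show "solution_on (ball 0 r0) (kelvin x l u) (kelvin_grad x l u G) (kelvin_hess x l u G H)"
        by (rule solution_on_subset[OF kelvin_solution[OF l(1)] _ sub]) simp
      show "solution_on (ball 0 r0 - {0}) u G H"
        by (rule solution_on_subset[OF solution]) (auto simp: r0_def)
      show "(\<Sum>i\<in>UNIV. H z $ i $ i) \<le> 0" if "z \<in> ball 0 r0 - {0}" for z
        using superharmonic that by (auto simp: r0_def)
      show "kelvin x l u z < u z" if "z \<in> ball 0 r0 - {0}" for z
        using sphere_strictly_below[OF l P] sub0 that by blast
    qed (use r0 in auto)
    have wlim: "(\<lambda>n. kelvin x l u (y' n)) \<longlonglongrightarrow> kelvin x l u q"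
      by (rule tendsto_kelvin[OF tendsto_const lim(2) qx l(1) u_cont[OF Iq]])
    have "(\<lambda>n. kelvin x (\<mu>' n) u (y' n) - kelvin x l u (y' n)) \<longlonglongrightarrow> 0"
      using tendsto_diff[OF klim wlim] by simp
    then have "\<forall>\<^sub>F n in sequentially. kelvin x (\<mu>' n) u (y' n) - kelvin x l u (y' n) < c"
      using c(1) by (rule order_tendstoD)
    moreover have "\<forall>\<^sub>F n in sequentially. y' n \<in> ball 0 r"
      using lim(2) c(2) 1 by (intro topological_tendstoD) auto
    ultimately have "\<forall>\<^sub>F n in sequentially. False"
    proof eventually_elim
      case (elim n)
      then show ?case using c(3)[of "y' n"] bad'(3,4)[of n] by auto
    qed
    then show False by simp
  next
    case 2
    have "q \<in> ball 0 1 - cball x l - {0}" using 2 q(1) by (auto simp: dist_norm norm_minus_commute)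
    then have "kelvin x l u q < u q" by (rule sphere_strictly_below[OF l P])
    moreover have "q \<in> D" using 2 q(1) by auto
    then have "(\<lambda>n. u (y' n)) \<longlonglongrightarrow> u q" by (rule isCont_tendsto_compose[OF u_cont lim(2)])
    then have "u q \<le> kelvin x l u q"
      by (rule LIMSEQ_le[OF _ klim]) (use bad'(3) less_imp_le in blast)
    ultimately show False by simp
  next
    case 3
    have "q \<in> ball x \<Lambda>" using 3 l by (simp add: dist_norm norm_minus_commute)
    then have qD: "q \<in> D" using ball_subset_D by blast
    have "\<forall>\<^sub>F z in nhds q. 0 < rate z"
      using rate_cont[OF qD] rate_pos_on_sphere[OF l P 3]
      by (intro order_tendstoD) (auto simp: isCont_def tendsto_at_iff_tendsto_nhds)
    moreover have "\<forall>\<^sub>F z in nhds q. z \<in> D" using qD by (intro eventually_nhds_in_open) auto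
    ultimately have "\<forall>\<^sub>F z in nhds q. z \<in> D \<and> 0 < rate z" by eventually_elim simp
    then obtain d where d: "0 < d" "\<And>z. dist z q < d \<Longrightarrow> z \<in> D \<and> 0 < rate z"
      unfolding eventually_nhds_metric by blast
    have "inversion x l q = q"
      using 3 l qx by (simp add: inversion_def power2_norm_eq_inner[symmetric])
    then have "(\<lambda>n. inversion x (\<mu>' n) (y' n)) \<longlonglongrightarrow> q"
      using tendsto_inversion[OF lim qx] by simp
    then have "\<forall>\<^sub>F n in sequentially. inversion x (\<mu>' n) (y' n) \<in> ball q d"
      using d(1) by (intro topological_tendstoD) auto
    moreover have "\<forall>\<^sub>F n in sequentially. y' n \<in> ball q d"
      using lim(2) d(1) by (intro topological_tendstoD) auto
    ultimately have "\<forall>\<^sub>F n in sequentially. False"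
    proof eventually_elim
      case (elim n)
      let ?z = "y' n - x" and ?\<tau> = "(\<mu>' n)\<^sup>2 / ((y' n - x) \<bullet> (y' n - x))"
      have "kelvin x (\<mu>' n) u (y' n) \<le> u (y' n)"
      proof (rule kelvin_le_of_rate_nonneg)
        show "0 < \<mu>' n" using bad'(1)[of n] l by simp
        fix t assume t: "?\<tau> \<le> t" "t \<le> 1"
        have "x + t *\<^sub>R ?z \<in> closed_segment (inversion x (\<mu>' n) (y' n)) (y' n)"
        proof (cases "?\<tau> = 1")
          case True
          then have "t = 1" using t by linarith
          then show ?thesis by simp
        next
          case False
          then have \<tau>: "?\<tau> < 1" using t by linarith
          define \<sigma> where "\<sigma> = (t - ?\<tau>) / (1 - ?\<tau>)"
          have q: "0 \<le> (t - r) / (1 - r)" "(t - r) / (1 - r) \<le> 1" "(t - r) / (1 - r) * (1 - r) = t - r"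
            if "r < 1" "r \<le> t" for r
            using that t(2) by (auto simp: divide_le_eq)
          have \<sigma>: "0 \<le> \<sigma>" "\<sigma> \<le> 1" unfolding \<sigma>_def by (rule q[OF \<tau> t(1)])+
          have "\<sigma> * (1 - ?\<tau>) = t - ?\<tau>" unfolding \<sigma>_def by (rule q[OF \<tau> t(1)])
          then have st: "(1 - \<sigma>) * ?\<tau> + \<sigma> = t" unfolding right_diff_distrib left_diff_distrib by linarith
          have "(1 - \<sigma>) *\<^sub>R inversion x (\<mu>' n) (y' n) + \<sigma> *\<^sub>R y' n = x + ((1 - \<sigma>) * ?\<tau> + \<sigma>) *\<^sub>R ?z"
            unfolding inversion_def by (simp only: scaleR_add_right scaleR_add_left scaleR_scaleR scaleR_diff_left scaleR_diff_right scaleR_one) simp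
          then show ?thesis unfolding st in_segment using \<sigma> by (intro exI[of _ \<sigma>]) auto
        qed
        also have "\<dots> \<subseteq> ball q d" using elim by (intro closed_segment_subset) auto
        finally show "x + t *\<^sub>R ?z \<in> D \<and> 0 \<le> rate (x + t *\<^sub>R ?z)"
          using d(2)[of "x + t *\<^sub>R ?z"] by (auto simp: dist_commute)
      qed (rule bad')
      then show ?case using bad'(3)[of n] by simp
    qed
    then show False by simp
  qed
qed

lemma all_spheres_below:
  assumes "0 < l" "l < \<Lambda>" shows "sphere_below l"
proof -
  obtain l0 where "0 < l0" "\<And>l. 0 < l \<Longrightarrow> l < l0 \<Longrightarrow> sphere_below l" using sphere_below_start by blast
  then show ?thesis
    by (rule continuous_induction[where \<Lambda> = \<Lambda>]) (use sphere_below_limit sphere_below_extend assms in blast)+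
qed

text \<open>If the rate were negative at \<open>y\<close>, then \<open>ray y\<close> would be larger just before 1 than at 1, which contradicts the
comparison for a radius slightly smaller than \<open>|y - x|\<close>.\<close>

lemma rate_nonneg:
  assumes y: "y \<in> ball x \<Lambda>" "y \<noteq> x"
  shows "0 \<le> rate y"
proof (rule ccontr)
  assume neg: "\<not> 0 \<le> rate y"
  have yD: "y \<in> D" using y ball_subset_D by blast
  have d: "(ray y has_real_derivative rate y) (at 1)"
    using ray_deriv[of 1 y] yD by simp
  then obtain e where e: "0 < e" "\<And>h. 0 < h \<Longrightarrow> h < e \<Longrightarrow> ray y 1 < ray y (1 - h)"
    using DERIV_neg_dec_left[OF d] neg by auto
  define h where "h = min (e / 2) (1 / 2)"
  have h: "0 < h" "h < e" "h < 1" using e by (auto simp: h_def)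
  let ?r = "norm (y - x)"
  have r: "0 < ?r" "?r < \<Lambda>" using y by (auto simp: dist_norm norm_minus_commute)
  define l where "l = ?r * sqrt (1 - h)"
  have l: "0 < l" "l < ?r" using r h by (auto simp: l_def)
  have "norm y < 1" "y \<noteq> 0"
    using norm_triangle_ineq[of "y - x" x] r center yD by auto
  then have "kelvin x l u y \<le> u y"
    using all_spheres_below[of l] l r by (simp add: sphere_below_def)
  moreover have "l\<^sup>2 / ((y - x) \<bullet> (y - x)) = 1 - h"
    using r h by (simp add: l_def power_mult_distrib power2_norm_eq_inner[symmetric])
  ultimately show False using e(2)[OF h(1,2)] by (simp add: kelvin_eq_ray ray_one)
qed

end

section \<open>Nearly flat points\<close>

text \<open>The gradient bound gives \<open>|u - T| \<le> \<epsilon> T\<close> on the ball, so \<open>u + b |y - x|\<^sup>2\<close> with \<open>b = 2 \<epsilon> T / a\<^sup>2\<close> is larger on the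
sphere than at the center and has an interior minimum. There the Hessian plus \<open>2 b I\<close> is positive semidefinite with
trace at most \<open>2 n b\<close>, which bounds the Hessian. The choice of \<open>a\<close> makes all powers of \<open>T\<close> cancel
(\<open>scale1\<close>, \<open>scale2\<close>).\<close>

lemma nearly_flat_point:
  fixes u :: "real^'n \<Rightarrow> real"
  assumes dim: "CARD('n) \<ge> 3"
  defines "n \<equiv> real CARD('n)"
  defines "k \<equiv> n - 2"
  assumes so: "second_order_on V u G H" and sym: "\<And>y. y \<in> V \<Longrightarrow> H y \<in> sym_mats"
    and super: "\<And>y. y \<in> V \<Longrightarrow> (\<Sum>i\<in>UNIV. H y $ i $ i) \<le> 0"
    and T: "0 < T" "u x = T" and a: "a = T powr (- 2 / k)" and sub: "cball x a \<subseteq> V"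
    and \<epsilon>: "0 < \<epsilon>" "\<epsilon> \<le> 1 / 2" and grad: "\<And>y. y \<in> cball x a \<Longrightarrow> norm (G y) \<le> \<epsilon> * T / a"
  obtains y where "y \<in> ball x a"
    "norm (conf_op (u y) (G y) (H y)) \<le>
       (16 * n^3 / k * 2 powr ((n + 2) / k) + 4 * n^3 / k\<^sup>2 * 2 powr (2 * n / k)) * \<epsilon>"
proof -
  have k: "0 < k" and n: "0 < n" and nk: "n = k + 2" using dim by (simp_all add: n_def k_def)
  have a0: "0 < a" using T by (simp add: a)
  have near: "\<bar>u y - T\<bar> \<le> \<epsilon> * T" if y: "y \<in> cball x a" for y
  proof -
    have "norm (u y - u x) \<le> (\<epsilon> * T / a) * norm (y - x)"
    proof (rule differentiable_bound[where S = "cball x a" and f = u and f' = "\<lambda>y v. G y \<bullet> v"])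
      show "(u has_derivative (\<lambda>v. G y \<bullet> v)) (at y within cball x a)" if "y \<in> cball x a" for y
        using second_order_onD(2)[OF so] sub that has_derivative_at_withinI by blast
      show "onorm (\<lambda>v. G y \<bullet> v) \<le> \<epsilon> * T / a" if "y \<in> cball x a" for y
      proof (rule onorm_le)
        fix v show "norm (G y \<bullet> v) \<le> \<epsilon> * T / a * norm v"
          using Cauchy_Schwarz_ineq2[of "G y" v] mult_right_mono[OF grad[OF that] norm_ge_zero[of v]] by simp
      qed
    qed (use y a0 in auto)
    also have "\<dots> \<le> (\<epsilon> * T / a) * a"
      using y \<epsilon> T a0 by (intro mult_left_mono) (auto simp: dist_norm norm_minus_commute)
    finally show ?thesis using a0 T(2) by simp
  qed
  define b where "b = 2 * \<epsilon> * T / a\<^sup>2"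
  define q where "q = (\<lambda>y. u y + b * (norm (y - x))\<^sup>2)"
  have qso: "second_order_on V q (\<lambda>y. G y + b *\<^sub>R (2 *\<^sub>R (y - x))) (\<lambda>y. H y + b *\<^sub>R mat 2)"
    unfolding q_def
    by (intro second_order_on_add second_order_on_cmul second_order_on_square so second_order_onD(1)[OF so])
  have xa: "x \<in> cball x a" using a0 by simp
  obtain y where y: "y \<in> cball x a" "\<And>z. z \<in> cball x a \<Longrightarrow> q y \<le> q z"
    using continuous_attains_inf[OF compact_cball _ continuous_on_subset[OF second_order_on_continuous(1)[OF qso] sub]] xa
    by blast
  have "dist x y \<noteq> a"
  proof
    assume "dist x y = a"
    then have "q y = u y + 2 * (\<epsilon> * T)" using a0 by (simp add: q_def b_def dist_norm norm_minus_commute)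
    moreover have "T - \<epsilon> * T \<le> u y" using near[OF y(1)] by (simp add: abs_le_iff)
    moreover have "q x = T" using T by (simp add: q_def)
    moreover have "0 < \<epsilon> * T" using \<epsilon> T by simp
    ultimately show False using y(2)[OF xa] by linarith
  qed
  then have yb: "y \<in> ball x a" using y(1) by simp
  have yV: "y \<in> V" using y(1) sub by blast
  let ?N = "H y + b *\<^sub>R mat 2"
  have bsub: "ball x a \<subseteq> V" using sub by auto
  have "0 \<le> v \<bullet> (?N *v v)" for v
    by (rule second_order_on_min(2)[OF second_order_on_subset[OF qso open_ball bsub] yb]) (use y(2) in auto)
  moreover have "?N \<in> sym_mats"
    by (intro subspace_add subspace_scale subspace_sym_mats sym[OF yV]) simp
  ultimately have psd: "pos_semidef ?N" by (simp add: pos_semidef_def)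
  have b0: "0 \<le> b" using \<epsilon> T by (simp add: b_def)
  have "(\<Sum>i\<in>UNIV. ?N $ i $ i) = (\<Sum>i\<in>UNIV. H y $ i $ i) + n * (2 * b)"
    by (simp add: mat_def sum.distrib n_def)
  also have "\<dots> \<le> n * (2 * b)" using super[OF yV] by simp
  finally have "n\<^sup>2 * (\<Sum>i\<in>UNIV. ?N $ i $ i) \<le> n\<^sup>2 * (n * (2 * b))" by (intro mult_left_mono) auto
  also have "n\<^sup>2 * (n * (2 * b)) = 2 * n^3 * b" by (simp add: power2_eq_square power3_eq_cube)
  finally have N: "norm ?N \<le> 2 * n^3 * b"
    by (rule order_trans[OF norm_matrix_le_trace[OF psd, folded n_def]])
  have two: "b *\<^sub>R (mat 2 :: real^'n^'n) = (2 * b) *\<^sub>R mat 1" by (simp add: mat_def vec_eq_iff)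
  have "norm (H y) \<le> norm ?N + norm (b *\<^sub>R (mat 2 :: real^'n^'n))"
    using norm_triangle_ineq4[of ?N "b *\<^sub>R mat 2"] by simp
  also have "norm (b *\<^sub>R (mat 2 :: real^'n^'n)) \<le> 2 * b * n^3"
    unfolding two using norm_mat_le[where 'n = 'n] b0 by (simp add: n_def mult_left_mono)
  finally have Hn: "norm (H y) \<le> 4 * n^3 * b" using N by (simp add: mult_ac)
  have ulow: "T / 2 \<le> u y"
  proof -
    have "\<epsilon> * T \<le> 1 / 2 * T" using \<epsilon> T by (intro mult_right_mono) auto
    then show ?thesis using near[OF y(1)] by (simp add: abs_le_iff)
  qed
  have upow: "u y powr (- e) \<le> 2 powr e * T powr (- e)" if "0 \<le> e" for e
  proof -
    have "u y powr (- e) \<le> (T / 2) powr (- e)" using ulow T that by (intro powr_mono2') auto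
    also have "\<dots> = 2 powr e * T powr (- e)" using T by (simp add: powr_divide powr_minus_divide)
    finally show ?thesis .
  qed
  have a2: "1 / a\<^sup>2 = T powr (4 / k)"
  proof -
    have "a\<^sup>2 = T powr (- (4 / k))"
      unfolding a power2_eq_square powr_add[symmetric] by simp
    then show ?thesis by (simp add: powr_minus_divide)
  qed
  have scale1: "T powr (- ((n + 2) / k)) * (T / a\<^sup>2) = 1"
  proof -
    have "T powr (- ((n + 2) / k)) * (T / a\<^sup>2) = T powr (- ((n + 2) / k)) * (T powr 1 * T powr (4 / k))"
      unfolding a2[symmetric] using T by simp
    also have "\<dots> = T powr (- ((n + 2) / k) + (1 + 4 / k))" by (simp only: powr_add)
    also have "- ((n + 2) / k) + (1 + 4 / k) = 0" using k by (simp add: nk field_simps)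
    finally show ?thesis using T by simp
  qed
  have scale2: "T powr (- (2 * n / k)) * (T / a)\<^sup>2 = 1"
  proof -
    have "T powr (- (2 * n / k)) * (T / a)\<^sup>2 = T powr (- (2 * n / k)) * (T powr 2 * T powr (4 / k))"
      unfolding a2[symmetric] using T by (simp add: power_divide)
    also have "\<dots> = T powr (- (2 * n / k) + (2 + 4 / k))" by (simp only: powr_add)
    also have "- (2 * n / k) + (2 + 4 / k) = 0" using k by (simp add: nk field_simps)
    finally show ?thesis using T by simp
  qed
  let ?p = "u y powr (- ((n + 2) / k))" and ?r = "u y powr (- (2 * n / k))"
  have t1: "?p * norm (H y) \<le> 8 * n^3 * 2 powr ((n + 2) / k) * \<epsilon>"
  proof -
    have "?p * norm (H y) \<le> (2 powr ((n + 2) / k) * T powr (- ((n + 2) / k))) * (4 * n^3 * b)"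
      using n k Hn b0 by (intro mult_mono upow) auto
    also have "\<dots> = 8 * n^3 * 2 powr ((n + 2) / k) * \<epsilon> * (T powr (- ((n + 2) / k)) * (T / a\<^sup>2))"
      by (simp add: b_def)
    finally show ?thesis unfolding scale1 by simp
  qed
  have t2: "?r * (norm (G y))\<^sup>2 \<le> 2 powr (2 * n / k) * \<epsilon>"
  proof -
    have "(norm (G y))\<^sup>2 \<le> (\<epsilon> * T / a)\<^sup>2" using grad[OF y(1)] by (intro power_mono) auto
    then have "?r * (norm (G y))\<^sup>2 \<le> (2 powr (2 * n / k) * T powr (- (2 * n / k))) * (\<epsilon> * T / a)\<^sup>2"
      using n k by (intro mult_mono upow) auto
    also have "\<dots> = 2 powr (2 * n / k) * (\<epsilon> * \<epsilon>) * (T powr (- (2 * n / k)) * (T / a)\<^sup>2)"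
      by (simp add: power_divide power_mult_distrib power2_eq_square)
    also have "\<dots> \<le> 2 powr (2 * n / k) * \<epsilon>"
    proof -
      have "\<epsilon> * \<epsilon> \<le> \<epsilon> * 1" using \<epsilon> by (intro mult_left_mono) auto
      then show ?thesis unfolding scale2 by simp
    qed
    finally show ?thesis .
  qed
  have "norm (conf_op (u y) (G y) (H y)) \<le> norm ((- (2 / k) * ?p) *\<^sub>R H y)
      + norm ((2 * n / k\<^sup>2 * ?r) *\<^sub>R tensor (G y) (G y))
      + norm ((2 / k\<^sup>2 * ?r * (norm (G y))\<^sup>2) *\<^sub>R (mat 1 :: real^'n^'n))"
    unfolding conf_op_def Let_def n_def[symmetric] k_def[symmetric]
    by (rule order_trans[OF norm_triangle_ineq4]) (intro add_right_mono norm_triangle_ineq)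
  also have "norm ((- (2 / k) * ?p) *\<^sub>R H y) = 2 / k * (?p * norm (H y))"
    using k by simp
  also have "\<dots> \<le> 2 / k * (8 * n^3 * 2 powr ((n + 2) / k) * \<epsilon>)"
    using k by (intro mult_left_mono t1) auto
  also have "norm ((2 * n / k\<^sup>2 * ?r) *\<^sub>R tensor (G y) (G y)) \<le> (2 * n / k\<^sup>2 * ?r) * (n\<^sup>2 * (norm (G y))\<^sup>2)"
    using n norm_tensor_le[of "G y"] by (simp add: n_def mult_left_mono divide_right_mono)
  also have "\<dots> = 2 * n^3 / k\<^sup>2 * (?r * (norm (G y))\<^sup>2)" by (simp add: power2_eq_square power3_eq_cube)
  also have "\<dots> \<le> 2 * n^3 / k\<^sup>2 * (2 powr (2 * n / k) * \<epsilon>)" using n by (intro mult_left_mono t2) auto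
  also have "norm ((2 / k\<^sup>2 * ?r * (norm (G y))\<^sup>2) *\<^sub>R (mat 1 :: real^'n^'n)) \<le> (2 / k\<^sup>2 * ?r * (norm (G y))\<^sup>2) * n^3"
    using norm_mat_le[where 'n = 'n] by (simp add: n_def mult_left_mono divide_right_mono)
  also have "\<dots> = 2 * n^3 / k\<^sup>2 * (?r * (norm (G y))\<^sup>2)" by simp
  also have "\<dots> \<le> 2 * n^3 / k\<^sup>2 * (2 powr (2 * n / k) * \<epsilon>)" using n by (intro mult_left_mono t2) auto
  finally have "norm (conf_op (u y) (G y) (H y)) \<le> 2 / k * (8 * n^3 * 2 powr ((n + 2) / k) * \<epsilon>)
     + 2 * n^3 / k\<^sup>2 * (2 powr (2 * n / k) * \<epsilon>) + 2 * n^3 / k\<^sup>2 * (2 powr (2 * n / k) * \<epsilon>)" by simp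
  also have "\<dots> = (16 * n^3 / k * 2 powr ((n + 2) / k) + 4 * n^3 / k\<^sup>2 * 2 powr (2 * n / k)) * \<epsilon>"
    by (simp add: algebra_simps)
  finally show ?thesis using yb by (rule that[rotated])
qed

section \<open>The singularity estimate\<close>

text \<open>The point \<open>x\<close> maximizes \<open>(R - |z - y|) powr e * u z\<close>. On the ball of radius \<open>\<sigma> / 2\<close> about
\<open>x\<close>, where \<open>\<sigma>\<close> is the distance from \<open>x\<close> to the boundary, the weight drops at most by the factor \<open>2 powr e\<close>.\<close>

lemma doubling:
  fixes u :: "real^'n \<Rightarrow> real"
  assumes cont: "continuous_on (cball y R) u" and pos: "\<And>z. z \<in> cball y R \<Longrightarrow> 0 < u z"
    and R: "0 < R" and e: "0 < e"
  obtains x \<sigma> where "x \<in> cball y R" "\<sigma> = R - dist x y" "0 < \<sigma>" "R powr e * u y \<le> \<sigma> powr e * u x"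
    "\<And>z. z \<in> ball x (\<sigma> / 2) \<Longrightarrow> u z \<le> 2 powr e * u x"
proof -
  let ?\<phi> = "\<lambda>z. (R - dist z y) powr e * u z"
  have "continuous_on (cball y R) ?\<phi>"
    by (intro continuous_on_mult cont continuous_on_powr' continuous_intros) (use e in \<open>auto simp: dist_commute\<close>)
  moreover have "y \<in> cball y R" using R by simp
  ultimately obtain x where x: "x \<in> cball y R" "\<And>z. z \<in> cball y R \<Longrightarrow> ?\<phi> z \<le> ?\<phi> x"
    using continuous_attains_sup[OF compact_cball] by blast
  have yx: "R powr e * u y \<le> ?\<phi> x" using x(2)[of y] R by simp
  moreover have "0 < R powr e * u y" using R pos[of y] by simp
  ultimately have "0 < ?\<phi> x" by linarith
  then have "R - dist x y \<noteq> 0" by (metis mult_zero_left powr_0 less_irrefl)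
  then have \<sigma>: "0 < R - dist x y" using x(1) by (simp add: dist_commute)
  show ?thesis
  proof (rule that[OF x(1) refl \<sigma> yx])
    fix z assume z: "z \<in> ball x ((R - dist x y) / 2)"
    have half: "(R - dist x y) / 2 \<le> R - dist z y"
      using z dist_triangle[of z y x] by (simp add: dist_commute field_simps)
    then have zR: "z \<in> cball y R" using \<sigma> by (simp add: dist_commute)
    have "((R - dist x y) / 2) powr e * u z \<le> ?\<phi> z"
      using half \<sigma> e pos[OF zR] by (intro mult_right_mono powr_mono2) auto
    also have "\<dots> \<le> ?\<phi> x" by (rule x(2)[OF zR])
    finally have "(R - dist x y) powr e * (u z / 2 powr e) \<le> (R - dist x y) powr e * u x"
      using \<sigma> by (simp add: powr_divide)
    then have "u z / 2 powr e \<le> u x" by (rule mult_left_le_imp_le) (use \<sigma> in simp)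
    then show "u z \<le> 2 powr e * u x" by (simp add: field_simps)
  qed
qed

context conformal_equation
begin

text \<open>\<open>rate_nonneg\<close> is applied at \<open>z\<close> with the center at distance \<open>\<Lambda> / 2\<close> from \<open>z\<close> in the direction of the gradient.\<close>

lemma gradient_estimate:
  assumes sol: "solution_on (ball 0 2 - {0}) u G H"
    and super: "\<And>y. y \<in> ball 0 2 - {0} \<Longrightarrow> (\<Sum>i\<in>UNIV. H y $ i $ i) \<le> 0"
    and low: "\<And>y. y \<in> ball 0 1 - {0} \<Longrightarrow> c\<^sub>0 \<le> u y"
    and \<Lambda>: "0 < \<Lambda>" "3 * \<Lambda> \<le> norm x\<^sub>0" "norm x\<^sub>0 + 3 * \<Lambda> \<le> 1 / 4"
    and up: "\<And>y. y \<in> ball x\<^sub>0 (3 * \<Lambda>) \<Longrightarrow> u y \<le> S"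
    and small: "(4 * \<Lambda>) powr (real CARD('n) - 2) * S < c\<^sub>0"
    and z: "z \<in> ball x\<^sub>0 \<Lambda>"
  shows "norm (G z) \<le> (real CARD('n) - 2) / \<Lambda> * u z"
proof (cases "G z = 0")
  case True
  have "ball x\<^sub>0 \<Lambda> \<subseteq> ball 0 2 - {0}"
    by (rule ball_subset_punctured_ball) (use \<Lambda> in linarith)+
  then have "z \<in> ball 0 2 - {0}" using z by blast
  then show ?thesis using True solution_onD(2)[OF sol, of z] dim \<Lambda> by simp
next
  case False
  define e where "e = (1 / norm (G z)) *\<^sub>R G z"
  have e: "norm e = 1" "G z \<bullet> e = norm (G z)"
    using False by (simp_all add: e_def power2_norm_eq_inner[symmetric] power2_eq_square)
  define x where "x = z + (\<Lambda> / 2) *\<^sub>R e"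
  have zx: "z - x = - (\<Lambda> / 2) *\<^sub>R e" by (simp add: x_def)
  have dzx: "norm (z - x) = \<Lambda> / 2" unfolding zx using e \<Lambda> by simp
  have dx: "norm (x - x\<^sub>0) < 3 / 2 * \<Lambda>"
    using norm_triangle_ineq4[of "z - x\<^sub>0" "z - x"] dzx z by (simp add: dist_norm norm_minus_commute)
  interpret moving_spheres U F dF u G H x \<Lambda> S c\<^sub>0
  proof unfold_locales
    show "\<Lambda> \<le> norm x" using norm_triangle_ineq4[of x "x - x\<^sub>0"] dx \<Lambda> by simp
    show "norm x + \<Lambda> \<le> 1 / 4" using norm_triangle_ineq[of "x - x\<^sub>0" "x\<^sub>0"] dx \<Lambda> by simp
    fix y assume "y \<in> ball x \<Lambda>"
    then have "norm (y - x\<^sub>0) < 3 * \<Lambda>"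
      using norm_triangle_ineq[of "y - x" "x - x\<^sub>0"] dx \<Lambda> by (simp add: dist_norm norm_minus_commute)
    then show "u y \<le> S" by (intro up) (simp add: dist_norm norm_minus_commute)
  qed (use sol super low \<Lambda> small in auto)
  have "0 \<le> rate z"
    by (rule rate_nonneg) (use dzx \<Lambda> in \<open>auto simp: dist_norm norm_minus_commute\<close>)
  then have "\<Lambda> / 2 * norm (G z) \<le> k / 2 * u z"
    unfolding rate_def zx using e by simp
  then show ?thesis using \<Lambda> by (simp add: k_def field_simps)
qed

text \<open>The constants are chosen in the order \<open>\<epsilon>\<close> (making the nearly flat matrix smaller than \<open>\<delta>\<close>), \<open>L\<close> (making the gradient
bound at scale \<open>\<Lambda> = L a\<close> at most \<open>\<epsilon> T / a\<close>), and \<open>K'\<close>. Exceeding the first part of \<open>K'\<close> forces \<open>6 \<Lambda> \<le> \<sigma>\<close>, so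
that all spheres used lie in the region where \<open>u\<close> is controlled; exceeding the second part makes \<open>T\<close> so large that
the Kelvin transforms stay below \<open>c\<^sub>0\<close>.\<close>

lemma growth_bound:
  assumes sol: "solution_on (ball 0 2 - {0}) u G H"
    and super: "\<And>y. y \<in> ball 0 2 - {0} \<Longrightarrow> (\<Sum>i\<in>UNIV. H y $ i $ i) \<le> 0"
    and F_small: "0 < \<delta>" "\<And>M. M \<in> U \<Longrightarrow> norm M < \<delta> \<Longrightarrow> F M \<noteq> 1"
  obtains K where "\<And>y. 0 < norm y \<Longrightarrow> norm y < 1 / 8 \<Longrightarrow> norm y powr ((real CARD('n) - 2) / 2) * u y \<le> K"
proof -
  let ?D = "ball 0 2 - {0 :: real^'n}"
  define n where "n = real CARD('n)"
  define k where "k = n - 2"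
  have k: "0 < k" and n: "0 < n" using dim by (simp_all add: n_def k_def)
  note so = solution_onD(1)[OF sol]
  note cont = second_order_on_continuous(1)[OF so]
  obtain c\<^sub>0 where c0: "0 < c\<^sub>0" "\<And>y. y \<in> ball 0 1 - {0} \<Longrightarrow> c\<^sub>0 \<le> u y"
  proof -
    have sub: "sphere 0 1 \<subseteq> ?D" by auto
    have "sphere (0 :: real^'n) 1 \<noteq> {}" by simp
    then obtain m where m: "m \<in> sphere 0 1" "\<And>y. y \<in> sphere 0 1 \<Longrightarrow> u m \<le> u y"
      using continuous_attains_inf[OF compact_sphere _ continuous_on_subset[OF cont sub]] by blast
    have "u m \<le> u y" if "y \<in> ball 0 1 - {0}" for y
      by (rule superharmonic_minimum_principle[OF dim so super, of 0 1])
        (use that m solution_onD(2)[OF sol] in \<open>auto intro: less_imp_le\<close>)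
    moreover have "0 < u m" by (rule solution_onD(2)[OF sol subsetD[OF sub m(1)]])
    ultimately show ?thesis by (intro that[of "u m"])
  qed
  define C where "C = 16 * n^3 / k * 2 powr ((n + 2) / k) + 4 * n^3 / k\<^sup>2 * 2 powr (2 * n / k)"
  have C: "0 < C" using k n by (simp add: C_def add_pos_pos)
  define \<epsilon> where "\<epsilon> = min (1 / 2) (\<delta> / (2 * C))"
  have \<epsilon>: "0 < \<epsilon>" "\<epsilon> \<le> 1 / 2" "C * \<epsilon> < \<delta>"
  proof -
    show "0 < \<epsilon>" "\<epsilon> \<le> 1 / 2" using C F_small by (auto simp: \<epsilon>_def)
    have "C * \<epsilon> \<le> C * (\<delta> / (2 * C))" using C by (intro mult_left_mono) (auto simp: \<epsilon>_def)
    also have "\<dots> < \<delta>" using C F_small(1) by simp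
    finally show "C * \<epsilon> < \<delta>" .
  qed
  define L where "L = max 2 (k * 2 powr (k / 2) / \<epsilon>)"
  have L: "2 \<le> L" "k * 2 powr (k / 2) \<le> \<epsilon> * L"
  proof -
    show "2 \<le> L" by (simp add: L_def)
    have "k * 2 powr (k / 2) / \<epsilon> \<le> L" by (simp add: L_def)
    then show "k * 2 powr (k / 2) \<le> \<epsilon> * L" using \<epsilon>(1) by (simp add: field_simps)
  qed
  define K' where "K' = max ((6 * L) powr (k / 2)) ((4 * L) powr k * 2 powr (k / 2) / c\<^sub>0)"
  have K'1: "(6 * L) powr (k / 2) \<le> K'" and K'2: "(4 * L) powr k * 2 powr (k / 2) / c\<^sub>0 \<le> K'"
    by (simp_all add: K'_def)
  have "norm y powr (k / 2) * u y \<le> 2 powr (k / 2) * K'" if y: "0 < norm y" "norm y < 1 / 8" for y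
  proof (rule ccontr)
    assume neg: "\<not> norm y powr (k / 2) * u y \<le> 2 powr (k / 2) * K'"
    define R where "R = norm y / 2"
    have R: "0 < R" "R < 1 / 16" using y by (auto simp: R_def)
    have sub: "cball y R \<subseteq> ?D"
    proof (rule order_trans)
      show "cball y R \<subseteq> ball y (norm y)" using y(1) unfolding R_def cball_subset_ball_iff dist_self by linarith
      show "ball y (norm y) \<subseteq> ?D" by (rule ball_subset_punctured_ball) (use y in linarith)+
    qed
    obtain x \<sigma> where x: "x \<in> cball y R" and \<sigma>: "\<sigma> = R - dist x y" "0 < \<sigma>"
      and grow: "R powr (k / 2) * u y \<le> \<sigma> powr (k / 2) * u x"
      and dbl: "\<And>z. z \<in> ball x (\<sigma> / 2) \<Longrightarrow> u z \<le> 2 powr (k / 2) * u x"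
      by (rule doubling[OF continuous_on_subset[OF cont sub] solution_onD(2)[OF sol subsetD[OF sub]] R(1), of "k / 2"])
        (use k in auto)
    define T where "T = u x"
    have T: "0 < T" unfolding T_def by (rule solution_onD(2)[OF sol subsetD[OF sub x]])
    have "2 powr (k / 2) * K' < norm y powr (k / 2) * u y" using neg by simp
    also have "norm y = 2 * R" by (simp add: R_def)
    also have "(2 * R) powr (k / 2) * u y = 2 powr (k / 2) * (R powr (k / 2) * u y)"
      using R by (simp add: powr_mult)
    finally have "K' < R powr (k / 2) * u y" by simp
    then have K': "K' < \<sigma> powr (k / 2) * T" using grow by (simp add: T_def)
    have \<sigma>1: "\<sigma> \<le> R" using \<sigma> by simp
    define a where "a = T powr (- 2 / k)"
    have a: "0 < a" using T by (simp add: a_def)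
    have "a powr (k / 2) = T powr (- 1)" "a powr k = T powr (- 2)"
      unfolding a_def powr_powr using k by simp_all
    moreover have "T powr (- 1) * T = 1" "T powr (- 2) * (T * T) = 1"
      using T by (simp_all add: powr_minus_divide power2_eq_square)
    ultimately have ak: "a powr (k / 2) * T = 1" "a powr k * (T * T) = 1" by simp_all
    define \<Lambda> where "\<Lambda> = L * a"
    have \<Lambda>: "0 < \<Lambda>" "a < \<Lambda>" using L a by (auto simp: \<Lambda>_def)
    have big: "6 * \<Lambda> \<le> \<sigma>"
    proof (rule ccontr)
      assume "\<not> 6 * \<Lambda> \<le> \<sigma>"
      then have "\<sigma> powr (k / 2) * T \<le> (6 * L * a) powr (k / 2) * T"
        using \<sigma> T k by (intro mult_right_mono powr_mono2) (auto simp: \<Lambda>_def)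
      also have "\<dots> = (6 * L) powr (k / 2) * (a powr (k / 2) * T)" using L a by (simp add: powr_mult)
      finally show False using K' K'1 ak by simp
    qed
    have "\<sigma> \<le> 1" using \<sigma>1 R by linarith
    then have "\<sigma> powr (k / 2) * T \<le> 1 * T"
      using \<sigma>(2) T k by (intro mult_right_mono powr_le1) auto
    then have TK: "K' < T" using K' by simp
    have xlow: "3 * \<Lambda> \<le> norm x" and xup: "norm x + 3 * \<Lambda> \<le> 1 / 4"
    proof -
      have "norm y \<le> norm x + dist x y" using norm_triangle_ineq4[of x "x - y"] by (simp add: dist_norm)
      moreover have "norm x \<le> norm y + dist x y" using norm_triangle_ineq[of "x - y" y] by (simp add: dist_norm)
      ultimately show "3 * \<Lambda> \<le> norm x" "norm x + 3 * \<Lambda> \<le> 1 / 4"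
        using big \<sigma> R y \<Lambda> by (auto simp: R_def)
    qed
    have small: "(4 * \<Lambda>) powr (real CARD('n) - 2) * (2 powr (k / 2) * T) < c\<^sub>0"
    proof -
      have "(4 * L) powr k * 2 powr (k / 2) < c\<^sub>0 * T"
        using K'2 TK c0(1) by (smt (verit) pos_divide_le_eq mult.commute mult_less_cancel_left_pos)
      then have "(4 * L) powr k * 2 powr (k / 2) * (a powr k * (T * T)) < c\<^sub>0 * T" using ak by simp
      then have "((4 * L) powr k * a powr k) * (2 powr (k / 2) * T) * T < c\<^sub>0 * T" by (simp add: mult_ac)
      then have "((4 * L) powr k * a powr k) * (2 powr (k / 2) * T) < c\<^sub>0" using T by simp
      moreover have "(4 * \<Lambda>) powr k = (4 * L) powr k * a powr k"
        using L a by (simp add: \<Lambda>_def powr_mult mult.assoc)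
      ultimately show ?thesis by (simp add: k_def n_def)
    qed
    have up: "u z \<le> 2 powr (k / 2) * T" if "z \<in> ball x (3 * \<Lambda>)" for z
      using dbl[of z] that big by (simp add: T_def)
    have ge: "norm (G z) \<le> \<epsilon> * T / a" if z: "z \<in> ball x \<Lambda>" for z
    proof -
      have "norm (G z) \<le> k / \<Lambda> * u z"
        using gradient_estimate[OF sol super c0(2) \<Lambda>(1) xlow xup up small z] by (simp add: k_def n_def)
      also have "\<dots> \<le> k / \<Lambda> * (2 powr (k / 2) * T)"
        using up[of z] z \<Lambda> k by (intro mult_left_mono) auto
      also have "\<dots> = (k * 2 powr (k / 2)) * T / (L * a)" by (simp add: \<Lambda>_def)
      also have "\<dots> \<le> (\<epsilon> * L) * T / (L * a)"
        using L a T by (intro divide_right_mono mult_right_mono) auto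
      also have "\<dots> = \<epsilon> * T / a" using L by simp
      finally show ?thesis .
    qed
    have sub2: "ball x \<Lambda> \<subseteq> ?D"
      by (rule ball_subset_punctured_ball) (use xlow xup \<Lambda>(1) in linarith)+
    have sub3: "cball x a \<subseteq> ball x \<Lambda>" using \<Lambda> by auto
    obtain z where z: "z \<in> ball x a" "norm (conf_op (u z) (G z) (H z)) \<le> C * \<epsilon>"
    proof (rule nearly_flat_point[OF dim second_order_on_subset[OF so open_ball sub2]])
      show "H z \<in> sym_mats" if "z \<in> ball x \<Lambda>" for z
        using solution_on_sym[OF sol] sub2 that by blast
      show "(\<Sum>i\<in>UNIV. H z $ i $ i) \<le> 0" if "z \<in> ball x \<Lambda>" for z
        using super sub2 that by blast
      show "a = T powr (- 2 / (real CARD('n) - 2))" by (simp add: a_def k_def n_def)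
      show "norm (G z) \<le> \<epsilon> * T / a" if "z \<in> cball x a" for z
        using ge sub3 that by blast
    qed (use T \<epsilon> sub3 that in \<open>auto simp: T_def C_def k_def n_def\<close>)
    have zD: "z \<in> ?D" using z(1) sub2 sub3 ball_subset_cball by blast
    have "norm (conf_op (u z) (G z) (H z)) < \<delta>" using z(2) \<epsilon>(3) by simp
    then show False using F_small(2) solution_onD(3,4)[OF sol zD] by blast
  qed
  then show ?thesis by (intro that[of "2 powr (k / 2) * K'"]) (simp add: k_def n_def)
qed

end

theorem theorem1:
  fixes U :: "(real^'n::finite^'n) set"
    and F :: "real^'n^'n \<Rightarrow> real"
    and u :: "real^'n \<Rightarrow> real"
  assumes n: "CARD('n) \<ge> 3"
    and U_open: "openin (top_of_set sym_mats) U"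
    and U_inv: "\<And>Q. orthogonal_matrix Q \<Longrightarrow> (\<lambda>M. matrix_inv Q ** M ** Q) ` U = U"
    and U_convex: "\<And>M N. M \<in> sym_mats \<Longrightarrow> pos_def N \<Longrightarrow>
                     convex (U \<inter> {M + t *\<^sub>R N |t. 0 < t})"
    and F_C1: "C1_on U F"
    and F_inv: "\<And>M Q. M \<in> U \<Longrightarrow> orthogonal_matrix Q \<Longrightarrow> F (matrix_inv Q ** M ** Q) = F M"
    and F_elliptic: "\<And>M. M \<in> U \<Longrightarrow> pos_def (mat_grad F M)"
    and F_small: "\<exists>\<delta>>0. \<forall>M\<in>U. norm M < \<delta> \<longrightarrow> F M \<noteq> 1"
    and u_C2: "C2_on (ball 0 2 - {0}) u"
    and u_pos: "\<And>x. x \<in> ball 0 2 - {0} \<Longrightarrow> 0 < u x"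
    and u_superharmonic: "\<And>x. x \<in> ball 0 2 - {0} \<Longrightarrow> laplacian u x \<le> 0"
    and u_in_U: "\<And>x. x \<in> ball 0 2 - {0} \<Longrightarrow> conf_hessian u x \<in> U"
    and u_eq: "\<And>x. x \<in> ball 0 2 - {0} \<Longrightarrow> F (conf_hessian u x) = 1"
  shows "Limsup (at 0) (\<lambda>y. ereal (norm y powr ((real CARD('n) - 2) / 2) * u y)) < \<infinity>"
proof -
  obtain dF :: "real^'n^'n \<Rightarrow> (real^'n^'n) \<Rightarrow>\<^sub>L real" where
    dF: "\<And>M. M \<in> U \<Longrightarrow> (F has_derivative blinfun_apply (dF M)) (at M within U)" "continuous_on U dF"
    using F_C1 unfolding C1_on_def by blast
  interpret conformal_equation U F dF
    by unfold_locales (fact n U_open U_convex dF F_elliptic U_inv F_inv)+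
  have "open (ball 0 2 - {0 :: real^'n})" by auto
  from C2_on_imp_second_order_on[OF u_C2 this] obtain G H
    where so: "second_order_on (ball 0 2 - {0}) u G H" .
  have sol: "solution_on (ball 0 2 - {0}) u G H"
    unfolding solution_on_def
  proof (intro conjI ballI so)
    fix y :: "real^'n" assume y: "y \<in> ball 0 2 - {0}"
    show "0 < u y" by (rule u_pos[OF y])
    have "conf_hessian u y = conf_op (u y) (G y) (transpose (H y))"
      unfolding conf_hessian_def conf_op_def grad_eq[OF so y] hessian_eq[OF so y] ..
    then have "transpose (H y) \<in> sym_mats"
      using second_derivative_in_sym_mats[OF n u_pos[OF y]] U_sym[OF u_in_U[OF y]] by metis
    then have "H y \<in> sym_mats" by (simp add: sym_mats_def)
    then have "conf_hessian u y = conf_op (u y) (G y) (H y)"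
      by (rule conf_hessian_eq[OF so y])
    then show "conf_op (u y) (G y) (H y) \<in> U" "F (conf_op (u y) (G y) (H y)) = 1"
      using u_in_U[OF y] u_eq[OF y] by simp_all
  qed
  have super: "(\<Sum>i\<in>UNIV. H y $ i $ i) \<le> 0" if "y \<in> ball 0 2 - {0}" for y
    using u_superharmonic[OF that] laplacian_eq[OF so that] by simp
  obtain \<delta> where "0 < \<delta>" "\<And>M. M \<in> U \<Longrightarrow> norm M < \<delta> \<Longrightarrow> F M \<noteq> 1" using F_small by blast
  from growth_bound[OF sol super this] obtain K where
    K: "\<And>y. 0 < norm y \<Longrightarrow> norm y < 1 / 8 \<Longrightarrow> norm y powr ((real CARD('n) - 2) / 2) * u y \<le> K"
    by blast
  have "\<forall>\<^sub>F y in at 0. ereal (norm y powr ((real CARD('n) - 2) / 2) * u y) \<le> ereal K"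
    unfolding eventually_at using K by (intro exI[of _ "1 / 8"]) auto
  then have "Limsup (at 0) (\<lambda>y. ereal (norm y powr ((real CARD('n) - 2) / 2) * u y)) \<le> ereal K"
    by (rule Limsup_bounded)
  then show ?thesis by (rule le_less_trans) simp
qed

end
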